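(* Suppose there are $x^*\in X^*$ and constants $\mathcal L<\infty$, $\sigma_*$ such that for all $x\in X$ and all $t$ $$\mathbb E_{\xi_{t,1}}\big[\|\mathcal G(x,\xi_{t,1})-g(x)\|_*^2\big]\le \mathcal L\,[f(x)-f^*-\langle g(x^* ),x-x^*\rangle]+\sigma_*^2,$$ and suppose that for each $\xi\in\Xi$ there is $\mathcal K(\xi)>0$ with $\mathbb E_\xi[\mathcal K(\xi)^2]<\infty$ and $$\|\mathcal G(x,\xi)-\mathcal G(y,\xi)\|_*\le\mathcal K(\xi)\|x-y\|\qquad\forall x,y\in X.$$ Let $\bar{\mathcal K}:=\big(3\,\mathbb E_{\xi_{t,1}}[\mathcal K(\xi_{t,1})^2]+3L^2\big)^{1/2}$. Let $k\ge2$, let $D>0$ be such that $V(z_0,x^* )\le D^2$, and let $\{z_t\},\{y_t\},\{x_t\}$ be generated by the SAGD algorithm (see context) with $\beta_t=\frac3{t+2}$, $m_t=m$ and $\eta_t=\frac\eta{t+1}$, where $$\eta=\max\left\{4L,\ \frac{18(k+1)\mathcal L}m,\ 12\sqrt{\frac{k\bar{\mathcal K}^2}m},\ \frac{\sigma_*}D\sqrt{\frac{2(k+2)^3}m}\right\}.$$ Then $\mathbb E[V(z_t,x^* )]\le3D^2$ for $t=1,\dots,k$, and $$\mathbb E[f(x_k)-f^*]\le\frac{13LD^2}{(k+1)(k+2)}+\frac{54\mathcal LD^2}{(k+2)m}+\frac{72\bar{\mathcal K}D^2}{(k+2)\sqrt{(k+1)m}}+\frac{4\sigma_*D\sqrt6}{\sqrt{(k+1)m}}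 .$$
   Context: $E$ is a finite-dimensional Euclidean space with inner product $\langle\cdot,\cdot\rangle$, $\|\cdot\|$ is a (not necessarily Euclidean) norm on $E$, and $\|z\|_*=\sup\{\langle x,z\rangle:\|x\|\le 1\}$ is its dual norm. $X\subset E$ is closed and convex, $f:X\to\mathbb R$ is a smooth convex function with gradient $g=\nabla f$ that is Lipschitz continuous in the sense that for some $L\ge 0$: $0\le f(y)-f(x)-\langle g(x),y-x\rangle\le \frac L2\|y-x\|^2$ for all $x,y\in X$. The value $f^*=\min_{x\in X}f(x)$ is attained and $X^*\neq\emptyset$ is the set of minimizers. Stochastic oracle: for $x\in X$ and $\xi\in\Xi$ the oracle returns $\mathcal G(x,\xi)\in E$. The random variables $\xi_{t,i}$ ($t\ge 0$, $1\le i\le m_t$) are mutually independent and, for each $t$, identically distributed (with $\mathbb E[\mathcal K(\xi_{t,1})^2]$ not depending on $t$), and the oracle is unbiased: $\mathbb E_{\xi_{t,i}}[\mathcal G(x,\xi_{t,i})]=g(x)$ for all $x\in X$. $\omega:E\to\mathbb R$ (the distance generating function) is continuously differentiable and strongly convex with modulus $1$ with respect to $\|\cdot\|$, with $\omega(x)\ge\omega(0)=0$. For a fixed initial point $x_0$, the Bregman divergence is $V(x,y)=V_{x_0}(x,y)=\omega(y-x_0)-\omega(x-x_0)-\langle\nabla\omega(x-x_0),y-x\rangle$. SAGD algorithm (stochastic accelerated gradient descent). Input: a (deterministic) initial point $z_0=x_0\in X$, nonrandom parameters $\beta_t\in[0,1]$ and $\eta_t>0$, and batch sizes $m_t\in\{1,2,\dots\}$.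 For $t=1,2,\dots$: $$y_t=(1-\beta_t)x_{t-1}+\beta_tz_{t-1},\qquad G_t=\frac1{m_t}\sum_{i=1}^{m_t}\mathcal G(y_t,\xi_{t,i}),$$ $$z_t=\operatorname{argmin}_{z\in X}\{\langle G_t,z\rangle+\eta_tV(z_{t-1},z)\},\qquad x_t=(1-\beta_t)x_{t-1}+\beta_tz_t .$$
   Formalization: The constants 𝓛 and σ_* are assumed nonnegative; without this the stated bound can fail (for example X a single point and 𝓛 very negative, where the right-hand side is negative and the left-hand side is zero). *)

theory Defs
  imports "HOL-Probability.Probability"
begin

text \<open>An arbitrary norm on a Euclidean space, as a predicate: the type-class \<^const>\<open>norm\<close> is
  the Euclidean one.\<close>

definition is_norm :: "('a::real_vector \<Rightarrow> real) \<Rightarrow> bool" where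
  "is_norm N \<longleftrightarrow>
     (\<forall>x. N x = 0 \<longleftrightarrow> x = 0) \<and>
     (\<forall>a x. N (a *\<^sub>R x) = \<bar>a\<bar> * N x) \<and>
     (\<forall>x y. N (x + y) \<le> N x + N y)"

definition dual_norm :: "('a::real_inner \<Rightarrow> real) \<Rightarrow> 'a \<Rightarrow> real" where
  "dual_norm N z = (SUP x\<in>{x. N x \<le> 1}. x \<bullet> z)"

definition strongly_convex ::
  "('a::real_vector \<Rightarrow> real) \<Rightarrow> real \<Rightarrow> ('a \<Rightarrow> real) \<Rightarrow> bool" where
  "strongly_convex N \<mu> h \<longleftrightarrow>
     (\<forall>x y. \<forall>c\<in>{0..1}.
        h ((1 - c) *\<^sub>R x + c *\<^sub>R y)
          \<le> (1 - c) * h x + c * h y - \<mu> / 2 * c * (1 - c) * (N (x - y))\<^sup>2)"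

text \<open>In \<open>bregman\<close>, \<open>\<omega>'\<close> is the gradient map of \<open>\<omega>\<close>; this is assumed separately.\<close>

definition bregman ::
  "('a::real_inner \<Rightarrow> real) \<Rightarrow> ('a \<Rightarrow> 'a) \<Rightarrow> 'a \<Rightarrow> 'a \<Rightarrow> 'a \<Rightarrow> real" where
  "bregman \<omega> \<omega>' x0 x y = \<omega> (y - x0) - \<omega> (x - x0) - \<omega>' (x - x0) \<bullet> (y - x)"

definition minibatch :: "('a::real_vector \<Rightarrow> 's \<Rightarrow> 'a) \<Rightarrow> nat \<Rightarrow> (nat \<Rightarrow> 's) \<Rightarrow> 'a \<Rightarrow> 'a" where
  "minibatch G m s y = (1 / real m) *\<^sub>R (\<Sum>i=1..m. G y (s i))"

text \<open>One sample path of stochastic accelerated gradient descent: \<open>s t i\<close> is the realisation of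
  the \<open>i\<close>-th oracle sample of iteration \<open>t\<close>. The value \<open>y 0\<close> is irrelevant. The prox-step is
  stated as a relation, so nothing is presupposed about existence or uniqueness of minimisers.\<close>

definition sagd_run ::
  "'a::real_inner set \<Rightarrow> ('a \<Rightarrow> 'a \<Rightarrow> real) \<Rightarrow> ('a \<Rightarrow> 's \<Rightarrow> 'a) \<Rightarrow> 'a \<Rightarrow>
   (nat \<Rightarrow> real) \<Rightarrow> (nat \<Rightarrow> real) \<Rightarrow> (nat \<Rightarrow> nat) \<Rightarrow> (nat \<Rightarrow> nat \<Rightarrow> 's) \<Rightarrow>
   (nat \<Rightarrow> 'a) \<Rightarrow> (nat \<Rightarrow> 'a) \<Rightarrow> (nat \<Rightarrow> 'a) \<Rightarrow> bool" where
  "sagd_run X V G x0 \<beta> \<eta> m s x y z \<longleftrightarrow>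
     x 0 = x0 \<and> z 0 = x0 \<and>
     (\<forall>t\<ge>1.
        y t = (1 - \<beta> t) *\<^sub>R x (t - 1) + \<beta> t *\<^sub>R z (t - 1) \<and>
        is_arg_min (\<lambda>u. minibatch G (m t) (s t) (y t) \<bullet> u + \<eta> t * V (z (t - 1)) u)
          (\<lambda>u. u \<in> X) (z t) \<and>
        x t = (1 - \<beta> t) *\<^sub>R x (t - 1) + \<beta> t *\<^sub>R z t)"

end

theory Submission
  imports Defs
begin

text \<open>
  Pathwise, the prox-step inequality and the smoothness of \<open>f\<close> give the usual recursion for
  \<open>f x\<^sub>t - f\<^sup>*\<close> and \<open>V z\<^sub>t x\<^sup>*\<close>. The minibatch noise enters through the convex conjugate of the distance
  generating function over \<open>X\<close>, which is 1-smooth for the dual norm: adding the noise vectors one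
  after the other bounds it by a martingale difference plus the sum of the squared dual norms. Hence the
  factor \<open>1 / m\<close> appears without a constant depending on the norm.

  The variance at \<open>y\<^sub>t\<close> is compared with the variance at \<open>x\<^bsub>t-1\<^esub>\<close> by means of the Lipschitz constants
  of the oracle. The gap \<open>f x\<^bsub>t-1\<^esub> - f\<^sup>*\<close> is absorbed by the decrease of the weights, and
  \<open>\<parallel>z\<^bsub>t-1\<^esub> - x\<^bsub>t-1\<^esub>\<parallel>\<^sup>2\<close> is controlled by an induction that bounds \<open>E V z\<^sub>t x\<^sup>*\<close> by a function of \<open>t\<close> growing
  linearly up to \<open>3 D\<^sup>2\<close> at \<open>t = k\<close>.
\<close>

section \<open>Norms and dual norms\<close>

text \<open>The obstacle is that \<open>z t\<close> depends on the samples of its own iteration, so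
  the noise is not centred against it. The prox-step leaves a spare term
  \<open>\<eta>s t * V (z (t - 1)) (z t)\<close>. Because \<open>4 * L \<le> \<eta>\<close>, three
  quarters of it pay for smoothness; the last quarter is the quadratic term against which the noise
  is conjugated. The conjugate inequality tolerates a shift that is fixed before the minibatch is
  drawn. The shift \<open>g (y t) - g (x (t - 1))\<close> leaves the centred noise in the linear
  terms but puts \<open>G (y t) - g (x (t - 1))\<close> into the squares. That vector is the oracle
  error at \<open>x (t - 1)\<close> plus one oracle difference, so comparing variances costs only
  \<open>K\<close>. Scaling the recursion by \<open>(t + 1) * (t + 2) / (3 * \<eta>)\<close> gives
  the divergence weight one. The gap then loses the weight \<open>(t + 2) / (3 * \<eta>)\<close> in
  the next step, and the entry with \<open>LL\<close> in the step-size rule is the size at which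
  this loss covers the noise proportional to the gap.\<close>

lemma is_norm_zero: "is_norm N \<Longrightarrow> N 0 = 0"
  by (simp add: is_norm_def)

lemma is_norm_scaleR: "is_norm N \<Longrightarrow> N (a *\<^sub>R x) = \<bar>a\<bar> * N x"
  by (simp add: is_norm_def)

lemma is_norm_triangle: "is_norm N \<Longrightarrow> N (x + y) \<le> N x + N y"
  by (simp add: is_norm_def)

lemma is_norm_minus: "is_norm N \<Longrightarrow> N (- x) = N x"
  using is_norm_scaleR[of N "-1" x] by simp

lemma is_norm_diff_commute: "is_norm N \<Longrightarrow> N (x - y) = N (y - x)"
  using is_norm_minus[of N "x - y"] by simp

lemma is_norm_nonneg: "is_norm N \<Longrightarrow> 0 \<le> N x"
  using is_norm_triangle[of N x "- x"] is_norm_minus[of N x] is_norm_zero[of N] by simp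

lemma is_norm_sum: "is_norm N \<Longrightarrow> N (\<Sum>i\<in>A. f i) \<le> (\<Sum>i\<in>A. N (f i))"
proof (induction A rule: infinite_finite_induct)
  case (insert a A)
  then show ?case using is_norm_triangle[of N "f a" "\<Sum>i\<in>A. f i"] by simp
qed (simp_all add: is_norm_zero)

lemma is_norm_le_norm:
  fixes N :: "'a::euclidean_space \<Rightarrow> real"
  assumes N: "is_norm N"
  obtains C where "C > 0" "\<And>x. N x \<le> C * norm x"
proof
  let ?C = "(\<Sum>b\<in>Basis. N b) + 1"
  show "?C > 0"
    by (intro add_nonneg_pos sum_nonneg) (simp_all add: is_norm_nonneg[OF N])
  fix x :: 'a
  have "N x = N (\<Sum>b\<in>Basis. (x \<bullet> b) *\<^sub>R b)"
    by (simp add: euclidean_representation)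
  also have "\<dots> \<le> (\<Sum>b\<in>Basis. N ((x \<bullet> b) *\<^sub>R b))"
    by (rule is_norm_sum[OF N])
  also have "\<dots> \<le> (\<Sum>b\<in>Basis. norm x * N b)"
    by (intro sum_mono) (auto simp: is_norm_scaleR[OF N] is_norm_nonneg[OF N] Basis_le_norm
        intro!: mult_right_mono)
  also have "\<dots> \<le> ?C * norm x"
    by (simp add: sum_distrib_left distrib_right distrib_left mult.commute)
  finally show "N x \<le> ?C * norm x" .
qed

lemma is_norm_continuous:
  fixes N :: "'a::euclidean_space \<Rightarrow> real"
  assumes N: "is_norm N"
  shows "continuous_on S N"
proof -
  obtain C where C: "C > 0" "\<And>x. N x \<le> C * norm x" using is_norm_le_norm[OF N] by blast
  have "\<bar>N x - N y\<bar> \<le> C * norm (x - y)" for x y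
    using is_norm_triangle[OF N, of "x - y" y] is_norm_triangle[OF N, of "y - x" x]
      C(2)[of "x - y"] is_norm_diff_commute[OF N, of x y] by simp
  then have "C-lipschitz_on S N"
    using C(1) by (auto simp: lipschitz_on_def dist_norm)
  then show ?thesis by (rule lipschitz_on_continuous_on)
qed

text \<open>The minimum over the compact Euclidean sphere is positive. Equivalence of norms serves
  existence, continuity and integrability; its constants never reach the final bound.\<close>

lemma is_norm_ge_norm:
  fixes N :: "'a::euclidean_space \<Rightarrow> real"
  assumes N: "is_norm N"
  obtains c where "c > 0" "\<And>x. c * norm x \<le> N x"
proof -
  have "sphere 0 1 \<noteq> ({} :: 'a set)" by simp
  then obtain s :: 'a where s: "s \<in> sphere 0 1" "\<And>x. x \<in> sphere 0 1 \<Longrightarrow> N s \<le> N x"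
    using continuous_attains_inf[OF compact_sphere _ is_norm_continuous[OF N]] by blast
  have "N s \<noteq> 0" using s(1) N by (auto simp: is_norm_def)
  then have pos: "N s > 0" using is_norm_nonneg[OF N, of s] by simp
  have "N s * norm x \<le> N x" for x
  proof (cases "x = 0")
    case False
    then have "N s \<le> N ((1 / norm x) *\<^sub>R x)" by (intro s(2)) simp
    then show ?thesis using False by (simp add: is_norm_scaleR[OF N] field_simps)
  qed (simp add: is_norm_zero[OF N])
  with pos show ?thesis using that by blast
qed

lemma bdd_above_dual_norm:
  fixes N :: "'a::euclidean_space \<Rightarrow> real"
  assumes N: "is_norm N"
  shows "bdd_above ((\<lambda>x. x \<bullet> z) ` {x. N x \<le> 1})"
proof -
  obtain c where c: "c > 0" "\<And>x. c * norm x \<le> N x" using is_norm_ge_norm[OF N] by blast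
  have "x \<bullet> z \<le> 1 / c * norm z" if "N x \<le> 1" for x
  proof -
    have "norm x \<le> 1 / c" using c(1) c(2)[of x] that by (simp add: field_simps)
    then have "norm x * norm z \<le> 1 / c * norm z" by (rule mult_right_mono) simp
    then show ?thesis using norm_cauchy_schwarz[of x z] by linarith
  qed
  then show ?thesis by (intro bdd_aboveI2) auto
qed

lemma dual_norm_nonneg:
  fixes N :: "'a::euclidean_space \<Rightarrow> real"
  assumes N: "is_norm N"
  shows "0 \<le> dual_norm N z"
  unfolding dual_norm_def
  by (rule cSUP_upper2[OF bdd_above_dual_norm[OF N], of 0]) (simp_all add: is_norm_zero[OF N])

lemma inner_le_dual_norm:
  fixes N :: "'a::euclidean_space \<Rightarrow> real"
  assumes N: "is_norm N"
  shows "x \<bullet> z \<le> N x * dual_norm N z"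
proof (cases "x = 0")
  case False
  then have pos: "N x > 0" using N is_norm_nonneg[OF N, of x] by (auto simp: is_norm_def less_le)
  have "((1 / N x) *\<^sub>R x) \<bullet> z \<le> dual_norm N z"
    unfolding dual_norm_def
    by (rule cSUP_upper[OF _ bdd_above_dual_norm[OF N]]) (use pos in \<open>simp add: is_norm_scaleR[OF N]\<close>)
  then show ?thesis using pos by (simp add: field_simps)
qed (simp add: is_norm_zero[OF N])

lemma dual_norm_leI:
  fixes N :: "'a::euclidean_space \<Rightarrow> real"
  assumes N: "is_norm N" and B: "\<And>x. N x \<le> 1 \<Longrightarrow> x \<bullet> z \<le> B"
  shows "dual_norm N z \<le> B"
  unfolding dual_norm_def
  by (rule cSUP_least) (use B is_norm_zero[OF N] in \<open>auto intro!: exI[of _ 0]\<close>)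

lemma dual_norm_triangle:
  fixes N :: "'a::euclidean_space \<Rightarrow> real"
  assumes N: "is_norm N"
  shows "dual_norm N (x + y) \<le> dual_norm N x + dual_norm N y"
proof (rule dual_norm_leI[OF N])
  fix u assume u: "N u \<le> 1"
  have "u \<bullet> v \<le> dual_norm N v" for v
    using inner_le_dual_norm[OF N, of u v] mult_right_mono[OF u dual_norm_nonneg[OF N, of v]]
    by simp
  from this[of x] this[of y] show "u \<bullet> (x + y) \<le> dual_norm N x + dual_norm N y"
    by (simp add: inner_add_right)
qed

lemma dual_norm_scaleR_le:
  fixes N :: "'a::euclidean_space \<Rightarrow> real"
  assumes N: "is_norm N"
  shows "dual_norm N (a *\<^sub>R x) \<le> \<bar>a\<bar> * dual_norm N x"
proof (rule dual_norm_leI[OF N])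
  fix u assume u: "N u \<le> 1"
  have "u \<bullet> (a *\<^sub>R x) = (a *\<^sub>R u) \<bullet> x" by simp
  also have "\<dots> \<le> N (a *\<^sub>R u) * dual_norm N x" by (rule inner_le_dual_norm[OF N])
  also have "\<dots> \<le> (\<bar>a\<bar> * 1) * dual_norm N x"
    using u by (intro mult_right_mono) (auto simp: is_norm_scaleR[OF N] dual_norm_nonneg[OF N] mult_left_le)
  finally show "u \<bullet> (a *\<^sub>R x) \<le> \<bar>a\<bar> * dual_norm N x" by simp
qed

lemma dual_norm_le_norm:
  fixes N :: "'a::euclidean_space \<Rightarrow> real"
  assumes N: "is_norm N"
  obtains C where "C > 0" "\<And>x. dual_norm N x \<le> C * norm x"
proof -
  obtain c where c: "c > 0" "\<And>x. c * norm x \<le> N x" using is_norm_ge_norm[OF N] by blast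
  have "dual_norm N z \<le> 1 / c * norm z" for z
  proof (rule dual_norm_leI[OF N])
    fix x assume "N x \<le> 1"
    then have "norm x \<le> 1 / c" using c(1) c(2)[of x] by (simp add: field_simps)
    then have "norm x * norm z \<le> 1 / c * norm z" by (rule mult_right_mono) simp
    then show "x \<bullet> z \<le> 1 / c * norm z" using norm_cauchy_schwarz[of x z] by linarith
  qed
  with c(1) show ?thesis using that[of "1 / c"] by simp
qed

lemma norm_le_dual_norm:
  fixes N :: "'a::euclidean_space \<Rightarrow> real"
  assumes N: "is_norm N"
  obtains C where "C > 0" "\<And>x. norm x \<le> C * dual_norm N x"
proof -
  obtain C where C: "C > 0" "\<And>x. N x \<le> C * norm x" using is_norm_le_norm[OF N] by blast
  have "norm z \<le> C * dual_norm N z" for z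
  proof (cases "z = 0")
    case False
    have "norm z * norm z = z \<bullet> z" by (simp add: power2_norm_eq_inner[symmetric] power2_eq_square)
    also have "\<dots> \<le> N z * dual_norm N z" by (rule inner_le_dual_norm[OF N])
    also have "\<dots> \<le> (C * norm z) * dual_norm N z"
      using C(2) by (intro mult_right_mono dual_norm_nonneg[OF N])
    finally show ?thesis using False by (simp add: mult.assoc mult.left_commute)
  qed (use C(1) dual_norm_nonneg[OF N, of 0] in simp)
  with C(1) show ?thesis using that by blast
qed

lemma dual_norm_continuous:
  fixes N :: "'a::euclidean_space \<Rightarrow> real"
  assumes N: "is_norm N"
  shows "continuous_on S (dual_norm N)"
proof -
  obtain C where C: "C > 0" "\<And>x. dual_norm N x \<le> C * norm x" using dual_norm_le_norm[OF N] by blast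
  have "\<bar>dual_norm N x - dual_norm N y\<bar> \<le> C * norm (x - y)" for x y
    using dual_norm_triangle[OF N, of "x - y" y] dual_norm_triangle[OF N, of "y - x" x]
      C(2)[of "x - y"] C(2)[of "y - x"] norm_minus_commute[of x y] by simp
  then have "C-lipschitz_on S (dual_norm N)"
    using C(1) by (auto simp: lipschitz_on_def dist_norm)
  then show ?thesis by (rule lipschitz_on_continuous_on)
qed

text \<open>The weights are those for which the quadratic bound in \<open>a\<close> has the factor 3 of the
  step-size rule.\<close>

lemma dual_norm_add_square_le:
  fixes N :: "'a::euclidean_space \<Rightarrow> real"
  assumes N: "is_norm N"
  shows "(dual_norm N (a + b))\<^sup>2 \<le> 3 * (dual_norm N a)\<^sup>2 + 3 / 2 * (dual_norm N b)\<^sup>2"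
proof -
  have "(dual_norm N (a + b))\<^sup>2 \<le> (dual_norm N a + dual_norm N b)\<^sup>2"
    by (intro power_mono dual_norm_triangle[OF N] dual_norm_nonneg[OF N])
  also have "\<dots> \<le> 3 * (dual_norm N a)\<^sup>2 + 3 / 2 * (dual_norm N b)\<^sup>2"
    using zero_le_power2[of "2 * dual_norm N a - dual_norm N b"]
    by (simp add: power2_eq_square algebra_simps)
  finally show ?thesis .
qed

lemma inner_le_half_squares:
  fixes N :: "'a::euclidean_space \<Rightarrow> real"
  assumes N: "is_norm N"
  shows "x \<bullet> z \<le> (N x)\<^sup>2 / 2 + (dual_norm N z)\<^sup>2 / 2"
  using inner_le_dual_norm[OF N, of x z] zero_le_power2[of "N x - dual_norm N z"]
  by (simp add: power2_diff)

section \<open>The mirror map\<close>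

locale prox_setup =
  fixes N :: "'a::euclidean_space \<Rightarrow> real" and X :: "'a set"
    and \<omega> :: "'a \<Rightarrow> real" and \<omega>' :: "'a \<Rightarrow> 'a" and x0 :: 'a
  assumes N: "is_norm N"
    and X: "closed X" "convex X"
    and x0: "x0 \<in> X"
    and \<omega>_gradient: "\<And>u. GDERIV \<omega> u :> \<omega>' u"
    and \<omega>'_continuous: "continuous_on UNIV \<omega>'"
    and \<omega>_strongly_convex: "strongly_convex N 1 \<omega>"
    and \<omega>_min: "\<omega> 0 = 0" "\<And>u. \<omega> u \<ge> 0"
begin

abbreviation V where "V \<equiv> bregman \<omega> \<omega>' x0"
abbreviation h where "h u \<equiv> \<omega> (u - x0)"
abbreviation dh where "dh u \<equiv> \<omega>' (u - x0)"
abbreviation Ndual where "Ndual \<equiv> dual_norm N"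

text \<open>The gradient of the conjugate of \<open>h\<close> over \<open>X\<close>. Every prox-step
  and every probe is a value of this one map, so uniqueness, continuity and measurability are
  settled once.\<close>

definition mirror :: "'a \<Rightarrow> 'a" where
  "mirror q = arg_min (\<lambda>u. h u - q \<bullet> u) (\<lambda>u. u \<in> X)"

lemma segment_in_X: "u \<in> X \<Longrightarrow> v \<in> X \<Longrightarrow> 0 \<le> c \<Longrightarrow> c \<le> 1 \<Longrightarrow> u + c *\<^sub>R (v - u) \<in> X"
  using convexD_alt[OF X(2), of u v c] by (simp add: algebra_simps)

lemma dgf_segment_derivative:
  "((\<lambda>c. h (p + c *\<^sub>R (u - p))) has_real_derivative dh p \<bullet> (u - p)) (at 0)"
proof -
  have "(\<omega> has_derivative (\<lambda>v. v \<bullet> \<omega>' (p - x0))) (at ((p - x0) + 0 *\<^sub>R (u - p)))"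
    using \<omega>_gradient[of "p - x0"] by (simp add: gderiv_def)
  moreover have "((\<lambda>c::real. (p - x0) + c *\<^sub>R (u - p)) has_derivative (\<lambda>c. c *\<^sub>R (u - p))) (at 0)"
    by (auto intro!: derivative_eq_intros)
  ultimately have "((\<lambda>c. \<omega> ((p - x0) + c *\<^sub>R (u - p))) has_derivative
      (\<lambda>c. (c *\<^sub>R (u - p)) \<bullet> \<omega>' (p - x0))) (at (0::real))"
    by (rule has_derivative_compose[rotated])
  moreover have "(\<lambda>c. (c *\<^sub>R (u - p)) \<bullet> \<omega>' (p - x0)) = (*) (dh p \<bullet> (u - p))"
    by (auto simp: fun_eq_iff inner_commute)
  moreover have "(p - x0) + c *\<^sub>R (u - p) = p + c *\<^sub>R (u - p) - x0" for c
    by simp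
  ultimately show ?thesis by (simp only: has_field_derivative_def)
qed

lemma dgf_continuous: "continuous_on S \<omega>"
proof -
  have "isCont \<omega> u" for u
    using \<omega>_gradient[of u] unfolding gderiv_def by (rule has_derivative_continuous)
  then show ?thesis by (simp add: continuous_at_imp_continuous_on)
qed

lemma dgf_strongly_convex_segment:
  assumes "0 \<le> c" "c \<le> 1"
  shows "\<omega> (u + c *\<^sub>R (v - u)) \<le> (1 - c) * \<omega> u + c * \<omega> v - 1 / 2 * c * (1 - c) * (N (v - u))\<^sup>2"
proof -
  have "\<omega> ((1 - c) *\<^sub>R u + c *\<^sub>R v)
      \<le> (1 - c) * \<omega> u + c * \<omega> v - 1 / 2 * c * (1 - c) * (N (u - v))\<^sup>2"
    using \<omega>_strongly_convex assms unfolding strongly_convex_def by auto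
  then show ?thesis by (simp add: algebra_simps is_norm_diff_commute[OF N, of u v])
qed

text \<open>Strong convexity is given as an inequality between values. Dividing it by the step
  \<open>c\<close> along the segment and letting \<open>c\<close> tend to 0 yields the gradient
  form; the factor \<open>1 - c\<close> disappears in the limit.\<close>

lemma bregman_ge: "(N (u - p))\<^sup>2 / 2 \<le> V p u"
proof -
  let ?\<phi> = "\<lambda>c. h (p + c *\<^sub>R (u - p))"
  have lim: "((\<lambda>c. (?\<phi> c - ?\<phi> 0) / c) \<longlongrightarrow> dh p \<bullet> (u - p)) (at_right 0)"
    using dgf_segment_derivative[of p u] unfolding has_field_derivative_iff
    by (simp add: filterlim_at_split)
  have lim': "((\<lambda>c. h u - h p - 1 / 2 * (1 - c) * (N (u - p))\<^sup>2)
      \<longlongrightarrow> h u - h p - 1 / 2 * (1 - 0) * (N (u - p))\<^sup>2) (at_right 0)"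
    by (intro tendsto_intros)
  have "eventually (\<lambda>c. (?\<phi> c - ?\<phi> 0) / c \<le> h u - h p - 1 / 2 * (1 - c) * (N (u - p))\<^sup>2)
      (at_right (0::real))"
    unfolding eventually_at_right_field
  proof (intro exI[of _ 1] conjI allI impI)
    fix c :: real assume c: "0 < c" "c < 1"
    have "?\<phi> c \<le> (1 - c) * h p + c * h u - 1 / 2 * c * (1 - c) * (N (u - p))\<^sup>2"
      using dgf_strongly_convex_segment[of c "p - x0" "u - x0"] c by (simp add: algebra_simps)
    then show "(?\<phi> c - ?\<phi> 0) / c \<le> h u - h p - 1 / 2 * (1 - c) * (N (u - p))\<^sup>2"
      using c by (simp add: divide_simps) (simp add: algebra_simps)
  qed simp
  from tendsto_le[OF _ lim' lim this] show ?thesis by (simp add: bregman_def)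
qed

lemma bregman_nonneg: "0 \<le> V p u"
  using bregman_ge[of u p] by (rule order_trans[rotated]) simp

text \<open>The same limit at the minimiser 0, where nonnegativity of \<open>\<omega>\<close> takes
  the place of the derivative. It supplies the coercivity behind the existence of prox
  points.\<close>

lemma dgf_ge: "(N u)\<^sup>2 / 2 \<le> \<omega> u"
proof -
  have lim: "((\<lambda>c. 1 / 2 * (1 - c) * (N u)\<^sup>2) \<longlongrightarrow> 1 / 2 * (1 - 0) * (N u)\<^sup>2) (at_right (0::real))"
    by (intro tendsto_intros)
  have ev: "eventually (\<lambda>c. 1 / 2 * (1 - c) * (N u)\<^sup>2 \<le> \<omega> u) (at_right (0::real))"
    unfolding eventually_at_right_field
  proof (intro exI[of _ 1] conjI allI impI)
    fix c :: real assume c: "0 < c" "c < 1"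
    have "c * (\<omega> u - 1 / 2 * (1 - c) * (N u)\<^sup>2)
        = (1 - c) * \<omega> 0 + c * \<omega> u - 1 / 2 * c * (1 - c) * (N (u - 0))\<^sup>2"
      using \<omega>_min(1) by (simp add: right_diff_distrib)
    also have "\<dots> \<ge> 0"
      using dgf_strongly_convex_segment[of c 0 u] \<omega>_min(2)[of "c *\<^sub>R u"] c by simp
    finally have "0 \<le> c * (\<omega> u - 1 / 2 * (1 - c) * (N u)\<^sup>2)" .
    then show "1 / 2 * (1 - c) * (N u)\<^sup>2 \<le> \<omega> u"
      using c by (simp add: zero_le_mult_iff)
  qed simp
  from tendsto_upperbound[OF lim ev] show ?thesis by simp
qed

text \<open>The directional derivative at a minimiser is nonnegative towards every point of
  \<open>X\<close>. The remainder of the linearisation of \<open>h\<close> is the divergence, so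
  minimality holds with the surplus \<open>V p u\<close>.\<close>

lemma mirror_optimality:
  assumes p: "is_arg_min (\<lambda>u. h u - q \<bullet> u) (\<lambda>u. u \<in> X) p" and u: "u \<in> X"
  shows "h p - q \<bullet> p + V p u \<le> h u - q \<bullet> u"
proof -
  let ?\<psi> = "\<lambda>c. h (p + c *\<^sub>R (u - p)) - q \<bullet> (p + c *\<^sub>R (u - p))"
  have pX: "p \<in> X" and min: "\<And>v. v \<in> X \<Longrightarrow> h p - q \<bullet> p \<le> h v - q \<bullet> v"
    using p by (auto simp: is_arg_min_linorder)
  have der: "(?\<psi> has_real_derivative dh p \<bullet> (u - p) - q \<bullet> (u - p)) (at 0)"
    by (rule DERIV_diff[OF dgf_segment_derivative])
      (auto intro!: derivative_eq_intros simp: inner_add_right)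
  have "0 \<le> dh p \<bullet> (u - p) - q \<bullet> (u - p)"
  proof (rule ccontr)
    assume "\<not> ?thesis"
    then obtain d where d: "d > 0" "\<And>c. 0 < c \<Longrightarrow> c < d \<Longrightarrow> ?\<psi> (0 + c) < ?\<psi> 0"
      using DERIV_neg_dec_right[OF der] by auto
    define c where "c = min (d / 2) 1"
    have c: "0 < c" "c < d" "c \<le> 1" using d(1) by (auto simp: c_def)
    then have "?\<psi> 0 \<le> ?\<psi> c" using min[OF segment_in_X[OF pX u, of c]] by simp
    then show False using d(2)[OF c(1,2)] by simp
  qed
  then show ?thesis by (simp add: bregman_def inner_diff_right)
qed

lemma arg_min_unique:
  assumes "is_arg_min (\<lambda>u. h u - q \<bullet> u) (\<lambda>u. u \<in> X) p"
    and "is_arg_min (\<lambda>u. h u - q \<bullet> u) (\<lambda>u. u \<in> X) r"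
  shows "p = r"
proof -
  have "r \<in> X" "h r - q \<bullet> r \<le> h p - q \<bullet> p"
    using assms by (auto simp: is_arg_min_linorder)
  then have "V p r \<le> 0" using mirror_optimality[OF assms(1)] by force
  then have "(N (r - p))\<^sup>2 \<le> 0" using bregman_ge[of r p] by linarith
  then have "N (r - p) = 0" by simp
  then show ?thesis using N by (simp add: is_norm_def)
qed

lemma mirror_arg_min: "is_arg_min (\<lambda>u. h u - q \<bullet> u) (\<lambda>u. u \<in> X) (mirror q)"
proof -
  let ?\<phi> = "\<lambda>u. h u - q \<bullet> u"
  obtain c where c: "c > 0" "\<And>x. c * norm x \<le> N x" using is_norm_ge_norm[OF N] by blast
  \<comment> \<open>Beyond this radius the quadratic lower bound of \<open>h\<close> outweighs the
    linear term, so \<open>x0\<close>, where \<open>h\<close> vanishes, is at least as good and the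
    search is confined to a compact set.\<close>
  define R where "R = (2 * norm q) / c\<^sup>2"
  have far: "?\<phi> x0 \<le> ?\<phi> u" if "R < norm (u - x0)" for u
  proof -
    have "(2 * norm q) \<le> c\<^sup>2 * norm (u - x0)"
      using that c(1) by (simp add: R_def field_simps)
    then have "2 * (norm q * norm (u - x0)) \<le> c\<^sup>2 * norm (u - x0) * norm (u - x0)"
      using mult_right_mono[of "2 * norm q" "c\<^sup>2 * norm (u - x0)" "norm (u - x0)"] by simp
    also have "\<dots> = (c * norm (u - x0))\<^sup>2" by (simp add: power2_eq_square)
    also have "\<dots> \<le> (N (u - x0))\<^sup>2" using c by (intro power_mono) simp_all
    finally have "norm q * norm (u - x0) \<le> h u" using dgf_ge[of "u - x0"] by simp
    moreover have "q \<bullet> (u - x0) \<le> norm q * norm (u - x0)" by (rule norm_cauchy_schwarz)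
    ultimately show ?thesis using \<omega>_min(1) by (simp add: inner_diff_right)
  qed
  let ?S = "X \<inter> cball x0 R"
  have R: "0 \<le> R" using c(1) by (simp add: R_def)
  have "compact ?S" using X(1) by (simp add: closed_Int_compact)
  moreover have "x0 \<in> ?S" using x0 R by simp
  moreover have "continuous_on ?S ?\<phi>"
    by (intro continuous_intros continuous_on_compose2[OF dgf_continuous[of UNIV]]) auto
  ultimately obtain p where p: "p \<in> ?S" "\<And>u. u \<in> ?S \<Longrightarrow> ?\<phi> p \<le> ?\<phi> u"
    using continuous_attains_inf[of ?S ?\<phi>] by blast
  have "?\<phi> p \<le> ?\<phi> u" if "u \<in> X" for u
  proof (cases "R < norm (u - x0)")
    case True
    then show ?thesis using far[OF True] p(2)[OF \<open>x0 \<in> ?S\<close>] by linarith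
  qed (use that p(2) in \<open>simp add: dist_norm norm_minus_commute\<close>)
  then have "is_arg_min ?\<phi> (\<lambda>u. u \<in> X) p" using p(1) by (simp add: is_arg_min_linorder)
  then show ?thesis unfolding mirror_def arg_min_def by (rule someI)
qed

lemma mirror_in_X: "mirror q \<in> X"
  using mirror_arg_min by (simp add: is_arg_min_def)

text \<open>Up to a constant the objective at \<open>dh v\<close> is \<open>V v u\<close>, which is
  least at \<open>u = v\<close>.\<close>

lemma mirror_dh: "v \<in> X \<Longrightarrow> mirror (dh v) = v"
proof (rule arg_min_unique[OF mirror_arg_min])
  assume v: "v \<in> X"
  have "h v - dh v \<bullet> v \<le> h u - dh v \<bullet> u" for u
    using bregman_nonneg[of v u] by (simp add: bregman_def inner_diff_right)
  then show "is_arg_min (\<lambda>u. h u - dh v \<bullet> u) (\<lambda>u. u \<in> X) v"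
    using v by (simp add: is_arg_min_linorder)
qed

text \<open>Adding the two optimality inequalities, whose surpluses are each at least half the
  squared distance, gives strong monotonicity; norm duality then cancels one factor.\<close>

lemma mirror_lipschitz: "N (mirror q - mirror r) \<le> Ndual (q - r)"
proof -
  let ?p = "mirror q" and ?s = "mirror r"
  have "(N (?p - ?s))\<^sup>2 \<le> (?p - ?s) \<bullet> (q - r)"
    using mirror_optimality[OF mirror_arg_min mirror_in_X, of q r]
      mirror_optimality[OF mirror_arg_min mirror_in_X, of r q]
      bregman_ge[of ?s ?p] bregman_ge[of ?p ?s] is_norm_diff_commute[OF N, of ?p ?s]
    by (simp add: algebra_simps inner_commute)
  also have "\<dots> \<le> N (?p - ?s) * Ndual (q - r)" by (rule inner_le_dual_norm[OF N])
  finally show ?thesis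
    using is_norm_nonneg[OF N, of "?p - ?s"] dual_norm_nonneg[OF N, of "q - r"]
    by (cases "N (?p - ?s) = 0") (auto simp: power2_eq_square)
qed

lemma mirror_continuous: "continuous_on S mirror"
proof -
  obtain c where c: "c > 0" "\<And>x. c * norm x \<le> N x" using is_norm_ge_norm[OF N] by blast
  obtain C where C: "C > 0" "\<And>x. Ndual x \<le> C * norm x" using dual_norm_le_norm[OF N] by blast
  have "norm (mirror q - mirror r) \<le> C / c * norm (q - r)" for q r
    using mirror_lipschitz[of q r] c(1) c(2)[of "mirror q - mirror r"] C(2)[of "q - r"]
    by (simp add: field_simps)
  then have "(C / c)-lipschitz_on S mirror"
    using c(1) C(1) by (auto simp: lipschitz_on_def dist_norm)
  then show ?thesis by (rule lipschitz_on_continuous_on)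
qed

section \<open>The convex conjugate of the distance generating function over X\<close>

text \<open>The supremum of \<open>q \<bullet> u - h u\<close> over \<open>X\<close>, written
  through its maximiser.\<close>

definition dgf_conj :: "'a \<Rightarrow> real" where
  "dgf_conj q = q \<bullet> mirror q - h (mirror q)"

lemma dgf_conj_ge: "u \<in> X \<Longrightarrow> q \<bullet> u - h u \<le> dgf_conj q"
  using mirror_optimality[OF mirror_arg_min, of u q] bregman_nonneg[of "mirror q" u]
  by (simp add: dgf_conj_def)

text \<open>Moving the maximiser from \<open>mirror q\<close> to \<open>mirror (q + w)\<close> costs
  at least half the squared distance. Young's inequality for the dual pair of norms sets this cost
  against the inner product with \<open>w\<close>.\<close>

lemma dgf_conj_smooth: "dgf_conj (q + w) \<le> dgf_conj q + w \<bullet> mirror q + (Ndual w)\<^sup>2 / 2"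
proof -
  let ?p = "mirror q" and ?r = "mirror (q + w)"
  have "(?r - ?p) \<bullet> w \<le> (N (?r - ?p))\<^sup>2 / 2 + (Ndual w)\<^sup>2 / 2"
    by (rule inner_le_half_squares[OF N])
  then show ?thesis
    using mirror_optimality[OF mirror_arg_min mirror_in_X, of q "q + w"] bregman_ge[of ?r ?p]
    by (simp add: dgf_conj_def algebra_simps inner_commute)
qed

lemma dgf_conj_gradient_ineq: "dgf_conj q + w \<bullet> mirror q \<le> dgf_conj (q + w)"
  using dgf_conj_ge[OF mirror_in_X[of q], of "q + w"] by (simp add: dgf_conj_def inner_add_left)

text \<open>Splitting off a constant \<open>w\<close>: with \<open>d = W - w\<close> the mean-zero part of \<open>W\<close>, the second-order
  term involves only the uncentred \<open>W\<close>. For a non-Euclidean norm centring would cost a constant.\<close>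

lemma dgf_conj_step:
  "dgf_conj (q + c *\<^sub>R d) \<le> dgf_conj q + c * (d \<bullet> mirror (q - c *\<^sub>R w)) + c\<^sup>2 / 2 * (Ndual (d + w))\<^sup>2"
proof -
  let ?r = "q - c *\<^sub>R w"
  have "dgf_conj (?r + c *\<^sub>R (d + w))
      \<le> dgf_conj ?r + c *\<^sub>R (d + w) \<bullet> mirror ?r + (Ndual (c *\<^sub>R (d + w)))\<^sup>2 / 2"
    by (rule dgf_conj_smooth)
  moreover have "(Ndual (c *\<^sub>R (d + w)))\<^sup>2 \<le> c\<^sup>2 * (Ndual (d + w))\<^sup>2"
    using power_mono[OF dual_norm_scaleR_le[OF N, of c "d + w"] dual_norm_nonneg[OF N], of 2]
    by (simp add: power_mult_distrib)
  \<comment> \<open>Convexity leads back from the shifted point to \<open>q\<close> and removes the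
    inner product with \<open>w\<close>, so only \<open>d\<close> stays in the linear term.\<close>
  moreover have "dgf_conj ?r + c *\<^sub>R w \<bullet> mirror ?r \<le> dgf_conj (?r + c *\<^sub>R w)"
    by (rule dgf_conj_gradient_ineq)
  ultimately show ?thesis by (simp add: algebra_simps inner_add_left)
qed

lemma dgf_conj_sum:
  fixes d :: "nat \<Rightarrow> 'a"
  shows "dgf_conj (q + c *\<^sub>R (\<Sum>i=1..n. d i)) \<le> dgf_conj q +
     (\<Sum>i=1..n. c * (d i \<bullet> mirror (q + c *\<^sub>R (\<Sum>j=1..<i. d j) - c *\<^sub>R w))
        + c\<^sup>2 / 2 * (Ndual (d i + w))\<^sup>2)"
proof (induction n)
  case (Suc n)
  have "{1..<Suc n} = {1..n}" by auto
  with Suc dgf_conj_step[of "q + c *\<^sub>R (\<Sum>i=1..n. d i)" c "d (Suc n)" w]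
  show ?case by (simp add: algebra_simps)
qed simp

text \<open>The Fenchel-Young inequality at a perturbation of \<open>dh v\<close>. The point
  \<open>u\<close> may depend on all noise vectors; at the price of \<open>V v u\<close> it is
  replaced by mirror points that depend only on the earlier ones.\<close>

lemma minibatch_noise_bound:
  fixes d :: "nat \<Rightarrow> 'a"
  assumes v: "v \<in> X" and u: "u \<in> X"
  shows "c * ((\<Sum>i=1..n. d i) \<bullet> (u - v)) - V v u \<le>
     (\<Sum>i=1..n. c * (d i \<bullet> (mirror (dh v + c *\<^sub>R (\<Sum>j=1..<i. d j) - c *\<^sub>R w) - v))
        + c\<^sup>2 / 2 * (Ndual (d i + w))\<^sup>2)"
proof -
  let ?s = "\<Sum>i=1..n. d i" and ?p = "\<lambda>i. mirror (dh v + c *\<^sub>R (\<Sum>j=1..<i. d j) - c *\<^sub>R w)"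
  have "(dh v + c *\<^sub>R ?s) \<bullet> u - h u \<le> dgf_conj (dh v + c *\<^sub>R ?s)" by (rule dgf_conj_ge[OF u])
  also have "\<dots> \<le> dgf_conj (dh v) + (\<Sum>i=1..n. c * (d i \<bullet> ?p i) + c\<^sup>2 / 2 * (Ndual (d i + w))\<^sup>2)"
    by (rule dgf_conj_sum)
  also have "dgf_conj (dh v) = dh v \<bullet> v - h v" by (simp add: dgf_conj_def mirror_dh[OF v])
  finally have "c * (?s \<bullet> u) - V v u
      \<le> (\<Sum>i=1..n. c * (d i \<bullet> ?p i) + c\<^sup>2 / 2 * (Ndual (d i + w))\<^sup>2)"
    by (simp add: bregman_def algebra_simps)
  moreover have "c * (?s \<bullet> v) = (\<Sum>i=1..n. c * (d i \<bullet> v))"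
    by (simp add: inner_sum_left sum_distrib_left)
  ultimately show ?thesis
    by (simp add: inner_diff_right right_diff_distrib sum.distrib sum_subtractf)
qed

text \<open>Up to a constant the prox objective is \<open>e\<close> times a mirror objective. Hence
  the relational prox-step determines the iterate as a continuous function of \<open>v\<close> and
  \<open>G\<close>, from which its measurability can be derived.\<close>

lemma prox_step_mirror:
  assumes e: "e > 0"
  assumes "is_arg_min (\<lambda>u. G \<bullet> u + e * V v u) (\<lambda>u. u \<in> X) p"
  shows "p = mirror (dh v - (1 / e) *\<^sub>R G)"
proof (rule arg_min_unique[OF _ mirror_arg_min])
  let ?q = "dh v - (1 / e) *\<^sub>R G"
  have eq: "G \<bullet> u + e * V v u = e * (h u - ?q \<bullet> u) + e * (dh v \<bullet> v - h v)" for u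
    using e by (simp add: bregman_def algebra_simps)
  show "is_arg_min (\<lambda>u. h u - ?q \<bullet> u) (\<lambda>u. u \<in> X) p"
    using assms unfolding is_arg_min_linorder eq by simp
qed

lemma prox_step_ineq:
  assumes e: "e > 0" and u: "u \<in> X" and p: "p = mirror (dh v - (1 / e) *\<^sub>R G)"
  shows "G \<bullet> (p - u) \<le> e * (V v u - V p u - V v p)"
proof -
  have "e * (h p - (dh v - (1 / e) *\<^sub>R G) \<bullet> p + V p u) \<le> e * (h u - (dh v - (1 / e) *\<^sub>R G) \<bullet> u)"
    unfolding p using mirror_optimality[OF mirror_arg_min u] e by (intro mult_left_mono) auto
  then show ?thesis using e by (simp add: bregman_def algebra_simps)
qed

end

section \<open>Independence and square integrability\<close>

text \<open>The first coordinate is a limit of simple functions. With finitely many values there,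
  only measurability in the second coordinate is needed; continuity handles the limit.\<close>

lemma caratheodory_measurable:
  fixes F :: "'a::euclidean_space \<Rightarrow> 's \<Rightarrow> 'b::{metric_space, second_countable_topology}"
  assumes cont: "\<And>s. s \<in> space S \<Longrightarrow> continuous_on UNIV (\<lambda>u. F u s)"
    and meas: "\<And>u. F u \<in> borel_measurable S"
  shows "(\<lambda>p. F (fst p) (snd p)) \<in> borel_measurable (borel \<Otimes>\<^sub>M S)"
proof -
  let ?P = "borel \<Otimes>\<^sub>M S :: ('a \<times> 's) measure"
  obtain r where r: "\<And>n. simple_function ?P (r n)"
    and lim: "\<And>p. p \<in> space ?P \<Longrightarrow> (\<lambda>n. r n p) \<longlonglongrightarrow> fst p"
    using borel_measurable_implies_sequence_metric[of fst ?P 0] by auto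
  show ?thesis
  proof (rule borel_measurable_LIMSEQ_metric)
    fix n
    show "(\<lambda>p. F (r n p) (snd p)) \<in> borel_measurable ?P"
    proof (rule measurable_compose_countable'[where f="\<lambda>u p. F u (snd p)" and g="r n"
          and I="r n ` space ?P"])
      show "countable (r n ` space ?P)"
        using simple_functionD(1)[OF r] by (rule countable_finite)
      show "r n \<in> measurable ?P (count_space (r n ` space ?P))"
        using simple_functionD[OF r] by (auto simp: measurable_count_space_eq2)
      show "(\<lambda>p. F u (snd p)) \<in> borel_measurable ?P" for u
        using meas[of u] by measurable
    qed
  next
    fix p assume p: "p \<in> space ?P"
    then have "isCont (\<lambda>u. F u (snd p)) (fst p)"
      using cont[of "snd p"] by (auto simp: space_pair_measure continuous_on_eq_continuous_at)
    then show "(\<lambda>n. F (r n p) (snd p)) \<longlonglongrightarrow> F (fst p) (snd p)"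
      using lim[OF p] by (rule isCont_tendsto_compose)
  qed
qed

lemma vimage_algebra_subset:
  assumes "f \<in> measurable M S"
  shows "sets (vimage_algebra (space M) f S) \<subseteq> sets M"
  using measurable_sets[OF assms] unfolding sets_vimage_algebra
  by (intro sets.sigma_sets_subset) auto

context prob_space
begin

text \<open>The library constant \<open>indep_var\<close> forces both variables to have the same range type.\<close>

definition indep_rv :: "'u measure \<Rightarrow> ('a \<Rightarrow> 'u) \<Rightarrow> 's measure \<Rightarrow> ('a \<Rightarrow> 's) \<Rightarrow> bool" where
  "indep_rv R U T Y \<longleftrightarrow> random_variable R U \<and> random_variable T Y \<and>
     indep_set {U -` A \<inter> space M |A. A \<in> sets R} {Y -` A \<inter> space M |A. A \<in> sets T}"

lemma indep_rv_pair_measure: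
  assumes "indep_rv R U T Y"
  shows "distr M R U \<Otimes>\<^sub>M distr M T Y = distr M (R \<Otimes>\<^sub>M T) (\<lambda>x. (U x, Y x))"
proof (rule pair_measure_eqI)
  have U[measurable]: "random_variable R U" and Y[measurable]: "random_variable T Y"
    and ind: "indep_set {U -` A \<inter> space M |A. A \<in> sets R} {Y -` A \<inter> space M |A. A \<in> sets T}"
    using assms by (auto simp: indep_rv_def)
  interpret PU: prob_space "distr M R U" by (rule prob_space_distr) measurable
  interpret PY: prob_space "distr M T Y" by (rule prob_space_distr) measurable
  show "sigma_finite_measure (distr M R U)" "sigma_finite_measure (distr M T Y)"
    by unfold_locales
  show "sets (distr M R U \<Otimes>\<^sub>M distr M T Y) = sets (distr M (R \<Otimes>\<^sub>M T) (\<lambda>x. (U x, Y x)))"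
    by simp
  fix A B assume "A \<in> sets (distr M R U)" "B \<in> sets (distr M T Y)"
  then have A[measurable]: "A \<in> sets R" and B[measurable]: "B \<in> sets T" by simp_all
  have "(\<lambda>x. (U x, Y x)) -` (A \<times> B) \<inter> space M = (U -` A \<inter> space M) \<inter> (Y -` B \<inter> space M)"
    by auto
  moreover have "prob ((U -` A \<inter> space M) \<inter> (Y -` B \<inter> space M))
      = prob (U -` A \<inter> space M) * prob (Y -` B \<inter> space M)"
    using A B by (intro indep_setD[OF ind]) auto
  ultimately show "emeasure (distr M R U) A * emeasure (distr M T Y) B
      = emeasure (distr M (R \<Otimes>\<^sub>M T) (\<lambda>x. (U x, Y x))) (A \<times> B)"
    by (simp add: emeasure_distr emeasure_eq_measure ennreal_mult)
qed

text \<open>Independence passes from two generating variables to everything measurable for the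
  sigma-algebras they generate. This is how iterates inherit independence from disjoint blocks of
  samples.\<close>

lemma indep_rv_vimage_algebra:
  assumes ind: "indep_var S H S' H'"
    and U: "U \<in> measurable (vimage_algebra (space M) H S) R"
    and Y: "Y \<in> measurable (vimage_algebra (space M) H' S') T"
  shows "indep_rv R U T Y"
proof -
  have gen: "random_variable Q f"
      "{f -` A \<inter> space M |A. A \<in> sets Q} \<subseteq> sigma_sets (space M) {g -` A \<inter> space M |A. A \<in> sets P}"
    if g: "random_variable P g" and f: "f \<in> measurable (vimage_algebra (space M) g P) Q"
    for f :: "'a \<Rightarrow> 'f" and g :: "'a \<Rightarrow> 'g" and P Q
  proof -
    show "random_variable Q f"
      using f vimage_algebra_subset[OF g] by (auto simp: measurable_def)
    show "{f -` A \<inter> space M |A. A \<in> sets Q} \<subseteq> sigma_sets (space M) {g -` A \<inter> space M |A. A \<in> sets P}"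
      using measurable_sets[OF f] by (auto simp: sets_vimage_algebra)
  qed
  have "indep_set (sigma_sets (space M) {H -` A \<inter> space M |A. A \<in> sets S})
      (sigma_sets (space M) {H' -` A \<inter> space M |A. A \<in> sets S'})"
    and H: "random_variable S H" and H': "random_variable S' H'"
    using ind unfolding indep_var_eq by simp_all
  then have "indep_set {U -` A \<inter> space M |A. A \<in> sets R} {Y -` A \<inter> space M |A. A \<in> sets T}"
    unfolding indep_set_def
    by (elim indep_sets_mono_sets)
      (use gen(2)[OF H U] gen(2)[OF H' Y] in \<open>auto split: bool.split\<close>)
  with gen(1)[OF H U] gen(1)[OF H' Y] show ?thesis by (simp add: indep_rv_def)
qed

text \<open>A substitute for conditioning: the joint law is a product, so Tonelli allows
  \<open>U\<close> to be frozen. Nonnegativity makes integrability of the composition a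
  conclusion.\<close>

lemma indep_rv_integral_le:
  fixes \<phi> :: "'u \<Rightarrow> 's \<Rightarrow> real"
  assumes ind: "indep_rv R U T Y"
    and meas: "(\<lambda>p. \<phi> (fst p) (snd p)) \<in> borel_measurable (R \<Otimes>\<^sub>M T)"
    and nonneg: "\<And>u s. 0 \<le> \<phi> u s"
    and slice: "\<And>u. u \<in> space R \<Longrightarrow> integrable M (\<lambda>w. \<phi> u (Y w))"
      "\<And>u. u \<in> space R \<Longrightarrow> (\<integral>w. \<phi> u (Y w) \<partial>M) \<le> \<psi> u"
    and \<psi>: "\<psi> \<in> borel_measurable R" "integrable M (\<lambda>w. \<psi> (U w))"
  shows "integrable M (\<lambda>w. \<phi> (U w) (Y w))"
    and "(\<integral>w. \<phi> (U w) (Y w) \<partial>M) \<le> (\<integral>w. \<psi> (U w) \<partial>M)"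
proof -
  have U[measurable]: "random_variable R U" and Y[measurable]: "random_variable T Y"
    and eq: "distr M R U \<Otimes>\<^sub>M distr M T Y = distr M (R \<Otimes>\<^sub>M T) (\<lambda>x. (U x, Y x))"
    using ind indep_rv_pair_measure[OF ind] by (auto simp: indep_rv_def)
  note meas[measurable] \<psi>(1)[measurable]
  interpret PY: prob_space "distr M T Y" by (rule prob_space_distr) measurable
  have m': "(\<lambda>p. ennreal (\<phi> (fst p) (snd p))) \<in> borel_measurable (distr M R U \<Otimes>\<^sub>M distr M T Y)"
    by (subst eq) simp
  have sl: "\<phi> u \<in> borel_measurable T" if "u \<in> space R" for u
    using measurable_compose[OF measurable_Pair1'[OF that] meas] by simp
  have slice': "(\<integral>\<^sup>+ w. ennreal (\<phi> u (Y w)) \<partial>M) \<le> ennreal (\<psi> u)" if "u \<in> space R" for u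
    using slice[OF that] nonneg by (simp add: nn_integral_eq_integral ennreal_leI)
  have psi0: "0 \<le> \<psi> u" if "u \<in> space R" for u
    using order_trans[OF Bochner_Integration.integral_nonneg slice(2)[OF that]] nonneg by blast
  have UR: "U w \<in> space R" if "w \<in> space M" for w
    using measurable_space[OF U that] .
  have "(\<integral>\<^sup>+ w. ennreal (\<phi> (U w) (Y w)) \<partial>M)
      = (\<integral>\<^sup>+ p. ennreal (\<phi> (fst p) (snd p)) \<partial>distr M (R \<Otimes>\<^sub>M T) (\<lambda>x. (U x, Y x)))"
    by (subst nn_integral_distr) simp_all
  also have "\<dots> = (\<integral>\<^sup>+ p. ennreal (\<phi> (fst p) (snd p)) \<partial>(distr M R U \<Otimes>\<^sub>M distr M T Y))"
    by (simp add: eq)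
  also have "\<dots> = (\<integral>\<^sup>+ u. \<integral>\<^sup>+ s. ennreal (\<phi> u s) \<partial>distr M T Y \<partial>distr M R U)"
    using PY.nn_integral_fst[OF m'] by simp
  also have "\<dots> \<le> (\<integral>\<^sup>+ u. ennreal (\<psi> u) \<partial>distr M R U)"
  proof (rule nn_integral_mono)
    fix u assume "u \<in> space (distr M R U)"
    then have u: "u \<in> space R" by simp
    have "(\<integral>\<^sup>+ s. ennreal (\<phi> u s) \<partial>distr M T Y) = (\<integral>\<^sup>+ w. ennreal (\<phi> u (Y w)) \<partial>M)"
      using sl[OF u] by (subst nn_integral_distr) simp_all
    with slice'[OF u] show "(\<integral>\<^sup>+ s. ennreal (\<phi> u s) \<partial>distr M T Y) \<le> ennreal (\<psi> u)" by simp
  qed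
  also have "\<dots> = (\<integral>\<^sup>+ w. ennreal (\<psi> (U w)) \<partial>M)"
    by (subst nn_integral_distr) simp_all
  also have "\<dots> = ennreal (\<integral>w. \<psi> (U w) \<partial>M)"
    using \<psi>(2) psi0 UR by (intro nn_integral_eq_integral) (auto intro!: AE_I2)
  finally have le: "(\<integral>\<^sup>+ w. ennreal (\<phi> (U w) (Y w)) \<partial>M) \<le> ennreal (\<integral>w. \<psi> (U w) \<partial>M)" .
  have mp: "(\<lambda>w. \<phi> (U w) (Y w)) \<in> borel_measurable M"
    using measurable_compose[OF measurable_Pair[OF U Y] meas] by simp
  show int: "integrable M (\<lambda>w. \<phi> (U w) (Y w))"
    using le nonneg mp by (intro integrableI_nonneg) (auto simp: le_less_trans)
  have "0 \<le> (\<integral>w. \<psi> (U w) \<partial>M)"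
    using psi0 UR by (intro integral_nonneg_AE) (auto intro!: AE_I2)
  then show "(\<integral>w. \<phi> (U w) (Y w) \<partial>M) \<le> (\<integral>w. \<psi> (U w) \<partial>M)"
    using le nn_integral_eq_integral[OF int] nonneg by simp
qed

text \<open>The signed counterpart through Fubini, for which integrability must already be
  known.\<close>

lemma indep_rv_integral_zero:
  fixes \<phi> :: "'u \<Rightarrow> 's \<Rightarrow> real"
  assumes ind: "indep_rv R U T Y"
    and meas: "(\<lambda>p. \<phi> (fst p) (snd p)) \<in> borel_measurable (R \<Otimes>\<^sub>M T)"
    and slice: "\<And>u. u \<in> space R \<Longrightarrow> (\<integral>w. \<phi> u (Y w) \<partial>M) = 0"
    and int: "integrable M (\<lambda>w. \<phi> (U w) (Y w))"
  shows "(\<integral>w. \<phi> (U w) (Y w) \<partial>M) = 0"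
proof -
  have U[measurable]: "random_variable R U" and Y[measurable]: "random_variable T Y"
    and eq: "distr M R U \<Otimes>\<^sub>M distr M T Y = distr M (R \<Otimes>\<^sub>M T) (\<lambda>x. (U x, Y x))"
    using ind indep_rv_pair_measure[OF ind] by (auto simp: indep_rv_def)
  note meas[measurable]
  interpret PU: prob_space "distr M R U" by (rule prob_space_distr) measurable
  interpret PY: prob_space "distr M T Y" by (rule prob_space_distr) measurable
  interpret P: pair_prob_space "distr M R U" "distr M T Y" ..
  have sl: "\<phi> u \<in> borel_measurable T" if "u \<in> space R" for u
    using measurable_compose[OF measurable_Pair1'[OF that] meas] by simp
  have int': "integrable (distr M R U \<Otimes>\<^sub>M distr M T Y) (\<lambda>p. \<phi> (fst p) (snd p))"
    using int by (subst eq, subst integrable_distr_eq) simp_all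
  have "(\<integral>w. \<phi> (U w) (Y w) \<partial>M) = (\<integral>p. \<phi> (fst p) (snd p) \<partial>distr M (R \<Otimes>\<^sub>M T) (\<lambda>x. (U x, Y x)))"
    by (subst integral_distr) simp_all
  also have "\<dots> = (\<integral>p. \<phi> (fst p) (snd p) \<partial>(distr M R U \<Otimes>\<^sub>M distr M T Y))"
    by (simp add: eq)
  also have "\<dots> = (\<integral>u. (\<integral>s. \<phi> u s \<partial>distr M T Y) \<partial>distr M R U)"
    using P.integral_fst'[OF int'] by simp
  also have "\<dots> = (\<integral>u. 0 \<partial>distr M R U)"
  proof (rule Bochner_Integration.integral_cong[OF refl])
    fix u assume "u \<in> space (distr M R U)"
    then have u: "u \<in> space R" by simp
    show "(\<integral>s. \<phi> u s \<partial>distr M T Y) = 0"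
      using sl[OF u] slice[OF u] by (subst integral_distr) simp_all
  qed
  finally show ?thesis by simp
qed

end

section \<open>Maps with finite second moment\<close>

text \<open>\<open>X\<close> may be unbounded, so integrability has to be carried along the
  iteration. Finite Euclidean second moments are stable under sums, scaling and domination, and they
  make inner products integrable.\<close>

definition square_integrable :: "'w measure \<Rightarrow> ('w \<Rightarrow> 'b::euclidean_space) \<Rightarrow> bool" where
  "square_integrable M f \<longleftrightarrow> f \<in> borel_measurable M \<and> integrable M (\<lambda>w. (norm (f w))\<^sup>2)"

lemma square_integrable_measurable: "square_integrable M f \<Longrightarrow> f \<in> borel_measurable M"
  by (simp add: square_integrable_def)

lemma square_integrable_add:
  assumes "square_integrable M f" "square_integrable M g"
  shows "square_integrable M (\<lambda>w. f w + g w)"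
  unfolding square_integrable_def
proof
  note [measurable] = assms[THEN square_integrable_measurable]
  show "(\<lambda>w. f w + g w) \<in> borel_measurable M" by measurable
  show "integrable M (\<lambda>w. (norm (f w + g w))\<^sup>2)"
  proof (rule Bochner_Integration.integrable_bound)
    show "integrable M (\<lambda>w. 2 * (norm (f w))\<^sup>2 + 2 * (norm (g w))\<^sup>2)"
      using assms by (auto simp: square_integrable_def)
    have "(norm (a + b))\<^sup>2 \<le> 2 * (norm a)\<^sup>2 + 2 * (norm b)\<^sup>2" for a b :: 'b
    proof -
      have "(norm (a + b))\<^sup>2 \<le> (norm a + norm b)\<^sup>2"
        by (intro power_mono norm_triangle_ineq) simp
      also have "\<dots> \<le> 2 * (norm a)\<^sup>2 + 2 * (norm b)\<^sup>2"
        using zero_le_power2[of "norm a - norm b"] by (simp add: power2_eq_square algebra_simps)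
      finally show ?thesis .
    qed
    then show "AE w in M. norm ((norm (f w + g w))\<^sup>2) \<le> norm (2 * (norm (f w))\<^sup>2 + 2 * (norm (g w))\<^sup>2)"
      by (auto intro!: AE_I2 order_trans[OF _ abs_ge_self])
  qed measurable
qed

lemma square_integrable_bound:
  assumes "square_integrable M g" "f \<in> borel_measurable M"
    and "\<And>w. w \<in> space M \<Longrightarrow> norm (f w) \<le> C * norm (g w)"
  shows "square_integrable M f"
  unfolding square_integrable_def
proof
  note [measurable] = assms(2) square_integrable_measurable[OF assms(1)]
  show "f \<in> borel_measurable M" by fact
  show "integrable M (\<lambda>w. (norm (f w))\<^sup>2)"
  proof (rule Bochner_Integration.integrable_bound)
    show "integrable M (\<lambda>w. C\<^sup>2 * (norm (g w))\<^sup>2)"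
      using assms by (auto simp: square_integrable_def)
    have "(norm (f w))\<^sup>2 \<le> C\<^sup>2 * (norm (g w))\<^sup>2" if "w \<in> space M" for w
      using power_mono[OF assms(3)[OF that], of 2] by (simp add: power_mult_distrib)
    then show "AE w in M. norm ((norm (f w))\<^sup>2) \<le> norm (C\<^sup>2 * (norm (g w))\<^sup>2)"
      by (auto intro!: AE_I2)
  qed measurable
qed

lemma square_integrable_scaleR:
  "square_integrable M f \<Longrightarrow> square_integrable M (\<lambda>w. c *\<^sub>R f w)"
  by (rule square_integrable_bound[where C="\<bar>c\<bar>"]) (auto dest: square_integrable_measurable)

lemma square_integrable_diff:
  assumes "square_integrable M f" "square_integrable M g"
  shows "square_integrable M (\<lambda>w. f w - g w)"
  using square_integrable_add[OF assms(1) square_integrable_scaleR[OF assms(2), of "-1"]] by simp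

lemma (in finite_measure) square_integrable_const: "square_integrable M (\<lambda>w. c)"
  by (simp add: square_integrable_def)

lemma (in finite_measure) square_integrable_sum:
  "(\<And>i. i \<in> I \<Longrightarrow> square_integrable M (f i)) \<Longrightarrow> square_integrable M (\<lambda>w. \<Sum>i\<in>I. f i w)"
  by (induction I rule: infinite_finite_induct)
    (auto intro!: square_integrable_add square_integrable_const)

lemma square_integrable_inner:
  assumes "square_integrable M f" "square_integrable M g"
  shows "integrable M (\<lambda>w. f w \<bullet> g w)"
proof (rule Bochner_Integration.integrable_bound)
  note [measurable] = assms[THEN square_integrable_measurable]
  show "(\<lambda>w. f w \<bullet> g w) \<in> borel_measurable M" by measurable
  show "integrable M (\<lambda>w. (norm (f w))\<^sup>2 + (norm (g w))\<^sup>2)"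
    using assms by (auto simp: square_integrable_def)
  have "\<bar>a \<bullet> b\<bar> \<le> (norm a)\<^sup>2 + (norm b)\<^sup>2" for a b :: 'b
    using Cauchy_Schwarz_ineq2[of a b] zero_le_power2[of "norm a - norm b"]
      mult_nonneg_nonneg[OF norm_ge_zero norm_ge_zero, of a b]
    by (simp add: power2_diff)
  then show "AE w in M. norm (f w \<bullet> g w) \<le> norm ((norm (f w))\<^sup>2 + (norm (g w))\<^sup>2)"
    by auto
qed

lemma (in finite_measure) square_integrable_integrable:
  assumes "square_integrable M f"
  shows "integrable M f"
proof (rule Bochner_Integration.integrable_bound)
  show "integrable M (\<lambda>w. 1 + (norm (f w))\<^sup>2)"
    using assms by (simp add: square_integrable_def)
  have "norm a \<le> 1 + (norm a)\<^sup>2" for a :: 'b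
  proof -
    have "0 \<le> (norm a)\<^sup>2 + 1 - 2 * norm a"
      using zero_le_power2[of "norm a - 1"] by (simp add: power2_diff)
    then show ?thesis using norm_ge_zero[of a] by linarith
  qed
  then show "AE w in M. norm (f w) \<le> norm (1 + (norm (f w))\<^sup>2)" by auto
  show "f \<in> borel_measurable M" using assms by (rule square_integrable_measurable)
qed

section \<open>Stochastic accelerated gradient descent\<close>

text \<open>Of the step-size rule, positivity and the entry \<open>4 * L\<close> act on single paths
  and are assumed here. The other entries compare expectations and belong to the purely numerical
  setting \<open>sagd_moments\<close>.\<close>

locale sagd_setup = prox_setup N X \<omega> \<omega>' x0 + prob_space M
  for N :: "'a::euclidean_space \<Rightarrow> real" and X \<omega> \<omega>' x0 and M :: "'w measure" +
  fixes f :: "'a \<Rightarrow> real" and g :: "'a \<Rightarrow> 'a" and L fstar :: real and Xi :: "'s measure"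
    and \<xi> :: "nat \<Rightarrow> nat \<Rightarrow> 'w \<Rightarrow> 's" and G :: "'a \<Rightarrow> 's \<Rightarrow> 'a"
    and xstar :: 'a and LL \<sigma> \<eta> :: real and K :: "'s \<Rightarrow> real" and m :: nat
    and x y z :: "nat \<Rightarrow> 'w \<Rightarrow> 'a"
  assumes f_gradient: "\<And>u. u \<in> X \<Longrightarrow> (f has_derivative (\<lambda>h. g u \<bullet> h)) (at u within X)"
    and L_nonneg: "L \<ge> 0"
    and f_smooth: "\<And>u v. u \<in> X \<Longrightarrow> v \<in> X \<Longrightarrow>
          0 \<le> f v - f u - g u \<bullet> (v - u) \<and>
          f v - f u - g u \<bullet> (v - u) \<le> L / 2 * (N (v - u))\<^sup>2"
    and xstar: "is_arg_min f (\<lambda>u. u \<in> X) xstar"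
    and fstar: "fstar = (INF u\<in>X. f u)"
    and m: "m \<ge> 1"
    and \<xi>_indep: "indep_vars (\<lambda>_. Xi) (\<lambda>(t, i). \<xi> t i) (UNIV \<times> {1..m})"
    and \<xi>_ident: "\<And>t i. i \<in> {1..m} \<Longrightarrow> distr M Xi (\<xi> t i) = distr M Xi (\<xi> t 1)"
    and G_measurable: "\<And>u. u \<in> X \<Longrightarrow> G u \<in> borel_measurable Xi"
    and G_unbiased: "\<And>u t i. u \<in> X \<Longrightarrow> i \<in> {1..m} \<Longrightarrow>
          integrable M (\<lambda>w. G u (\<xi> t i w)) \<and> (\<integral>w. G u (\<xi> t i w) \<partial>M) = g u"
    and LL_nonneg: "LL \<ge> 0"
    and G_variance: "\<And>u t. u \<in> X \<Longrightarrow>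
          integrable M (\<lambda>w. (dual_norm N (G u (\<xi> t 1 w) - g u))\<^sup>2) \<and>
          (\<integral>w. (dual_norm N (G u (\<xi> t 1 w) - g u))\<^sup>2 \<partial>M)
            \<le> LL * (f u - fstar - g xstar \<bullet> (u - xstar)) + \<sigma>\<^sup>2"
    and K_pos: "\<And>s. s \<in> space Xi \<Longrightarrow> K s > 0"
    and K_measurable: "K \<in> borel_measurable Xi"
    and K_square_integrable: "\<And>t. integrable M (\<lambda>w. (K (\<xi> t 1 w))\<^sup>2)"
    and K_second_moment: "\<And>t t'. (\<integral>w. (K (\<xi> t 1 w))\<^sup>2 \<partial>M) = (\<integral>w. (K (\<xi> t' 1 w))\<^sup>2 \<partial>M)"
    and G_lipschitz: "\<And>s u v. s \<in> space Xi \<Longrightarrow> u \<in> X \<Longrightarrow> v \<in> X \<Longrightarrow>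
          dual_norm N (G u s - G v s) \<le> K s * N (u - v)"
    and \<eta>: "\<eta> > 0" "4 * L \<le> \<eta>"
    and sagd: "\<And>w. w \<in> space M \<Longrightarrow>
          sagd_run X (bregman \<omega> \<omega>' x0) G x0 (\<lambda>t. 3 / (t + 2)) (\<lambda>t. \<eta> / (t + 1)) (\<lambda>_. m)
            (\<lambda>t i. \<xi> t i w) (\<lambda>t. x t w) (\<lambda>t. y t w) (\<lambda>t. z t w)"
begin

abbreviation K2 where "K2 \<equiv> \<integral>w. (K (\<xi> 1 1 w))\<^sup>2 \<partial>M"

lemma xstar_in_X: "xstar \<in> X"
  using xstar by (simp add: is_arg_min_def)

lemma fstar_eq: "fstar = f xstar"
proof -
  have "f xstar \<le> f u" if "u \<in> X" for u using xstar that by (auto simp: is_arg_min_linorder)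
  then show ?thesis unfolding fstar using xstar_in_X
    by (intro cInf_eq_minimum) auto
qed

lemma gap_nonneg: "u \<in> X \<Longrightarrow> 0 \<le> f u - fstar"
  using xstar by (auto simp: is_arg_min_linorder fstar_eq)

text \<open>Apply the quadratic upper bound at a point of the segment from \<open>xstar\<close> to
  \<open>u\<close>, divide by \<open>c\<close> and let \<open>c\<close> tend to 0. Consequently the
  bracket in the variance hypothesis is at most the gap.\<close>

lemma gradient_optimality:
  assumes u: "u \<in> X"
  shows "0 \<le> g xstar \<bullet> (u - xstar)"
proof -
  let ?b = "L / 2 * (N (u - xstar))\<^sup>2"
  have "((\<lambda>c. - (?b * c)) \<longlongrightarrow> - (?b * 0)) (at_right (0::real))"
    by (intro tendsto_intros)
  moreover have "eventually (\<lambda>c. - (?b * c) \<le> g xstar \<bullet> (u - xstar)) (at_right (0::real))"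
    unfolding eventually_at_right_field
  proof (intro exI[of _ 1] conjI allI impI)
    fix c :: real assume c: "0 < c" "c < 1"
    let ?v = "xstar + c *\<^sub>R (u - xstar)"
    have v: "?v \<in> X" using segment_in_X[OF xstar_in_X u] c by simp
    have "0 \<le> f ?v - f xstar" using gap_nonneg[OF v] by (simp add: fstar_eq)
    also have "\<dots> \<le> g xstar \<bullet> (?v - xstar) + L / 2 * (N (?v - xstar))\<^sup>2"
      using f_smooth[OF xstar_in_X v] by linarith
    also have "\<dots> = c * (g xstar \<bullet> (u - xstar)) + L / 2 * (c * N (u - xstar))\<^sup>2"
      using c by (simp add: is_norm_scaleR[OF N])
    also have "\<dots> = c * (g xstar \<bullet> (u - xstar) + ?b * c)"
      by (simp add: algebra_simps power2_eq_square)
    finally have "0 \<le> c * (g xstar \<bullet> (u - xstar) + ?b * c)" .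
    then show "- (?b * c) \<le> g xstar \<bullet> (u - xstar)"
      using c(1) by (simp add: zero_le_mult_iff)
  qed simp
  ultimately show ?thesis
    using tendsto_upperbound[of "\<lambda>c. - (?b * c)" "- (?b * 0)" "at_right 0"]
      trivial_limit_at_right_real[of 0] by simp
qed

lemma gap_le: "u \<in> X \<Longrightarrow> f u - fstar \<le> g xstar \<bullet> (u - xstar) + L / 2 * (N (u - xstar))\<^sup>2"
  using f_smooth[OF xstar_in_X, of u] by (simp add: fstar_eq)

lemma f_continuous: "continuous_on X f"
  using f_gradient by (auto simp: continuous_on_eq_continuous_within intro: has_derivative_continuous)

lemma \<xi>_measurable: "i \<in> {1..m} \<Longrightarrow> \<xi> t i \<in> measurable M Xi"
  using indep_vars_def[of "\<lambda>_. Xi" "\<lambda>(t, i). \<xi> t i" "UNIV \<times> {1..m}"] \<xi>_indep by auto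

lemma one_in: "1 \<in> {1..m}" using m by simp

lemma sample_eq:
  fixes \<phi> :: "'s \<Rightarrow> real"
  assumes i: "i \<in> {1..m}" and \<phi>: "\<phi> \<in> borel_measurable Xi"
  shows "integrable M (\<lambda>w. \<phi> (\<xi> t i w)) \<longleftrightarrow> integrable M (\<lambda>w. \<phi> (\<xi> t 1 w))"
    and "(\<integral>w. \<phi> (\<xi> t i w) \<partial>M) = (\<integral>w. \<phi> (\<xi> t 1 w) \<partial>M)"
  using integrable_distr_eq[OF \<xi>_measurable[OF i] \<phi>, of t]
    integrable_distr_eq[OF \<xi>_measurable[OF one_in] \<phi>, of t]
    integral_distr[OF \<xi>_measurable[OF i] \<phi>, of t]
    integral_distr[OF \<xi>_measurable[OF one_in] \<phi>, of t] \<xi>_ident[OF i, of t]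
  by simp_all

lemma K_moment:
  assumes i: "i \<in> {1..m}"
  shows "integrable M (\<lambda>w. (K (\<xi> t i w))\<^sup>2)" and "(\<integral>w. (K (\<xi> t i w))\<^sup>2 \<partial>M) = K2"
  using sample_eq[OF i, of "\<lambda>s. (K s)\<^sup>2" t] K_measurable K_square_integrable[of t]
    K_second_moment[of t 1] by auto

lemma variance:
  assumes i: "i \<in> {1..m}" and u: "u \<in> X"
  shows "integrable M (\<lambda>w. (Ndual (G u (\<xi> t i w) - g u))\<^sup>2)"
    and "(\<integral>w. (Ndual (G u (\<xi> t i w) - g u))\<^sup>2 \<partial>M)
            \<le> LL * (f u - fstar - g xstar \<bullet> (u - xstar)) + \<sigma>\<^sup>2"
proof -
  note [measurable] = borel_measurable_continuous_onI[OF dual_norm_continuous[OF N]] G_measurable[OF u]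
  have "(\<lambda>s. (Ndual (G u s - g u))\<^sup>2) \<in> borel_measurable Xi" by measurable
  from sample_eq[OF i this, of t] G_variance[OF u, of t]
  show "integrable M (\<lambda>w. (Ndual (G u (\<xi> t i w) - g u))\<^sup>2)"
    and "(\<integral>w. (Ndual (G u (\<xi> t i w) - g u))\<^sup>2 \<partial>M)
            \<le> LL * (f u - fstar - g xstar \<bullet> (u - xstar)) + \<sigma>\<^sup>2" by auto
qed

lemma sample_in_space: "i \<in> {1..m} \<Longrightarrow> w \<in> space M \<Longrightarrow> \<xi> t i w \<in> space Xi"
  using measurable_space[OF \<xi>_measurable] .

text \<open>Averaging the Lipschitz oracle gives this bound. The smoothness hypothesis would not: it
  sees \<open>g\<close> only through differences of points of \<open>X\<close> and says nothing
  about a component orthogonal to all of them.\<close>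

lemma gradient_lipschitz:
  assumes u: "u \<in> X" and v: "v \<in> X"
  shows "Ndual (g u - g v) \<le> (\<integral>w. K (\<xi> 1 1 w) \<partial>M) * N (u - v)"
proof (rule dual_norm_leI[OF N])
  fix r assume r: "N r \<le> 1"
  let ?s = "\<xi> 1 1"
  have Kint: "integrable M (\<lambda>w. K (?s w))"
  proof (rule square_integrable_integrable)
    show "square_integrable M (\<lambda>w. K (?s w))"
      using measurable_compose[OF \<xi>_measurable[OF one_in] K_measurable] K_square_integrable
      by (simp add: square_integrable_def)
  qed
  have int: "integrable M (\<lambda>w. G u (?s w))" "integrable M (\<lambda>w. G v (?s w))"
    and gu: "g u = (\<integral>w. G u (?s w) \<partial>M)" and gv: "g v = (\<integral>w. G v (?s w) \<partial>M)"
    using G_unbiased[OF u one_in, of 1] G_unbiased[OF v one_in, of 1] by auto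
  have "r \<bullet> (g u - g v) = (\<integral>w. r \<bullet> (G u (?s w) - G v (?s w)) \<partial>M)"
    unfolding gu gv using int by simp
  also have "\<dots> \<le> (\<integral>w. K (?s w) * N (u - v) \<partial>M)"
  proof (rule integral_mono)
    fix w assume w: "w \<in> space M"
    have "r \<bullet> (G u (?s w) - G v (?s w)) \<le> N r * Ndual (G u (?s w) - G v (?s w))"
      by (rule inner_le_dual_norm[OF N])
    also have "\<dots> \<le> 1 * Ndual (G u (?s w) - G v (?s w))"
      using r by (intro mult_right_mono dual_norm_nonneg[OF N])
    also have "\<dots> \<le> K (?s w) * N (u - v)"
      using G_lipschitz[OF sample_in_space[OF one_in w] u v] by simp
    finally show "r \<bullet> (G u (?s w) - G v (?s w)) \<le> K (?s w) * N (u - v)" .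
  qed (use int Kint in auto)
  also have "\<dots> = (\<integral>w. K (?s w) \<partial>M) * N (u - v)" using Kint by simp
  finally show "r \<bullet> (g u - g v) \<le> (\<integral>w. K (?s w) \<partial>M) * N (u - v)" .
qed

lemma dual_lipschitz_continuous:
  assumes "\<And>u v. u \<in> X \<Longrightarrow> v \<in> X \<Longrightarrow> Ndual (F u - F v) \<le> C * N (u - v)"
  shows "continuous_on X F"
proof -
  obtain A where A: "A > 0" "\<And>u. N u \<le> A * norm u" using is_norm_le_norm[OF N] by blast
  obtain B where B: "B > 0" "\<And>u. norm u \<le> B * Ndual u" using norm_le_dual_norm[OF N] by blast
  have "norm (F u - F v) \<le> (B * (\<bar>C\<bar> * A)) * norm (u - v)" if "u \<in> X" "v \<in> X" for u v
  proof -
    have "Ndual (F u - F v) \<le> \<bar>C\<bar> * N (u - v)"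
      using assms[OF that] mult_right_mono[OF abs_ge_self is_norm_nonneg[OF N], of C "u - v"] by simp
    also have "\<dots> \<le> \<bar>C\<bar> * (A * norm (u - v))" using A by (intro mult_left_mono) auto
    finally have "B * Ndual (F u - F v) \<le> B * (\<bar>C\<bar> * (A * norm (u - v)))"
      using B(1) by (intro mult_left_mono) auto
    with B(2)[of "F u - F v"] show ?thesis by (simp add: mult_ac)
  qed
  then have "(B * (\<bar>C\<bar> * A))-lipschitz_on X F"
    using A(1) B(1) by (auto simp: lipschitz_on_def dist_norm)
  then show ?thesis by (rule lipschitz_on_continuous_on)
qed

text \<open>Composing with the metric projection extends functions on \<open>X\<close> to the whole space, so that
  measurability can be discussed without restricting the Borel space.\<close>

abbreviation proj where "proj \<equiv> closest_point X"
definition Gx where "Gx u s = G (proj u) s"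
definition gx where "gx u = g (proj u)"

lemma X_nonempty: "X \<noteq> {}" using x0 by auto

lemma proj_in: "proj u \<in> X"
  using closest_point_in_set[OF X(1) X_nonempty] .

lemma proj_self: "u \<in> X \<Longrightarrow> proj u = u"
  by (rule closest_point_self)

lemma Gx_self: "u \<in> X \<Longrightarrow> Gx u s = G u s"
  by (simp add: Gx_def proj_self)

lemma gx_self: "u \<in> X \<Longrightarrow> gx u = g u"
  by (simp add: gx_def proj_self)

lemma proj_continuous: "continuous_on S proj"
  by (rule continuous_on_closest_point[OF X(2) X(1) X_nonempty])

lemma continuous_on_proj: "continuous_on X F \<Longrightarrow> continuous_on UNIV (\<lambda>u. F (proj u))"
  by (rule continuous_on_compose2[OF _ proj_continuous]) (auto simp: proj_in)

lemma gx_measurable[measurable]: "gx \<in> borel_measurable borel"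
  unfolding gx_def
  by (intro borel_measurable_continuous_onI continuous_on_proj
      dual_lipschitz_continuous[OF gradient_lipschitz])

lemma f_proj_measurable[measurable]: "(\<lambda>u. f (proj u)) \<in> borel_measurable borel"
  by (intro borel_measurable_continuous_onI continuous_on_proj f_continuous)

lemma Gx_measurable: "(\<lambda>p. Gx (fst p) (snd p)) \<in> borel_measurable (borel \<Otimes>\<^sub>M Xi)"
  unfolding Gx_def
proof (rule caratheodory_measurable[of Xi "\<lambda>u. G (proj u)"])
  fix s assume "s \<in> space Xi"
  then show "continuous_on UNIV (\<lambda>u. G (proj u) s)"
    by (intro continuous_on_proj[of "\<lambda>u. G u s"]
        dual_lipschitz_continuous[where C="K s"] G_lipschitz)
qed (simp add: G_measurable proj_in)

lemma Gx_measurable2[measurable (raw)]: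
  assumes "u \<in> borel_measurable P" "s \<in> measurable P Xi"
  shows "(\<lambda>p. Gx (u p) (s p)) \<in> borel_measurable P"
  using measurable_compose[OF measurable_Pair[OF assms] Gx_measurable] by simp

lemma N_measurable[measurable]: "N \<in> borel_measurable borel"
  by (rule borel_measurable_continuous_onI[OF is_norm_continuous[OF N]])

lemma Ndual_measurable[measurable]: "Ndual \<in> borel_measurable borel"
  by (rule borel_measurable_continuous_onI[OF dual_norm_continuous[OF N]])

lemma mirror_measurable[measurable]: "mirror \<in> borel_measurable borel"
  by (rule borel_measurable_continuous_onI[OF mirror_continuous])

lemma \<omega>_measurable[measurable]: "\<omega> \<in> borel_measurable borel"
  by (rule borel_measurable_continuous_onI[OF dgf_continuous])

lemma \<omega>'_measurable[measurable]: "\<omega>' \<in> borel_measurable borel"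
  by (rule borel_measurable_continuous_onI[OF \<omega>'_continuous])

declare K_measurable[measurable]

subsection \<open>The filtration\<close>

text \<open>Samples are ordered by iteration and then by position in the minibatch. The filtration
  is refined inside a minibatch because probes use the earlier samples of the same iteration.
  \<open>past (Suc t) 1\<close> holds everything up to the end of iteration
  \<open>t\<close>.\<close>

definition past_index :: "nat \<Rightarrow> nat \<Rightarrow> (nat \<times> nat) set" where
  "past_index t i = {(s, j). j \<in> {1..m} \<and> (s < t \<or> s = t \<and> j < i)}"

definition sample_algebra :: "(nat \<times> nat) set \<Rightarrow> 'w measure" where
  "sample_algebra A = vimage_algebra (space M) (\<lambda>w. \<lambda>(t, i)\<in>A. \<xi> t i w) (PiM A (\<lambda>_. Xi))"

abbreviation past where "past t i \<equiv> sample_algebra (past_index t i)"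

lemma space_sample_algebra: "space (sample_algebra A) = space M"
  by (simp add: sample_algebra_def)

lemma sample_measurable:
  assumes A: "A \<subseteq> UNIV \<times> {1..m}" and ti: "(t, i) \<in> A"
  shows "\<xi> t i \<in> measurable (sample_algebra A) Xi"
proof -
  let ?H = "\<lambda>w. \<lambda>(t, i)\<in>A. \<xi> t i w"
  have "?H \<in> space M \<rightarrow> space (PiM A (\<lambda>_. Xi))"
    using A by (auto simp: space_PiM PiE_iff simp del: One_nat_def intro!: sample_in_space)
  then have "?H \<in> measurable (sample_algebra A) (PiM A (\<lambda>_. Xi))"
    unfolding sample_algebra_def by (rule measurable_vimage_algebra1)
  from measurable_compose[OF this measurable_component_singleton[OF ti]] ti show ?thesis
    by simp
qed

lemma sample_algebra_mono:
  assumes "A \<subseteq> B" "B \<subseteq> UNIV \<times> {1..m}"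
  shows "sets (sample_algebra A) \<subseteq> sets (sample_algebra B)"
proof -
  let ?H = "\<lambda>w. \<lambda>(t, i)\<in>A. \<xi> t i w"
  have "?H \<in> measurable (sample_algebra B) (PiM A (\<lambda>_. Xi))"
    using assms by (intro measurable_restrict) (auto intro!: sample_measurable)
  from vimage_algebra_subset[OF this] show ?thesis
    by (simp add: sample_algebra_def)
qed

lemma past_index_subset: "past_index t i \<subseteq> UNIV \<times> {1..m}"
  by (auto simp: past_index_def)

lemma past_mono:
  assumes "F \<in> measurable (past s j) R" "s < t \<or> s = t \<and> j \<le> i"
  shows "F \<in> measurable (past t i) R"
proof -
  have "past_index s j \<subseteq> past_index t i" using assms(2) by (auto simp: past_index_def)
  from sample_algebra_mono[OF this past_index_subset] assms(1) show ?thesis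
    by (auto simp: measurable_def space_sample_algebra)
qed

lemma past_measurable:
  assumes "F \<in> measurable (past t i) R"
  shows "F \<in> measurable M R"
proof -
  have "(\<lambda>w. \<lambda>(t, i)\<in>past_index t i. \<xi> t i w) \<in> measurable M (PiM (past_index t i) (\<lambda>_. Xi))"
    by (intro measurable_restrict)
      (auto simp: past_index_def simp del: One_nat_def intro!: \<xi>_measurable)
  from vimage_algebra_subset[OF this] assms show ?thesis
    by (auto simp: measurable_def sample_algebra_def)
qed

text \<open>The index sets \<open>past_index t i\<close> and \<open>{(t, i)}\<close> are disjoint,
  so the corresponding blocks of samples are independent.\<close>

lemma past_indep:
  assumes U: "U \<in> measurable (past t i) R" and i: "i \<in> {1..m}"
  shows "indep_rv R U Xi (\<xi> t i)"
proof (rule indep_rv_vimage_algebra)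
  show "indep_var (PiM (past_index t i) (\<lambda>_. Xi)) (\<lambda>w. \<lambda>(t, i)\<in>past_index t i. \<xi> t i w)
     (PiM {(t, i)} (\<lambda>_. Xi)) (\<lambda>w. \<lambda>(t, i)\<in>{(t, i)}. \<xi> t i w)"
    using indep_var_restrict[OF \<xi>_indep, of "past_index t i" "{(t, i)}"] i past_index_subset
    by (auto simp: past_index_def case_prod_unfold)
  show "U \<in> measurable (vimage_algebra (space M) (\<lambda>w. \<lambda>(t, i)\<in>past_index t i. \<xi> t i w)
      (PiM (past_index t i) (\<lambda>_. Xi))) R"
    using U unfolding sample_algebra_def .
  show "\<xi> t i \<in> measurable (vimage_algebra (space M) (\<lambda>w. \<lambda>(t, i)\<in>{(t, i)}. \<xi> t i w)
      (PiM {(t, i)} (\<lambda>_. Xi))) Xi"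
    using sample_measurable[of "{(t, i)}" t i] i unfolding sample_algebra_def by simp
qed

abbreviation \<beta> :: "nat \<Rightarrow> real" where "\<beta> t \<equiv> 3 / (t + 2)"
abbreviation \<eta>s :: "nat \<Rightarrow> real" where "\<eta>s t \<equiv> \<eta> / (t + 1)"

lemma \<beta>_bounds: "t \<ge> 1 \<Longrightarrow> 0 < \<beta> t \<and> \<beta> t \<le> 1"
  by simp

lemma \<eta>s_pos: "0 < \<eta>s t"
  using \<eta>(1) by simp

subsection \<open>Sample paths\<close>

lemma path_0: "w \<in> space M \<Longrightarrow> x 0 w = x0" "w \<in> space M \<Longrightarrow> z 0 w = x0"
  using sagd by (auto simp: sagd_run_def)

lemma path_y: "w \<in> space M \<Longrightarrow> t \<ge> 1 \<Longrightarrow> y t w = (1 - \<beta> t) *\<^sub>R x (t - 1) w + \<beta> t *\<^sub>R z (t - 1) w"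
  using sagd by (auto simp: sagd_run_def add.commute)

lemma path_x: "w \<in> space M \<Longrightarrow> t \<ge> 1 \<Longrightarrow> x t w = (1 - \<beta> t) *\<^sub>R x (t - 1) w + \<beta> t *\<^sub>R z t w"
  using sagd by (auto simp: sagd_run_def add.commute)

lemma path_z:
  assumes w: "w \<in> space M" and t: "t \<ge> 1"
  shows "z t w = mirror (dh (z (t - 1) w) - (1 / \<eta>s t) *\<^sub>R minibatch G m (\<lambda>i. \<xi> t i w) (y t w))"
  using sagd[OF w] t by (intro prox_step_mirror \<eta>s_pos) (auto simp: sagd_run_def)

lemma z_in_X: "w \<in> space M \<Longrightarrow> z t w \<in> X"
  using path_z[of w t] by (cases t) (auto simp: path_0 x0 mirror_in_X)

lemma combo_in_X: "t \<ge> 1 \<Longrightarrow> u \<in> X \<Longrightarrow> v \<in> X \<Longrightarrow> (1 - \<beta> t) *\<^sub>R u + \<beta> t *\<^sub>R v \<in> X"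
  using X(2) \<beta>_bounds[of t] by (intro convexD) auto

lemma x_in_X: "w \<in> space M \<Longrightarrow> x t w \<in> X"
proof (induction t)
  case (Suc t)
  then show ?case using combo_in_X[of "Suc t"] path_x[of w "Suc t"] z_in_X by simp
qed (simp add: path_0 x0)

lemma y_in_X: "w \<in> space M \<Longrightarrow> t \<ge> 1 \<Longrightarrow> y t w \<in> X"
  using combo_in_X path_y x_in_X z_in_X by simp

text \<open>\<open>probe\<close> is the value of the mirror map that is paired with the \<open>i\<close>-th noise vector; it depends
  only on samples drawn before \<open>\<xi> t i\<close>.\<close>

definition noise :: "nat \<Rightarrow> nat \<Rightarrow> 'w \<Rightarrow> 'a" where
  "noise t i w = G (y t w) (\<xi> t i w) - g (y t w)"

text \<open>Known before iteration \<open>t\<close> draws its samples. Together with the noise it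
  telescopes to \<open>G (y t w) (\<xi> t i w) - g (x (t - 1) w)\<close>, the sampled gradient
  centred at the previous iterate.\<close>

definition drift :: "nat \<Rightarrow> 'w \<Rightarrow> 'a" where
  "drift t w = g (y t w) - g (x (t - 1) w)"

definition probe_dual :: "nat \<Rightarrow> nat \<Rightarrow> 'w \<Rightarrow> 'a" where
  "probe_dual t i w = (- 4 / (\<eta>s t * m)) *\<^sub>R (\<Sum>j=1..<i. noise t j w) - (- 4 / (\<eta>s t * m)) *\<^sub>R drift t w"

definition probe :: "nat \<Rightarrow> nat \<Rightarrow> 'w \<Rightarrow> 'a" where
  "probe t i w = mirror (dh (z (t - 1) w) + probe_dual t i w)"

lemma probe_near: "w \<in> space M \<Longrightarrow> N (probe t i w - z (t - 1) w) \<le> Ndual (probe_dual t i w)"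
  using mirror_lipschitz[of "dh (z (t - 1) w) + probe_dual t i w" "dh (z (t - 1) w)"]
    mirror_dh[OF z_in_X[of w "t - 1"]] by (simp add: probe_def)

lemma z_near:
  assumes "w \<in> space M" "t \<ge> 1"
  shows "N (z t w - z (t - 1) w) \<le> Ndual (- ((1 / \<eta>s t) *\<^sub>R minibatch G m (\<lambda>i. \<xi> t i w) (y t w)))"
  using mirror_lipschitz[of "dh (z (t - 1) w) - (1 / \<eta>s t) *\<^sub>R minibatch G m (\<lambda>i. \<xi> t i w) (y t w)"
      "dh (z (t - 1) w)"] mirror_dh[OF z_in_X[of w "t - 1"]] path_z[OF assms] assms by simp

abbreviation gap :: "nat \<Rightarrow> 'w \<Rightarrow> real" where "gap t w \<equiv> f (x t w) - fstar"
abbreviation div_star :: "nat \<Rightarrow> 'w \<Rightarrow> real" where "div_star t w \<equiv> V (z t w) xstar"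

lemma minibatch_decomp:
  "minibatch G m (\<lambda>i. \<xi> t i w) (y t w) = g (y t w) + (1 / m) *\<^sub>R (\<Sum>i=1..m. noise t i w)"
  using m by (simp add: minibatch_def noise_def sum_subtractf algebra_simps sum_constant_scaleR)

lemma smooth_step:
  assumes w: "w \<in> space M" and t: "t \<ge> 1"
  shows "gap t w \<le> (1 - \<beta> t) * gap (t - 1) w + \<beta> t * (g (y t w) \<bullet> (z t w - xstar))
           + \<beta> t * (3 / 4 * \<eta>s t) * V (z (t - 1) w) (z t w)"
proof -
  let ?x = "x (t - 1) w" and ?z = "z (t - 1) w" and ?y = "y t w" and ?b = "\<beta> t"
  have b: "0 < ?b" "?b \<le> 1" using \<beta>_bounds[OF t] by auto
  have yX: "?y \<in> X" by (rule y_in_X[OF w t])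
  have dxy: "x t w - ?y = ?b *\<^sub>R (z t w - ?z)"
    unfolding path_x[OF w t] path_y[OF w t] by (simp add: algebra_simps)
  have "f (x t w) \<le> f ?y + g ?y \<bullet> (x t w - ?y) + L / 2 * (N (x t w - ?y))\<^sup>2"
    using f_smooth[OF yX x_in_X[OF w, of t]] by linarith
  also have "g ?y \<bullet> (x t w - ?y) = (1 - ?b) * (g ?y \<bullet> (?x - ?y)) + ?b * (g ?y \<bullet> (z t w - ?y))"
    unfolding path_x[OF w t] by (simp add: algebra_simps)
  also have "N (x t w - ?y) = ?b * N (z t w - ?z)"
    unfolding dxy using b by (simp add: is_norm_scaleR[OF N])
  finally have 1: "f (x t w) \<le> f ?y + ((1 - ?b) * (g ?y \<bullet> (?x - ?y)) + ?b * (g ?y \<bullet> (z t w - ?y)))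
      + L / 2 * (?b * N (z t w - ?z))\<^sup>2" .
  have 2: "(1 - ?b) * (f ?y + g ?y \<bullet> (?x - ?y)) \<le> (1 - ?b) * f ?x"
    using f_smooth[OF yX x_in_X[OF w, of "t - 1"]] b by (intro mult_left_mono) auto
  have 3: "?b * (f ?y + g ?y \<bullet> (xstar - ?y)) \<le> ?b * fstar"
    using f_smooth[OF yX xstar_in_X] b by (intro mult_left_mono) (auto simp: fstar_eq)
  have 4: "L / 2 * (?b * N (z t w - ?z))\<^sup>2 \<le> ?b * (3 / 4 * \<eta>s t) * V ?z (z t w)"
  proof -
    \<comment> \<open>Uses \<open>L \<le> \<eta> / 4\<close> and
      \<open>3 / (t + 2) \<le> 3 / (t + 1)\<close>. The remaining quarter of
      \<open>\<eta>s t\<close> is reserved for the noise.\<close>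
    have "L * ?b \<le> 3 / 4 * \<eta>s t"
    proof -
      have "L * ?b \<le> (\<eta> / 4) * (3 / (t + 1))"
        using \<eta> L_nonneg by (intro mult_mono divide_left_mono) auto
      then show ?thesis by (simp add: mult.commute[of \<eta>])
    qed
    moreover have "?b * ((N (z t w - ?z))\<^sup>2 / 2) \<le> ?b * V ?z (z t w)"
      using b bregman_ge by (intro mult_left_mono) auto
    moreover have "0 \<le> 3 / 4 * \<eta>s t" using \<eta>(1) by simp
    moreover have "0 \<le> ?b * ((N (z t w - ?z))\<^sup>2 / 2)" by simp
    ultimately have "L * ?b * (?b * ((N (z t w - ?z))\<^sup>2 / 2)) \<le> (3 / 4 * \<eta>s t) * (?b * V ?z (z t w))"
      by (rule mult_mono)
    moreover have "L / 2 * (b * n)\<^sup>2 = L * b * (b * (n\<^sup>2 / 2))" "e * (b * n) = b * e * n"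
      for b n e :: real by (simp_all add: power2_eq_square)
    ultimately show ?thesis by (simp only:)
  qed
  have arith: "fx - fs \<le> (1 - b) * (fx' - fs) + b * (gz - gs) + r"
    if "fx \<le> fy + ((1 - b) * gxy + b * (gz - gy)) + l" "(1 - b) * (fy + gxy) \<le> (1 - b) * fx'"
      "b * (fy + (gs - gy)) \<le> b * fs" "l \<le> r" for fx fs b fx' gz gs r fy gxy gy l :: real
    using that by (simp add: algebra_simps)
  show ?thesis
    unfolding inner_diff_right[of "g ?y" "z t w" xstar]
    by (rule arith[OF 1[unfolded inner_diff_right[of "g ?y" "z t w" ?y]] 2
          3[unfolded inner_diff_right[of "g ?y" xstar ?y]] 4])
qed

text \<open>The prox inequality is tested at \<open>xstar\<close>, and \<open>z t - xstar\<close> is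
  split at \<open>z (t - 1)\<close>. The part with \<open>z t - z (t - 1)\<close> goes through the
  conjugate bound; the other part recombines with the probes, so that in the end the noise is paired
  only with \<open>probe t i - xstar\<close>.\<close>

lemma path_recursion:
  assumes w: "w \<in> space M" and t: "t \<ge> 1"
  shows "gap t w + \<beta> t * \<eta>s t * div_star t w
    \<le> (1 - \<beta> t) * gap (t - 1) w + \<beta> t * \<eta>s t * div_star (t - 1) w
      - \<beta> t / m * (\<Sum>i=1..m. noise t i w \<bullet> (probe t i w - xstar))
      + 2 * \<beta> t / (\<eta>s t * (real m)\<^sup>2) * (\<Sum>i=1..m. (Ndual (noise t i w + drift t w))\<^sup>2)"
proof -
  let ?z = "z (t - 1) w" and ?y = "y t w" and ?b = "\<beta> t" and ?e = "\<eta>s t"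
  \<comment> \<open>The value of \<open>?c\<close> is forced: multiplied by the reserved
    \<open>?e / 4\<close> it must give \<open>- 1 / m\<close>, the factor of the noise in the
    minibatch gradient. The squares then receive \<open>2 / (?e * (real m)\<^sup>2)\<close>.\<close>
  let ?c = "- 4 / (?e * m)" and ?s = "\<Sum>i=1..m. noise t i w"
  let ?Q = "\<Sum>i=1..m. (Ndual (noise t i w + drift t w))\<^sup>2"
  have b: "0 < ?b" using \<beta>_bounds[OF t] by auto
  have e: "0 < ?e" by (rule \<eta>s_pos)
  have e4: "0 \<le> ?e / 4" using \<eta>(1) by simp
  have m0: "real m > 0" using m by simp
  have prox: "(g ?y + (1 / m) *\<^sub>R ?s) \<bullet> (z t w - xstar)
      \<le> ?e * (V ?z xstar - V (z t w) xstar - V ?z (z t w))"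
    unfolding minibatch_decomp[symmetric]
    by (rule prox_step_ineq[OF e xstar_in_X path_z[OF w t]])
  have "?c * (?s \<bullet> (z t w - ?z)) - V ?z (z t w)
     \<le> (\<Sum>i=1..m. ?c * (noise t i w \<bullet> (probe t i w - ?z)) + ?c\<^sup>2 / 2 * (Ndual (noise t i w + drift t w))\<^sup>2)"
    using minibatch_noise_bound[OF z_in_X[OF w] z_in_X[OF w], where c="?c" and n=m
        and d="\<lambda>i. noise t i w" and w="drift t w"]
    unfolding probe_def probe_dual_def by (simp add: algebra_simps)
  also have "\<dots> = ?c * (\<Sum>i=1..m. noise t i w \<bullet> (probe t i w - ?z)) + ?c\<^sup>2 / 2 * ?Q"
    by (simp add: sum.distrib sum_distrib_left)
  also have "(\<Sum>i=1..m. noise t i w \<bullet> (probe t i w - ?z))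
      = (\<Sum>i=1..m. noise t i w \<bullet> (probe t i w - xstar)) + ?s \<bullet> (xstar - ?z)"
    by (simp add: inner_sum_left sum.distrib[symmetric] inner_add_right[symmetric])
  finally have nb0: "(?e / 4) * (?c * (?s \<bullet> (z t w - ?z)) - V ?z (z t w))
      \<le> (?e / 4) * (?c * ((\<Sum>i=1..m. noise t i w \<bullet> (probe t i w - xstar)) + ?s \<bullet> (xstar - ?z))
          + ?c\<^sup>2 / 2 * ?Q)"
    by (rule mult_left_mono[OF _ e4])
  have nb1: "(?e / 4) * (?c * r) = - (r / m)" for r
  proof -
    have "(a / 4) * (- 4 / (a * b) * r) = - (r / b)" if "a > 0" "b > 0" for a b :: real
      using that by (simp add: field_simps)
    from this[OF e m0] show ?thesis .
  qed
  have nb2: "(?e / 4) * (?c\<^sup>2 / 2 * ?Q) = 2 / (?e * (real m)\<^sup>2) * ?Q"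
  proof -
    have "(a / 4) * ((- 4 / (a * b))\<^sup>2 / 2 * q) = 2 / (a * b\<^sup>2) * q" if "a > 0" "b > 0" for a b q :: real
      using that by (simp add: field_simps power2_eq_square)
    from this[OF e m0] show ?thesis .
  qed
  have nb: "- (?s \<bullet> (z t w - ?z) / m) - (?e / 4) * V ?z (z t w)
      \<le> - (((\<Sum>i=1..m. noise t i w \<bullet> (probe t i w - xstar)) + ?s \<bullet> (xstar - ?z)) / m)
         + 2 / (?e * (real m)\<^sup>2) * ?Q"
    using nb0 unfolding right_diff_distrib[of "?e / 4"] distrib_left[of "?e / 4"] nb1 nb2 .
  have "g ?y \<bullet> (z t w - xstar) + 3 / 4 * ?e * V ?z (z t w)
      \<le> ?e * V ?z xstar - ?e * V (z t w) xstar
        - (\<Sum>i=1..m. noise t i w \<bullet> (probe t i w - xstar)) / m + 2 / (?e * (real m)\<^sup>2) * ?Q"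
  proof -
    have eq: "(1 / m) *\<^sub>R ?s \<bullet> (z t w - xstar) = ?s \<bullet> (z t w - ?z) / m - ?s \<bullet> (xstar - ?z) / m"
      by (simp add: inner_diff_right diff_divide_distrib)
    have arith: "gz + 3 / 4 * e * v3 \<le> e * v1 - e * v2 - p / k + q"
      if "gz + (s1 / k - s2 / k) \<le> e * (v1 - v2 - v3)" "- (s1 / k) - (e / 4) * v3 \<le> - ((p + s2) / k) + q"
      for gz e v1 v2 v3 p k q s1 s2 :: real
      using that by (simp add: algebra_simps add_divide_distrib)
    show ?thesis by (rule arith[OF prox[unfolded inner_add_left eq] nb])
  qed
  then have step: "?b * (g ?y \<bullet> (z t w - xstar) + 3 / 4 * ?e * V ?z (z t w))
      \<le> ?b * (?e * V ?z xstar - ?e * V (z t w) xstar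
        - (\<Sum>i=1..m. noise t i w \<bullet> (probe t i w - xstar)) / m + 2 / (?e * (real m)\<^sup>2) * ?Q)"
    using b by (intro mult_left_mono) auto
  have arith: "F + b * e * v2 \<le> F' + b * e * v1 - b / k * p + 2 * b / d * q"
    if "F \<le> F' + b * gz + b * (3 / 4 * e) * v3" "b * (gz + 3 / 4 * e * v3) \<le> b * (e * v1 - e * v2 - p / k + 2 / d * q)"
    for F F' b e v1 v2 v3 gz k d p q :: real
    using that by (simp add: algebra_simps)
  show ?thesis by (rule arith[OF smooth_step[OF w t] step])
qed

subsection \<open>Adaptedness and square integrability\<close>

lemma sample_past: "j \<in> {1..m} \<Longrightarrow> s < t \<or> s = t \<and> j < i \<Longrightarrow> \<xi> s j \<in> measurable (past t i) Xi"
  by (rule sample_measurable[OF past_index_subset]) (auto simp: past_index_def)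

lemma past_cong:
  assumes "\<And>w. w \<in> space M \<Longrightarrow> F w = F' w" "F' \<in> measurable (past t i) R"
  shows "F \<in> measurable (past t i) R"
  using assms(2) by (rule measurable_cong[THEN iffD2, rotated]) (simp add: space_sample_algebra assms(1))

lemma y_adapted_aux:
  assumes t: "t \<ge> 1" and "x (t - 1) \<in> borel_measurable (past s i)" "z (t - 1) \<in> borel_measurable (past s i)"
  shows "y t \<in> borel_measurable (past s i)"
proof (rule past_cong)
  note [measurable] = assms(2,3)
  show "(\<lambda>w. (1 - \<beta> t) *\<^sub>R x (t - 1) w + \<beta> t *\<^sub>R z (t - 1) w) \<in> borel_measurable (past s i)"
    by measurable
qed (rule path_y[OF _ t])

lemma xz_adapted: "x t \<in> borel_measurable (past (Suc t) 1) \<and> z t \<in> borel_measurable (past (Suc t) 1)"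
proof (induction t)
  case 0
  have "x 0 \<in> borel_measurable (past (Suc 0) 1)" "z 0 \<in> borel_measurable (past (Suc 0) 1)"
    by (rule past_cong[where F'="\<lambda>_. x0"]; simp add: path_0)+
  then show ?case by simp
next
  case (Suc t)
  let ?P = "past (Suc (Suc t)) 1"
  have x[measurable]: "x t \<in> borel_measurable ?P" and z[measurable]: "z t \<in> borel_measurable ?P"
    using Suc by (auto elim!: past_mono)
  have y[measurable]: "y (Suc t) \<in> borel_measurable ?P"
    using y_adapted_aux[of "Suc t"] x z by simp
  have s: "\<xi> (Suc t) i \<in> measurable ?P Xi" if "i \<in> {1..m}" for i
    by (rule sample_past) (use that in auto)
  have z'[measurable]: "z (Suc t) \<in> borel_measurable ?P"
  \<comment> \<open>The projected oracle agrees with \<open>G\<close> along the path, since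
    \<open>y\<close> stays in \<open>X\<close>, and it is the version that is jointly
    measurable.\<close>
  proof (rule past_cong[where F'="\<lambda>w. mirror (dh (z t w) - (1 / \<eta>s (Suc t)) *\<^sub>R
        ((1 / m) *\<^sub>R (\<Sum>i=1..m. Gx (y (Suc t) w) (\<xi> (Suc t) i w))))"])
    fix w assume w: "w \<in> space M"
    show "z (Suc t) w = mirror (dh (z t w) - (1 / \<eta>s (Suc t)) *\<^sub>R
        ((1 / m) *\<^sub>R (\<Sum>i=1..m. Gx (y (Suc t) w) (\<xi> (Suc t) i w))))"
      using path_z[OF w, of "Suc t"] y_in_X[OF w, of "Suc t"] by (simp add: minibatch_def Gx_self)
  next
    have "(\<lambda>w. Gx (y (Suc t) w) (\<xi> (Suc t) i w)) \<in> borel_measurable ?P" if "i \<in> {1..m}" for i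
      by (rule Gx_measurable2[OF y s[OF that]])
    then have [measurable]: "(\<lambda>w. \<Sum>i=1..m. Gx (y (Suc t) w) (\<xi> (Suc t) i w)) \<in> borel_measurable ?P"
      by (rule borel_measurable_sum)
    show "(\<lambda>w. mirror (dh (z t w) - (1 / \<eta>s (Suc t)) *\<^sub>R
        ((1 / m) *\<^sub>R (\<Sum>i=1..m. Gx (y (Suc t) w) (\<xi> (Suc t) i w))))) \<in> borel_measurable ?P"
      by measurable
  qed
  have "x (Suc t) \<in> borel_measurable ?P"
  proof (rule past_cong)
    show "(\<lambda>w. (1 - \<beta> (Suc t)) *\<^sub>R x t w + \<beta> (Suc t) *\<^sub>R z (Suc t) w) \<in> borel_measurable ?P"
      by measurable
  qed (use path_x[of _ "Suc t"] in simp)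
  with z' show ?case by simp
qed

lemma x_past: "t \<ge> 1 \<Longrightarrow> i \<ge> 1 \<Longrightarrow> x (t - 1) \<in> borel_measurable (past t i)"
  and z_past: "t \<ge> 1 \<Longrightarrow> i \<ge> 1 \<Longrightarrow> z (t - 1) \<in> borel_measurable (past t i)"
  using xz_adapted[of "t - 1"] by (auto elim!: past_mono)

lemma y_past: "t \<ge> 1 \<Longrightarrow> i \<ge> 1 \<Longrightarrow> y t \<in> borel_measurable (past t i)"
  by (intro y_adapted_aux x_past z_past)

lemma x_measurable[measurable]: "x t \<in> borel_measurable M"
  and z_measurable[measurable]: "z t \<in> borel_measurable M"
  using xz_adapted[of t] by (auto dest: past_measurable)

lemma noise_eq: "w \<in> space M \<Longrightarrow> t \<ge> 1 \<Longrightarrow> noise t i w = Gx (y t w) (\<xi> t i w) - gx (y t w)"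
  by (simp add: noise_def Gx_self gx_self y_in_X)

lemma drift_eq: "w \<in> space M \<Longrightarrow> t \<ge> 1 \<Longrightarrow> drift t w = gx (y t w) - gx (x (t - 1) w)"
  by (simp add: drift_def gx_self y_in_X x_in_X)

lemma noise_past:
  assumes t: "t \<ge> 1" and j: "j \<in> {1..m}" and "j < i"
  shows "noise t j \<in> borel_measurable (past t i)"
proof (rule past_cong)
  have y[measurable]: "y t \<in> borel_measurable (past t i)" using y_past[OF t] assms by simp
  have [measurable]: "\<xi> t j \<in> measurable (past t i) Xi" using assms by (intro sample_past) auto
  show "(\<lambda>w. Gx (y t w) (\<xi> t j w) - gx (y t w)) \<in> borel_measurable (past t i)"
    by measurable
qed (rule noise_eq[OF _ t])

lemma drift_past:
  assumes t: "t \<ge> 1" and i: "i \<ge> 1"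
  shows "drift t \<in> borel_measurable (past t i)"
proof (rule past_cong)
  note [measurable] = y_past[OF t i] x_past[OF t i]
  show "(\<lambda>w. gx (y t w) - gx (x (t - 1) w)) \<in> borel_measurable (past t i)" by measurable
qed (rule drift_eq[OF _ t])

lemma probe_dual_past:
  assumes t: "t \<ge> 1" and i: "i \<in> {1..m}"
  shows "probe_dual t i \<in> borel_measurable (past t i)"
proof -
  have [measurable]: "(\<lambda>w. \<Sum>j=1..<i. noise t j w) \<in> borel_measurable (past t i)"
    using i by (intro borel_measurable_sum noise_past[OF t]) auto
  have [measurable]: "drift t \<in> borel_measurable (past t i)"
    using i by (intro drift_past[OF t]) simp
  show ?thesis unfolding probe_dual_def by measurable
qed

lemma probe_past:
  assumes t: "t \<ge> 1" and i: "i \<in> {1..m}"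
  shows "probe t i \<in> borel_measurable (past t i)"
proof -
  have [measurable]: "z (t - 1) \<in> borel_measurable (past t i)" using i by (intro z_past t) simp
  note [measurable] = probe_dual_past[OF t i]
  show ?thesis unfolding probe_def by measurable
qed

lemma N_square_integrable:
  assumes "square_integrable M F"
  shows "integrable M (\<lambda>w. (N (F w))\<^sup>2)"
proof -
  note [measurable] = square_integrable_measurable[OF assms]
  obtain C where C: "\<And>u. N u \<le> C * norm u" using is_norm_le_norm[OF N] by blast
  have "square_integrable M (\<lambda>w. N (F w))"
    by (rule square_integrable_bound[OF assms, of _ C]) (auto simp: C is_norm_nonneg[OF N])
  then show ?thesis by (simp add: square_integrable_def)
qed

lemma Ndual_square_integrable:
  assumes "square_integrable M F"
  shows "integrable M (\<lambda>w. (Ndual (F w))\<^sup>2)"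
proof -
  note [measurable] = square_integrable_measurable[OF assms]
  obtain C where C: "\<And>u. Ndual u \<le> C * norm u" using dual_norm_le_norm[OF N] by blast
  have "square_integrable M (\<lambda>w. Ndual (F w))"
    by (rule square_integrable_bound[OF assms, of _ C]) (auto simp: C dual_norm_nonneg[OF N])
  then show ?thesis by (simp add: square_integrable_def)
qed

lemma square_integrable_if_N_le:
  assumes F[measurable]: "F \<in> borel_measurable M" and H: "square_integrable M H"
    and le: "\<And>w. w \<in> space M \<Longrightarrow> N (F w) \<le> Ndual (H w)"
  shows "square_integrable M F"
proof -
  obtain c where c: "c > 0" "\<And>u. c * norm u \<le> N u" using is_norm_ge_norm[OF N] by blast
  obtain C where C: "\<And>u. Ndual u \<le> C * norm u" using dual_norm_le_norm[OF N] by blast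
  have "norm (F w) \<le> C / c * norm (H w)" if "w \<in> space M" for w
    using le[OF that] c(1) c(2)[of "F w"] C[of "H w"] by (simp add: field_simps)
  then show ?thesis by (rule square_integrable_bound[OF H F])
qed

lemma square_integrable_if_Ndual_le:
  fixes H :: "'w \<Rightarrow> real"
  assumes F[measurable]: "F \<in> borel_measurable M" and H: "square_integrable M H"
    and le: "\<And>w. w \<in> space M \<Longrightarrow> Ndual (F w) \<le> H w"
  shows "square_integrable M F"
proof -
  obtain C where C: "C > 0" "\<And>u. norm u \<le> C * Ndual u" using norm_le_dual_norm[OF N] by blast
  have "norm (F w) \<le> C * norm (H w)" if "w \<in> space M" for w
  proof -
    have "norm (F w) \<le> C * Ndual (F w)" by (rule C(2))
    also have "\<dots> \<le> C * norm (H w)" using C(1) le[OF that] by (intro mult_left_mono) auto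
    finally show ?thesis .
  qed
  then show ?thesis by (rule square_integrable_bound[OF H F])
qed

text \<open>\<open>U\<close> is known before \<open>\<xi> t i\<close> is drawn, so the second
  moments multiply.\<close>

lemma K_N_product:
  assumes U: "U \<in> borel_measurable (past t i)" "square_integrable M U" and i: "i \<in> {1..m}"
  shows "integrable M (\<lambda>w. (K (\<xi> t i w))\<^sup>2 * (N (U w))\<^sup>2)"
    and "(\<integral>w. (K (\<xi> t i w))\<^sup>2 * (N (U w))\<^sup>2 \<partial>M) \<le> K2 * (\<integral>w. (N (U w))\<^sup>2 \<partial>M)"
proof -
  note K = K_moment[OF i, of t]
  have meas: "(\<lambda>p. (K (snd p))\<^sup>2 * (N (fst p))\<^sup>2) \<in> borel_measurable (borel \<Otimes>\<^sub>M Xi)"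
    by measurable
  note * = indep_rv_integral_le[OF past_indep[OF U(1) i] meas, where \<psi>="\<lambda>u. K2 * (N u)\<^sup>2"]
  show "integrable M (\<lambda>w. (K (\<xi> t i w))\<^sup>2 * (N (U w))\<^sup>2)"
    by (rule *(1)) (use K N_square_integrable[OF U(2)] in auto)
  have "(\<integral>w. (K (\<xi> t i w))\<^sup>2 * (N (U w))\<^sup>2 \<partial>M) \<le> (\<integral>w. K2 * (N (U w))\<^sup>2 \<partial>M)"
    by (rule *(2)) (use K N_square_integrable[OF U(2)] in auto)
  then show "(\<integral>w. (K (\<xi> t i w))\<^sup>2 * (N (U w))\<^sup>2 \<partial>M) \<le> K2 * (\<integral>w. (N (U w))\<^sup>2 \<partial>M)"
    by simp
qed

text \<open>Comparison with the fixed point \<open>x0\<close>: the difference is dominated by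
  \<open>K * N (U - x0)\<close>, whose factors are independent, and at \<open>x0\<close> the
  variance hypothesis applies.\<close>

lemma oracle_square_integrable:
  assumes U: "U \<in> borel_measurable (past t i)" "square_integrable M U" and i: "i \<in> {1..m}"
    and UX: "\<And>w. w \<in> space M \<Longrightarrow> U w \<in> X"
  shows "square_integrable M (\<lambda>w. Gx (U w) (\<xi> t i w))"
proof -
  note \<xi>_measurable[OF i, of t, measurable]
  note square_integrable_measurable[OF U(2), measurable]
  note G_measurable[OF x0, measurable]
  have 1: "square_integrable M (\<lambda>w. Gx (U w) (\<xi> t i w) - Gx x0 (\<xi> t i w))"
  proof (rule square_integrable_if_Ndual_le)
    have c: "(\<lambda>w. U w - x0) \<in> borel_measurable (past t i)" using U(1) by measurable
    have "square_integrable M (\<lambda>w. U w - x0)"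
      by (intro square_integrable_diff U square_integrable_const)
    from K_N_product(1)[OF c this i]
    show "square_integrable M (\<lambda>w. K (\<xi> t i w) * N (U w - x0))"
      by (simp add: square_integrable_def power_mult_distrib abs_mult)
    show "Ndual (Gx (U w) (\<xi> t i w) - Gx x0 (\<xi> t i w)) \<le> K (\<xi> t i w) * N (U w - x0)"
      if "w \<in> space M" for w
      using G_lipschitz[OF sample_in_space[OF i that] UX[OF that] x0]
      by (simp add: Gx_self UX[OF that] x0)
  qed measurable
  have 2: "square_integrable M (\<lambda>w. G x0 (\<xi> t i w) - g x0)"
  proof (rule square_integrable_if_Ndual_le[OF _ _ order_refl])
    show "square_integrable M (\<lambda>w. Ndual (G x0 (\<xi> t i w) - g x0))"
      using variance(1)[OF i x0, of t] by (simp add: square_integrable_def)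
  qed measurable
  have "square_integrable M (\<lambda>w. (Gx (U w) (\<xi> t i w) - Gx x0 (\<xi> t i w)) + ((G x0 (\<xi> t i w) - g x0) + g x0))"
    by (intro square_integrable_add 1 2 square_integrable_const)
  then show ?thesis by (simp add: Gx_self x0)
qed

lemma gradient_square_integrable:
  assumes U: "square_integrable M U" and UX: "\<And>w. w \<in> space M \<Longrightarrow> U w \<in> X"
  shows "square_integrable M (\<lambda>w. gx (U w))"
proof -
  note square_integrable_measurable[OF U, measurable]
  let ?k = "\<integral>w. K (\<xi> 1 1 w) \<partial>M"
  have "square_integrable M (\<lambda>w. gx (U w) - g x0)"
  proof (rule square_integrable_if_Ndual_le)
    have "square_integrable M (\<lambda>w. U w - x0)"
      by (intro square_integrable_diff U square_integrable_const)
    from N_square_integrable[OF this]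
    have "square_integrable M (\<lambda>w. N (U w - x0))" by (simp add: square_integrable_def)
    then show "square_integrable M (\<lambda>w. ?k *\<^sub>R N (U w - x0))"
      by (rule square_integrable_scaleR)
    show "Ndual (gx (U w) - g x0) \<le> ?k *\<^sub>R N (U w - x0)" if "w \<in> space M" for w
      using gradient_lipschitz[OF UX[OF that] x0] by (simp add: gx_self UX[OF that])
  qed measurable
  from square_integrable_add[OF this square_integrable_const[of "g x0"]] show ?thesis by simp
qed

lemma square_integrable_cong:
  "(\<And>w. w \<in> space M \<Longrightarrow> F w = F' w) \<Longrightarrow> square_integrable M F \<longleftrightarrow> square_integrable M F'"
  unfolding square_integrable_def
  by (intro conj_cong measurable_cong Bochner_Integration.integrable_cong) auto

lemma y_square_integrable_aux:
  assumes t: "t \<ge> 1" and "square_integrable M (x (t - 1))" "square_integrable M (z (t - 1))"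
  shows "square_integrable M (y t)"
  using assms square_integrable_cong[OF path_y[OF _ t]]
  by (simp add: square_integrable_add square_integrable_scaleR)

text \<open>The mirror map is 1-Lipschitz from the dual norm, so the increment of \<open>z\<close>
  is bounded by the scaled minibatch gradient, which is square integrable by the induction
  hypothesis.\<close>

lemma xz_square_integrable: "square_integrable M (x t) \<and> square_integrable M (z t)"
proof (induction t)
  case 0
  then show ?case using square_integrable_const
    by (auto simp: path_0 cong: square_integrable_cong)
next
  case (Suc t)
  then have x: "square_integrable M (x t)" and z: "square_integrable M (z t)" by auto
  have y: "square_integrable M (y (Suc t))" using y_square_integrable_aux[of "Suc t"] x z by simp
  have "square_integrable M (\<lambda>w. Gx (y (Suc t) w) (\<xi> (Suc t) i w))" if "i \<in> {1..m}" for i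
    by (rule oracle_square_integrable[OF y_past y that y_in_X]) (use that in auto)
  then have "square_integrable M (\<lambda>w. (- (1 / \<eta>s (Suc t))) *\<^sub>R ((1 / m) *\<^sub>R (\<Sum>i=1..m. Gx (y (Suc t) w) (\<xi> (Suc t) i w))))"
    by (intro square_integrable_scaleR square_integrable_sum)
  then have "square_integrable M (\<lambda>w. z (Suc t) w - z t w)"
  proof (rule square_integrable_if_N_le[rotated])
    fix w assume w: "w \<in> space M"
    show "N (z (Suc t) w - z t w) \<le> Ndual ((- (1 / \<eta>s (Suc t))) *\<^sub>R ((1 / m) *\<^sub>R (\<Sum>i=1..m. Gx (y (Suc t) w) (\<xi> (Suc t) i w))))"
      using z_near[OF w, of "Suc t"] y_in_X[OF w, of "Suc t"] by (simp add: minibatch_def Gx_self)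
  qed measurable
  from square_integrable_add[OF this z] have z': "square_integrable M (z (Suc t))" by simp
  have "square_integrable M (\<lambda>w. (1 - \<beta> (Suc t)) *\<^sub>R x t w + \<beta> (Suc t) *\<^sub>R z (Suc t) w)"
    by (intro square_integrable_add square_integrable_scaleR x z')
  then have "square_integrable M (x (Suc t))"
    using square_integrable_cong[of "x (Suc t)", OF path_x] by simp
  with z' show ?case by simp
qed

lemma x_square_integrable: "square_integrable M (x t)"
  and z_square_integrable: "square_integrable M (z t)"
  using xz_square_integrable by auto

lemma y_square_integrable: "t \<ge> 1 \<Longrightarrow> square_integrable M (y t)"
  by (intro y_square_integrable_aux x_square_integrable z_square_integrable)

lemma noise_square_integrable:
  assumes t: "t \<ge> 1" and i: "i \<in> {1..m}"
  shows "square_integrable M (noise t i)"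
proof -
  have "square_integrable M (\<lambda>w. Gx (y t w) (\<xi> t i w) - gx (y t w))"
    using i by (intro square_integrable_diff oracle_square_integrable gradient_square_integrable
        y_past y_square_integrable t y_in_X) auto
  then show ?thesis using square_integrable_cong[OF noise_eq[OF _ t]] by simp
qed

lemma drift_square_integrable:
  assumes t: "t \<ge> 1"
  shows "square_integrable M (drift t)"
proof -
  have "square_integrable M (\<lambda>w. gx (y t w) - gx (x (t - 1) w))"
    by (intro square_integrable_diff gradient_square_integrable
        x_square_integrable y_square_integrable t y_in_X x_in_X)
  then show ?thesis using square_integrable_cong[OF drift_eq[OF _ t]] by simp
qed

lemma probe_square_integrable:
  assumes t: "t \<ge> 1" and i: "i \<in> {1..m}"
  shows "square_integrable M (probe t i)"
proof -
  note [measurable] = past_measurable[OF probe_past[OF t i]]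
  have "square_integrable M (probe_dual t i)"
    unfolding probe_dual_def using i
    by (intro square_integrable_diff square_integrable_scaleR square_integrable_sum
        noise_square_integrable drift_square_integrable t) auto
  then have "square_integrable M (\<lambda>w. probe t i w - z (t - 1) w)"
    by (rule square_integrable_if_N_le[rotated]) (use probe_near in auto)
  from square_integrable_add[OF this z_square_integrable[of "t - 1"]] show ?thesis by simp
qed

subsection \<open>The noise terms in expectation\<close>

lemma noise_probe_integrable:
  assumes t: "t \<ge> 1" and i: "i \<in> {1..m}"
  shows "integrable M (\<lambda>w. noise t i w \<bullet> (probe t i w - xstar))"
  by (intro square_integrable_inner square_integrable_diff noise_square_integrable
      probe_square_integrable square_integrable_const t i)

lemma noise_probe_zero:
  assumes t: "t \<ge> 1" and i: "i \<in> {1..m}"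
  shows "(\<integral>w. noise t i w \<bullet> (probe t i w - xstar) \<partial>M) = 0"
proof -
  let ?U = "\<lambda>w. (y t w, probe t i w)"
  let ?\<phi> = "\<lambda>u s. (Gx (fst u) s - gx (fst u)) \<bullet> (snd u - xstar)"
  have U: "?U \<in> measurable (past t i) (borel \<Otimes>\<^sub>M borel)"
    using i by (intro measurable_Pair y_past probe_past t) auto
  have meas: "(\<lambda>p. ?\<phi> (fst p) (snd p)) \<in> borel_measurable ((borel \<Otimes>\<^sub>M borel) \<Otimes>\<^sub>M Xi)"
    by measurable
  have eq: "?\<phi> (?U w) (\<xi> t i w) = noise t i w \<bullet> (probe t i w - xstar)" if "w \<in> space M" for w
    using noise_eq[OF that t] by simp
  have "(\<integral>w. ?\<phi> (?U w) (\<xi> t i w) \<partial>M) = 0"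
  proof (rule indep_rv_integral_zero[OF past_indep[OF U i] meas])
    fix u :: "'a \<times> 'a"
    show "(\<integral>w. ?\<phi> u (\<xi> t i w) \<partial>M) = 0"
      using G_unbiased[OF proj_in i, of "fst u" t]
      by (simp add: Gx_def gx_def prob_space)
  next
    show "integrable M (\<lambda>w. ?\<phi> (?U w) (\<xi> t i w))"
      using noise_probe_integrable[OF t i] eq
      by (simp cong: Bochner_Integration.integrable_cong)
  qed
  then show ?thesis
    using eq by (simp cong: Bochner_Integration.integral_cong)
qed

lemma gap_integrable: "integrable M (gap t)"
proof (rule Bochner_Integration.integrable_bound)
  let ?b = "\<lambda>w. g xstar \<bullet> (x t w - xstar) + L / 2 * (N (x t w - xstar))\<^sup>2"
  have d: "square_integrable M (\<lambda>w. x t w - xstar)"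
    by (intro square_integrable_diff x_square_integrable square_integrable_const)
  show "integrable M ?b"
    using square_integrable_inner[OF square_integrable_const d] N_square_integrable[OF d] by simp
  have "(\<lambda>w. f (proj (x t w)) - fstar) \<in> borel_measurable M" by measurable
  then show "gap t \<in> borel_measurable M"
    by (rule measurable_cong[THEN iffD1, rotated]) (simp add: proj_self x_in_X)
  have "norm (gap t w) \<le> norm (?b w)" if "w \<in> space M" for w
    using gap_nonneg[OF x_in_X[OF that, of t]] gap_le[OF x_in_X[OF that, of t]] by simp
  then show "AE w in M. norm (gap t w) \<le> norm (?b w)" by auto
qed

text \<open>Freezing \<open>x (t - 1)\<close> transfers the pointwise variance hypothesis to the
  random iterate. The linear part of its bracket is dropped by first-order optimality, which leaves
  a quantity present in the recursion.\<close>

lemma oracle_variance_past: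
  assumes t: "t \<ge> 1" and i: "i \<in> {1..m}"
  shows "integrable M (\<lambda>w. (Ndual (G (x (t - 1) w) (\<xi> t i w) - g (x (t - 1) w)))\<^sup>2)"
    and "(\<integral>w. (Ndual (G (x (t - 1) w) (\<xi> t i w) - g (x (t - 1) w)))\<^sup>2 \<partial>M)
      \<le> LL * (\<integral>w. gap (t - 1) w \<partial>M) + \<sigma>\<^sup>2"
proof -
  let ?x = "x (t - 1)"
  let ?\<phi> = "\<lambda>u s. (Ndual (Gx u s - gx u))\<^sup>2"
  let ?\<psi> = "\<lambda>u. LL * (f (proj u) - fstar) + \<sigma>\<^sup>2"
  have U: "?x \<in> borel_measurable (past t i)" using i by (intro x_past t) simp
  have meas: "(\<lambda>p. ?\<phi> (fst p) (snd p)) \<in> borel_measurable (borel \<Otimes>\<^sub>M Xi)"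
    by measurable
  have slice: "integrable M (\<lambda>w. ?\<phi> u (\<xi> t i w))" "(\<integral>w. ?\<phi> u (\<xi> t i w) \<partial>M) \<le> ?\<psi> u" for u
  proof -
    note v = variance[OF i proj_in[of u], of t]
    show "integrable M (\<lambda>w. ?\<phi> u (\<xi> t i w))" using v(1) by (simp add: Gx_def gx_def)
    have "LL * (f (proj u) - fstar - g xstar \<bullet> (proj u - xstar)) \<le> LL * (f (proj u) - fstar)"
      using LL_nonneg gradient_optimality[OF proj_in] by (intro mult_left_mono) auto
    with v(2) show "(\<integral>w. ?\<phi> u (\<xi> t i w) \<partial>M) \<le> ?\<psi> u" by (simp add: Gx_def gx_def)
  qed
  have \<psi>: "?\<psi> \<in> borel_measurable borel" by measurable
  have eq1: "?\<psi> (?x w) = LL * gap (t - 1) w + \<sigma>\<^sup>2"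
    and eq2: "?\<phi> (?x w) (\<xi> t i w) = (Ndual (G (?x w) (\<xi> t i w) - g (?x w)))\<^sup>2" if "w \<in> space M" for w
    using x_in_X[OF that] by (simp_all add: proj_self Gx_self gx_self)
  have \<psi>i: "integrable M (\<lambda>w. ?\<psi> (?x w))"
    by (subst Bochner_Integration.integrable_cong[OF refl eq1]) (use gap_integrable in auto)
  have \<psi>e: "(\<integral>w. ?\<psi> (?x w) \<partial>M) = LL * (\<integral>w. gap (t - 1) w \<partial>M) + \<sigma>\<^sup>2"
    by (subst Bochner_Integration.integral_cong[OF refl eq1]) (use gap_integrable in \<open>auto simp: prob_space\<close>)
  note * = indep_rv_integral_le[OF past_indep[OF U i] meas zero_le_power2 slice \<psi> \<psi>i]
  show "integrable M (\<lambda>w. (Ndual (G (?x w) (\<xi> t i w) - g (?x w)))\<^sup>2)"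
    using *(1) by (subst (asm) Bochner_Integration.integrable_cong[OF refl eq2])
  show "(\<integral>w. (Ndual (G (?x w) (\<xi> t i w) - g (?x w)))\<^sup>2 \<partial>M)
      \<le> LL * (\<integral>w. gap (t - 1) w \<partial>M) + \<sigma>\<^sup>2"
    using *(2) unfolding \<psi>e by (subst (asm) Bochner_Integration.integral_cong[OF refl eq2])
qed

lemma noise_drift_integrable:
  assumes t: "t \<ge> 1" and i: "i \<in> {1..m}"
  shows "integrable M (\<lambda>w. (Ndual (noise t i w + drift t w))\<^sup>2)"
  by (intro Ndual_square_integrable square_integrable_add noise_square_integrable
      drift_square_integrable t i)

lemma spread_square_integrable: "square_integrable M (\<lambda>w. z t w - x t w)"
  by (intro square_integrable_diff z_square_integrable x_square_integrable)

lemma noise_drift_bound: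
  assumes t: "t \<ge> 1" and i: "i \<in> {1..m}"
  shows "(\<integral>w. (Ndual (noise t i w + drift t w))\<^sup>2 \<partial>M)
    \<le> 3 * (LL * (\<integral>w. gap (t - 1) w \<partial>M) + \<sigma>\<^sup>2)
      + 3 / 2 * K2 * (\<beta> t)\<^sup>2 * (\<integral>w. (N (z (t - 1) w - x (t - 1) w))\<^sup>2 \<partial>M)"
proof -
  let ?x = "x (t - 1)" and ?d = "\<lambda>w. z (t - 1) w - x (t - 1) w"
  let ?A = "\<lambda>w. (Ndual (G (?x w) (\<xi> t i w) - g (?x w)))\<^sup>2"
  let ?B = "\<lambda>w. (K (\<xi> t i w))\<^sup>2 * (N (?d w))\<^sup>2"
  have dm: "?d \<in> borel_measurable (past t i)"
    using i by (intro borel_measurable_diff x_past z_past t) auto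
  note A = oracle_variance_past[OF t i] and B = K_N_product[OF dm spread_square_integrable i]
  have "(\<integral>w. (Ndual (noise t i w + drift t w))\<^sup>2 \<partial>M)
      \<le> (\<integral>w. 3 * ?A w + 3 / 2 * (\<beta> t)\<^sup>2 * ?B w \<partial>M)"
  proof (rule integral_mono)
    fix w assume w: "w \<in> space M"
    \<comment> \<open>The sum of noise and drift is \<open>?a + ?b\<close>. Since \<open>y t\<close>
      and \<open>x (t - 1)\<close> differ by \<open>\<beta> t\<close> times the spread
      \<open>z (t - 1) - x (t - 1)\<close>, \<open>?b\<close> brings a factor
      \<open>\<beta> t\<close>.\<close>
    let ?a = "G (?x w) (\<xi> t i w) - g (?x w)" and ?b = "G (y t w) (\<xi> t i w) - G (?x w) (\<xi> t i w)"
    have "y t w - ?x w = \<beta> t *\<^sub>R ?d w"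
      unfolding path_y[OF w t] by (simp add: algebra_simps)
    then have "N (y t w - ?x w) = \<beta> t * N (?d w)"
      by (simp add: is_norm_scaleR[OF N])
    then have "Ndual ?b \<le> K (\<xi> t i w) * (\<beta> t * N (?d w))"
      using G_lipschitz[OF sample_in_space[OF i w] y_in_X[OF w t] x_in_X[OF w]] by metis
    then have "(Ndual ?b)\<^sup>2 \<le> (K (\<xi> t i w) * (\<beta> t * N (?d w)))\<^sup>2"
      by (intro power_mono dual_norm_nonneg[OF N])
    also have "\<dots> = (\<beta> t)\<^sup>2 * ?B w" by (simp only: power_mult_distrib mult.left_commute)
    finally have "(Ndual ?b)\<^sup>2 \<le> (\<beta> t)\<^sup>2 * ?B w" .
    then show "(Ndual (noise t i w + drift t w))\<^sup>2 \<le> 3 * ?A w + 3 / 2 * (\<beta> t)\<^sup>2 * ?B w"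
      using dual_norm_add_square_le[OF N, of ?a ?b] by (simp add: noise_def drift_def)
  qed (use A(1) B(1) noise_drift_integrable[OF t i] in auto)
  also have "\<dots> = 3 * (\<integral>w. ?A w \<partial>M) + 3 / 2 * (\<beta> t)\<^sup>2 * (\<integral>w. ?B w \<partial>M)"
    using A(1) B(1) by simp
  also have "\<dots> \<le> 3 * (LL * (\<integral>w. gap (t - 1) w \<partial>M) + \<sigma>\<^sup>2)
      + 3 / 2 * (\<beta> t)\<^sup>2 * (K2 * (\<integral>w. (N (?d w))\<^sup>2 \<partial>M))"
    using A(2) B(2) by (intro add_mono mult_left_mono) auto
  finally show ?thesis by (simp only: mult_ac)
qed

text \<open>\<open>\<beta> 1 = 1\<close> and \<open>x 0 = z 0\<close> make the drift vanish. Here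
  the full bracket of the variance hypothesis is kept: smoothness at \<open>xstar\<close> bounds it
  by the divergence, whereas the gap at \<open>x0\<close> would retain a linear term in
  \<open>g xstar\<close>.\<close>

lemma noise_drift_bound_first:
  assumes i: "i \<in> {1..m}"
  shows "(\<integral>w. (Ndual (noise 1 i w + drift 1 w))\<^sup>2 \<partial>M) \<le> LL * (L * V x0 xstar) + \<sigma>\<^sup>2"
proof -
  have eq: "noise 1 i w + drift 1 w = G x0 (\<xi> 1 i w) - g x0" if w: "w \<in> space M" for w
    using path_y[OF w, of 1] path_0[OF w] by (simp add: noise_def drift_def)
  have "(\<integral>w. (Ndual (noise 1 i w + drift 1 w))\<^sup>2 \<partial>M) = (\<integral>w. (Ndual (G x0 (\<xi> 1 i w) - g x0))\<^sup>2 \<partial>M)"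
    by (intro Bochner_Integration.integral_cong refl) (simp only: eq)
  also have "\<dots> \<le> LL * (f x0 - fstar - g xstar \<bullet> (x0 - xstar)) + \<sigma>\<^sup>2"
    by (rule variance(2)[OF i x0])
  also have "\<dots> \<le> LL * (L * V x0 xstar) + \<sigma>\<^sup>2"
  proof -
    have "f x0 - fstar - g xstar \<bullet> (x0 - xstar) \<le> L * ((N (x0 - xstar))\<^sup>2 / 2)"
      using gap_le[OF x0] by simp
    also have "\<dots> \<le> L * V x0 xstar"
      using bregman_ge[of xstar x0] L_nonneg
      by (intro mult_left_mono) (simp_all add: is_norm_diff_commute[OF N, of x0])
    finally show ?thesis using LL_nonneg by (simp add: mult_left_mono)
  qed
  finally show ?thesis .
qed

section \<open>The divergence to the minimiser and the recursion in expectation\<close>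

lemma div_star_measurable[measurable]: "div_star t \<in> borel_measurable M"
  unfolding bregman_def by measurable

text \<open>\<open>\<omega>\<close> may grow faster than quadratically, so second moments of
  \<open>z t\<close> do not suffice. The pathwise recursion itself dominates \<open>div_star\<close>
  by integrable terms, because the gap is nonnegative.\<close>

lemma div_star_integrable: "integrable M (div_star t)"
proof (induction t)
  case 0
  have "integrable M (div_star 0) \<longleftrightarrow> integrable M (\<lambda>_. V x0 xstar)"
    by (rule Bochner_Integration.integrable_cong[OF refl]) (simp add: path_0)
  then show ?case by simp
next
  case (Suc t)
  define T where "T = Suc t"
  have T: "T \<ge> 1" "T - 1 = t" by (auto simp: T_def)
  let ?c = "\<beta> T * \<eta>s T"
  let ?r = "\<lambda>w. (1 - \<beta> T) * gap t w + ?c * div_star t w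
      - \<beta> T / m * (\<Sum>i=1..m. noise T i w \<bullet> (probe T i w - xstar))
      + 2 * \<beta> T / (\<eta>s T * (real m)\<^sup>2) * (\<Sum>i=1..m. (Ndual (noise T i w + drift T w))\<^sup>2)"
  have c: "?c > 0" using \<eta>(1) by simp
  have "integrable M ?r"
    by (intro Bochner_Integration.integrable_add Bochner_Integration.integrable_diff
        integrable_mult_right Bochner_Integration.integrable_sum gap_integrable Suc
        noise_probe_integrable noise_drift_integrable T)
  then have "integrable M (\<lambda>w. ?r w / ?c)" by (rule integrable_divide)
  moreover have "norm (div_star T w) \<le> norm (?r w / ?c)" if w: "w \<in> space M" for w
  proof -
    have arith: "v \<le> r / b" if "F + b * v \<le> r" "0 \<le> F" "b > 0" for F b v r :: real
      using that by (simp add: field_simps)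
    have "div_star T w \<le> ?r w / ?c"
      by (rule arith[OF path_recursion[OF w T(1), unfolded T(2)] gap_nonneg[OF x_in_X[OF w]] c])
    then show ?thesis using bregman_nonneg[of "z T w" xstar]
      unfolding real_norm_def by linarith
  qed
  ultimately have "integrable M (div_star T)"
    by (rule Bochner_Integration.integrable_bound[OF _ div_star_measurable AE_I2])
  then show ?case by (simp add: T_def)
qed

text \<open>The terms pairing noise with probes have mean zero. The \<open>m\<close> squares, each
  at most \<open>S\<close> in mean, meet a coefficient with \<open>m\<close> squared, which leaves
  the gain \<open>1 / m\<close>.\<close>

lemma expected_recursion:
  assumes t: "t \<ge> 1"
    and S: "\<And>i. i \<in> {1..m} \<Longrightarrow> (\<integral>w. (Ndual (noise t i w + drift t w))\<^sup>2 \<partial>M) \<le> S"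
  shows "(\<integral>w. gap t w \<partial>M) + \<beta> t * \<eta>s t * (\<integral>w. div_star t w \<partial>M)
    \<le> (1 - \<beta> t) * (\<integral>w. gap (t - 1) w \<partial>M) + \<beta> t * \<eta>s t * (\<integral>w. div_star (t - 1) w \<partial>M)
      + 2 * \<beta> t / (\<eta>s t * m) * S"
proof -
  let ?c = "\<beta> t * \<eta>s t" and ?d = "2 * \<beta> t / (\<eta>s t * (real m)\<^sup>2)"
  let ?P = "\<lambda>w. \<Sum>i=1..m. noise t i w \<bullet> (probe t i w - xstar)"
  let ?Q = "\<lambda>w. \<Sum>i=1..m. (Ndual (noise t i w + drift t w))\<^sup>2"
  note int [simp] = gap_integrable div_star_integrable noise_probe_integrable[OF t]
    noise_drift_integrable[OF t]
  have P: "integrable M ?P" and Q: "integrable M ?Q"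
    by (intro Bochner_Integration.integrable_sum; simp)+
  have "(\<integral>w. gap t w \<partial>M) + ?c * (\<integral>w. div_star t w \<partial>M) = (\<integral>w. gap t w + ?c * div_star t w \<partial>M)"
    by simp
  also have "\<dots> \<le> (\<integral>w. (1 - \<beta> t) * gap (t - 1) w + ?c * div_star (t - 1) w
      - \<beta> t / m * ?P w + ?d * ?Q w \<partial>M)"
    using P Q by (intro integral_mono path_recursion t Bochner_Integration.integrable_add
        Bochner_Integration.integrable_diff integrable_mult_right int) auto
  also have "\<dots> = (1 - \<beta> t) * (\<integral>w. gap (t - 1) w \<partial>M) + ?c * (\<integral>w. div_star (t - 1) w \<partial>M)
      - \<beta> t / m * (\<integral>w. ?P w \<partial>M) + ?d * (\<integral>w. ?Q w \<partial>M)"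
    using P Q by simp
  also have "(\<integral>w. ?P w \<partial>M) = 0"
    using noise_probe_zero[OF t] by (subst Bochner_Integration.integral_sum) simp_all
  also have "?d * (\<integral>w. ?Q w \<partial>M) \<le> ?d * (m * S)"
  proof (rule mult_left_mono)
    have "(\<integral>w. ?Q w \<partial>M) = (\<Sum>i=1..m. \<integral>w. (Ndual (noise t i w + drift t w))\<^sup>2 \<partial>M)"
      by (subst Bochner_Integration.integral_sum) simp_all
    also have "\<dots> \<le> (\<Sum>i=1..m. S)" by (intro sum_mono S)
    finally show "(\<integral>w. ?Q w \<partial>M) \<le> m * S" by simp
    show "0 \<le> ?d" using \<eta>(1) by simp
  qed
  also have "?d * (m * S) = 2 * \<beta> t / (\<eta>s t * m) * S"
    using m by (simp add: power2_eq_square)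
  finally show ?thesis by simp
qed

section \<open>Distances of the averaged iterates\<close>

lemma convex_N_square:
  assumes "0 \<le> b" "b \<le> 1"
  shows "(N ((1 - b) *\<^sub>R u + b *\<^sub>R v))\<^sup>2 \<le> (1 - b) * (N u)\<^sup>2 + b * (N v)\<^sup>2"
proof -
  have "N ((1 - b) *\<^sub>R u + b *\<^sub>R v) \<le> (1 - b) * N u + b * N v"
    using is_norm_triangle[OF N, of "(1 - b) *\<^sub>R u" "b *\<^sub>R v"] assms
    by (simp add: is_norm_scaleR[OF N])
  then have "(N ((1 - b) *\<^sub>R u + b *\<^sub>R v))\<^sup>2 \<le> ((1 - b) * N u + b * N v)\<^sup>2"
    by (intro power_mono is_norm_nonneg[OF N])
  also have "\<dots> \<le> (1 - b) * (N u)\<^sup>2 + b * (N v)\<^sup>2"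
  proof -
    have "0 \<le> b * (1 - b) * (N u - N v)\<^sup>2"
      using assms by (intro mult_nonneg_nonneg) auto
    then show ?thesis by (simp add: power2_eq_square algebra_simps)
  qed
  finally show ?thesis .
qed

lemma x_dist_recursion:
  assumes t: "t \<ge> 1"
  shows "(\<integral>w. (N (x t w - xstar))\<^sup>2 / 2 \<partial>M)
    \<le> (1 - \<beta> t) * (\<integral>w. (N (x (t - 1) w - xstar))\<^sup>2 / 2 \<partial>M) + \<beta> t * (\<integral>w. div_star t w \<partial>M)"
proof -
  have int[simp]: "integrable M (\<lambda>w. (N (x s w - xstar))\<^sup>2)" for s
    by (intro N_square_integrable square_integrable_diff x_square_integrable square_integrable_const)
  note div_star_integrable[simp]
  have "(\<integral>w. (N (x t w - xstar))\<^sup>2 / 2 \<partial>M)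
      \<le> (\<integral>w. (1 - \<beta> t) * ((N (x (t - 1) w - xstar))\<^sup>2 / 2) + \<beta> t * div_star t w \<partial>M)"
  proof (rule integral_mono)
    fix w assume w: "w \<in> space M"
    have eq: "x t w - xstar = (1 - \<beta> t) *\<^sub>R (x (t - 1) w - xstar) + \<beta> t *\<^sub>R (z t w - xstar)"
      unfolding path_x[OF w t] by (simp add: algebra_simps)
    have 1: "(N (x t w - xstar))\<^sup>2 \<le> (1 - \<beta> t) * (N (x (t - 1) w - xstar))\<^sup>2 + \<beta> t * (N (z t w - xstar))\<^sup>2"
      unfolding eq using \<beta>_bounds[OF t] by (intro convex_N_square) auto
    have 2: "\<beta> t * ((N (z t w - xstar))\<^sup>2 / 2) \<le> \<beta> t * div_star t w"
      using bregman_ge[of xstar "z t w"] \<beta>_bounds[OF t]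
      by (intro mult_left_mono) (auto simp: is_norm_diff_commute[OF N, of xstar])
    have arith: "c / 2 \<le> (1 - b) * (a / 2) + b * v"
      if "c \<le> (1 - b) * a + b * d" "b * (d / 2) \<le> b * v" for a b c d v :: real
      using that by (simp add: field_simps)
    show "(N (x t w - xstar))\<^sup>2 / 2
        \<le> (1 - \<beta> t) * ((N (x (t - 1) w - xstar))\<^sup>2 / 2) + \<beta> t * div_star t w"
      by (rule arith[OF 1 2])
  qed simp_all
  also have "\<dots> = (1 - \<beta> t) * (\<integral>w. (N (x (t - 1) w - xstar))\<^sup>2 / 2 \<partial>M) + \<beta> t * (\<integral>w. div_star t w \<partial>M)"
    by simp
  finally show ?thesis .
qed

lemma spread_bound:
  "(\<integral>w. (N (z t w - x t w))\<^sup>2 \<partial>M)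
    \<le> 4 * (\<integral>w. div_star t w \<partial>M) + 4 * (\<integral>w. (N (x t w - xstar))\<^sup>2 / 2 \<partial>M)"
proof -
  have int[simp]: "integrable M (\<lambda>w. (N (x s w - xstar))\<^sup>2)" for s
    by (intro N_square_integrable square_integrable_diff x_square_integrable square_integrable_const)
  note div_star_integrable[simp] N_square_integrable[OF spread_square_integrable, simp]
  have "(\<integral>w. (N (z t w - x t w))\<^sup>2 \<partial>M)
      \<le> (\<integral>w. 4 * div_star t w + 4 * ((N (x t w - xstar))\<^sup>2 / 2) \<partial>M)"
  proof (rule integral_mono)
    fix w
    have eq: "(1 / 2) *\<^sub>R (z t w - x t w) = (1 - 1 / 2) *\<^sub>R (z t w - xstar) + (1 / 2) *\<^sub>R (xstar - x t w)"
      by (simp add: algebra_simps)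
    have "(N ((1 / 2) *\<^sub>R (z t w - x t w)))\<^sup>2
        \<le> (1 - 1 / 2) * (N (z t w - xstar))\<^sup>2 + 1 / 2 * (N (xstar - x t w))\<^sup>2"
      unfolding eq by (rule convex_N_square) auto
    then show "(N (z t w - x t w))\<^sup>2 \<le> 4 * div_star t w + 4 * ((N (x t w - xstar))\<^sup>2 / 2)"
      using bregman_ge[of xstar "z t w"]
      by (simp add: is_norm_scaleR[OF N] is_norm_diff_commute[OF N, of xstar] power_divide)
  qed simp_all
  also have "\<dots> = 4 * (\<integral>w. div_star t w \<partial>M) + 4 * (\<integral>w. (N (x t w - xstar))\<^sup>2 / 2 \<partial>M)"
    by simp
  finally show ?thesis .
qed

end

section \<open>The recursion for the moments\<close>

text \<open>The estimate really gives \<open>56 + 371 / 8\<close>, below 104. The rounding is chosen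
  for later: \<open>4 * 104 / 16 = 26\<close> is the share of the spread in
  \<open>vbound\<close>.\<close>

lemma sum_spread_bound:
  fixes k :: real
  assumes k: "k > 0" and n: "1 \<le> n" "real n \<le> k"
  shows "(\<Sum>s=1..<n. 56 + 53 * (7 * real s + 1) / (4 * k)) \<le> 104 * real n"
proof -
  have sum: "(\<Sum>s=1..<n. 7 * real s + 1) = (real n - 1) * (7 / 2 * real n + 1)"
    using n(1) by (induction n rule: dec_induct) (simp_all add: field_simps)
  have "(\<Sum>s=1..<n. 56 + 53 * (7 * real s + 1) / (4 * k))
      = (\<Sum>s=1..<n. 56 + 53 / (4 * k) * (7 * real s + 1))"
    by simp
  also have "\<dots> = (\<Sum>s=1..<n. 56) + 53 / (4 * k) * (\<Sum>s=1..<n. 7 * real s + 1)"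
    unfolding sum_distrib_left by (rule sum.distrib)
  also have "\<dots> = 56 * (real n - 1) + 53 / (4 * k) * ((real n - 1) * (7 / 2 * real n + 1))"
    unfolding sum using n(1) by simp
  also have "\<dots> \<le> 56 * real n + 53 / (4 * k) * (7 / 2 * (real n * k))"
  proof (intro add_mono mult_left_mono)
    have "(real n - 1) * (7 / 2 * real n + 1) \<le> 7 / 2 * (real n * real n)"
      using n(1) by (simp add: field_simps)
    also have "\<dots> \<le> 7 / 2 * (real n * k)"
      using n(2) by (intro mult_left_mono) auto
    finally show "(real n - 1) * (7 / 2 * real n + 1) \<le> 7 / 2 * (real n * k)" .
  qed (use k in auto)
  also have "53 / (4 * k) * (7 / 2 * (real n * k)) = 371 / 8 * real n"
    using k by simp
  finally show ?thesis by simp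
qed

text \<open>The sum is cubic in \<open>n\<close>, but a bound proportional to \<open>n / k\<close>
  is what fits the linear induction hypothesis. Its value at \<open>n = k\<close> explains the cube
  in the step-size rule.\<close>

lemma sum_squares_le:
  assumes k: "k \<ge> 1" and n: "n \<le> k"
  shows "(\<Sum>t=1..n. (real t + 1)\<^sup>2) \<le> real n / real k * ((real k + 2) ^ 3 / 3)"
proof -
  have "(\<Sum>t=1..n. (real t + 1)\<^sup>2) = real n * (2 * (real n)\<^sup>2 + 9 * real n + 13) / 6"
    by (induction n) (simp_all add: field_simps power2_eq_square)
  also have "\<dots> \<le> real n * (2 * (real k)\<^sup>2 + 9 * real k + 13) / 6"
    using n by (intro divide_right_mono mult_left_mono add_mono power_mono) auto
  also have "\<dots> \<le> real n * ((real k + 2) ^ 3 / (3 * real k))"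
  proof -
    have "(2 * (real k)\<^sup>2 + 9 * real k + 13) / 6 \<le> (real k + 2) ^ 3 / (3 * real k)"
      using k by (simp add: field_simps power2_eq_square power3_eq_cube)
    from mult_left_mono[OF this, of "real n"] show ?thesis by simp
  qed
  finally show ?thesis by simp
qed

text \<open>The sequences stand for expectations: \<open>a\<close> of the gap, \<open>v\<close> of
  the divergence to \<open>xstar\<close>, \<open>r\<close> of half the squared distance from
  \<open>x t\<close> to \<open>xstar\<close>, \<open>e\<close> of the squared spread between
  \<open>z t\<close> and \<open>x t\<close>. \<open>B\<close> is the second moment of
  \<open>K\<close>.\<close>

locale sagd_moments =
  fixes a v r e :: "nat \<Rightarrow> real" and L LL \<sigma> \<eta> D B Kb :: real and m k :: nat
  assumes nonneg: "\<And>t. 0 \<le> a t" "\<And>t. 0 \<le> v t" "\<And>t. 0 \<le> e t"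
    and pars: "0 \<le> L" "0 \<le> LL" "0 < \<eta>" "0 < D" "0 \<le> B" "1 \<le> m" "2 \<le> k"
    and v0: "v 0 \<le> D\<^sup>2"
    and first: "a 1 + 3 * \<eta> / ((1 + 1) * (1 + 2)) * v 1
        \<le> 3 * \<eta> / ((1 + 1) * (1 + 2)) * v 0 + 4 / (\<eta> * m) * (LL * (L * D\<^sup>2) + \<sigma>\<^sup>2)"
    and rec: "\<And>t. t \<ge> 1 \<Longrightarrow> a (Suc t) + 3 * \<eta> / ((real t + 2) * (real t + 3)) * v (Suc t)
        \<le> real t / (real t + 3) * a t + 3 * \<eta> / ((real t + 2) * (real t + 3)) * v t
          + 6 * (real t + 2) / ((real t + 3) * \<eta> * m) *
            (3 * (LL * a t + \<sigma>\<^sup>2) + 3 / 2 * B * (3 / (real t + 3))\<^sup>2 * e t)"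
    and r1: "r 1 \<le> v 1"
    and r_rec: "\<And>t. t \<ge> 1 \<Longrightarrow> r (Suc t) \<le> real t / (real t + 3) * r t + 3 / (real t + 3) * v (Suc t)"
    and e_le: "\<And>t. e t \<le> 4 * v t + 4 * r t"
    and eta: "4 * L \<le> \<eta>" "18 * (real k + 1) * LL / m \<le> \<eta>"
      "144 * real k * Kb\<^sup>2 / m \<le> \<eta>\<^sup>2" "2 * \<sigma>\<^sup>2 * (real k + 2) ^ 3 / m \<le> \<eta>\<^sup>2 * D\<^sup>2"
    and Kb: "3 * B \<le> Kb\<^sup>2"
begin

text \<open>The weight of \<open>a t\<close> is the reciprocal of the product of averaging weight
  and step parameter at \<open>t\<close>.\<close>

definition lyap :: "nat \<Rightarrow> real" where
  "lyap t = (real t + 1) * (real t + 2) / (3 * \<eta>) * a t + v t"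

lemma m_pos: "real m > 0" using pars by simp

lemma lyap_1: "lyap 1 \<le> D\<^sup>2 + 4 / 27 * L * D\<^sup>2 / \<eta> + 6 * \<sigma>\<^sup>2 / (\<eta>\<^sup>2 * m) * 4"
proof -
  have "LL / m \<le> \<eta> / (18 * (real k + 1))" using eta(2) pars m_pos by (simp add: field_simps)
  \<comment> \<open>From \<open>k \<ge> 2\<close>; then \<open>8 / 54 = 4 / 27\<close>.\<close>
  also have "\<dots> \<le> \<eta> / (18 * 3)" using pars by (intro divide_left_mono mult_left_mono) auto
  finally have "8 / \<eta>\<^sup>2 * (L * D\<^sup>2) * (LL / m) \<le> 8 / \<eta>\<^sup>2 * (L * D\<^sup>2) * (\<eta> / 54)"
    using pars by (intro mult_left_mono) auto
  then have 1: "8 * LL * (L * D\<^sup>2) / (\<eta>\<^sup>2 * m) \<le> 4 / 27 * L * D\<^sup>2 / \<eta>"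
    using pars by (simp add: power2_eq_square mult_ac)
  have "2 / \<eta> * (a 1 + 3 * \<eta> / ((1 + 1) * (1 + 2)) * v 1)
      \<le> 2 / \<eta> * (3 * \<eta> / ((1 + 1) * (1 + 2)) * v 0 + 4 / (\<eta> * m) * (LL * (L * D\<^sup>2) + \<sigma>\<^sup>2))"
    using pars by (intro mult_left_mono first) auto
  then have "lyap 1 \<le> v 0 + 8 * LL * (L * D\<^sup>2) / (\<eta>\<^sup>2 * m) + 8 * \<sigma>\<^sup>2 / (\<eta>\<^sup>2 * m)"
    using pars m_pos by (simp add: lyap_def field_simps power2_eq_square)
  \<comment> \<open>Enlarged so that the first step becomes the summand \<open>t = 1\<close> of the
    sum of \<open>(t + 1)\<^sup>2\<close>.\<close>
  moreover have "8 * \<sigma>\<^sup>2 / (\<eta>\<^sup>2 * m) \<le> 6 * \<sigma>\<^sup>2 / (\<eta>\<^sup>2 * m) * 4"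
    by (simp add: divide_right_mono)
  ultimately show ?thesis using 1 v0 by linarith
qed

lemma lyap_Suc:
  assumes t: "t \<ge> 1" "t < k"
  shows "lyap (Suc t) \<le> lyap t + 6 * \<sigma>\<^sup>2 / (\<eta>\<^sup>2 * m) * (real t + 2)\<^sup>2 + 27 * B / (\<eta>\<^sup>2 * m) * e t"
proof -
  let ?c = "(real t + 2) * (real t + 3) / (3 * \<eta>)" and ?u = "real t + 2" and ?w = "real t + 3"
  have pos: "?u > 0" "?w > 0" "\<eta> > 0" "real m > 0" using pars m_pos by auto
  have "?c * (a (Suc t) + 3 * \<eta> / (?u * ?w) * v (Suc t))
      \<le> ?c * (real t / ?w * a t + 3 * \<eta> / (?u * ?w) * v t + 6 * ?u / (?w * \<eta> * m) *
            (3 * (LL * a t + \<sigma>\<^sup>2) + 3 / 2 * B * (3 / ?w)\<^sup>2 * e t))"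
    using pars by (intro mult_left_mono rec t) auto
  moreover have "?c * (a (Suc t) + 3 * \<eta> / (?u * ?w) * v (Suc t)) = lyap (Suc t)"
  proof -
    have "u * w / (3 * h) * (p + 3 * h / (u * w) * q) = u * w / (3 * h) * p + q"
      if "u > 0" "w > 0" "h > 0" for u w h p q :: real
      using that by (simp add: field_simps)
    from this[OF pos(1-3)] show ?thesis by (simp add: lyap_def add.commute)
  qed
  moreover have arith: "u * w / (3 * h) * (p / w * a' + 3 * h / (u * w) * v' + 6 * u / (w * h * n) *
            (3 * (l * a' + s) + 3 / 2 * b * (3 / w)\<^sup>2 * q))
      = p * u / (3 * h) * a' + v' + 6 * u\<^sup>2 * l / (h\<^sup>2 * n) * a' + 6 * s / (h\<^sup>2 * n) * u\<^sup>2
        + 27 * b / (h\<^sup>2 * n) * q * (u / w)\<^sup>2"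
    if "u > 0" "w > 0" "h > 0" "n > 0" for u w h n p a' v' l s b q :: real
    using that by (simp add: field_simps power2_eq_square)
  ultimately have main: "lyap (Suc t) \<le> real t * ?u / (3 * \<eta>) * a t + v t
      + 6 * ?u\<^sup>2 * LL / (\<eta>\<^sup>2 * m) * a t + 6 * \<sigma>\<^sup>2 / (\<eta>\<^sup>2 * m) * ?u\<^sup>2
      + 27 * B / (\<eta>\<^sup>2 * m) * e t * (?u / ?w)\<^sup>2"
    using arith[OF pos] by metis
  \<comment> \<open>Here \<open>t < k\<close> enters: \<open>t + 2 \<le> k + 1\<close>. The
    right-hand side is the weight that the gap loses in this step.\<close>
  have "6 * ?u\<^sup>2 * LL / (\<eta>\<^sup>2 * m) \<le> ?u / (3 * \<eta>)"
  proof -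
    have "18 * ?u * LL / m \<le> 18 * (real k + 1) * LL / m"
      using t pars by (intro divide_right_mono mult_right_mono) auto
    with eta(2) have "18 * ?u * LL / m \<le> \<eta>" by linarith
    then have le: "?u / (3 * \<eta>\<^sup>2) * (18 * ?u * LL / m) \<le> ?u / (3 * \<eta>\<^sup>2) * \<eta>"
      by (intro mult_left_mono) auto
    have eq: "u / (3 * h\<^sup>2) * (18 * u * l / n) = 6 * u\<^sup>2 * l / (h\<^sup>2 * n)" "u / (3 * h\<^sup>2) * h = u / (3 * h)"
      if "h > 0" "n > 0" for u h l n :: real
      using that by (simp_all add: field_simps power2_eq_square)
    show ?thesis using le unfolding eq[OF pos(3,4)] .
  qed
  then have "6 * ?u\<^sup>2 * LL / (\<eta>\<^sup>2 * m) * a t \<le> ?u / (3 * \<eta>) * a t"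
    using nonneg(1) by (rule mult_right_mono)
  moreover have "real t * ?u / (3 * \<eta>) * a t + v t + ?u / (3 * \<eta>) * a t = lyap t"
    using pos(3) by (simp add: lyap_def field_simps)
  moreover have "27 * B / (\<eta>\<^sup>2 * m) * e t * (?u / ?w)\<^sup>2 \<le> 27 * B / (\<eta>\<^sup>2 * m) * e t"
    using nonneg(3)[of t] pars by (intro mult_right_le_one_le) (auto simp: power_le_one)
  ultimately show ?thesis using main by linarith
qed

lemma lyap_le:
  assumes n: "1 \<le> n" "n \<le> k"
  shows "lyap n \<le> D\<^sup>2 + 4 / 27 * L * D\<^sup>2 / \<eta> + 6 * \<sigma>\<^sup>2 / (\<eta>\<^sup>2 * m) * (\<Sum>t=1..n. (real t + 1)\<^sup>2)
      + 27 * B / (\<eta>\<^sup>2 * m) * (\<Sum>s=1..<n. e s)"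
  using n
proof (induction n rule: dec_induct)
  case base
  then show ?case using lyap_1 by simp
next
  case (step n)
  have 1: "(\<Sum>t=1..Suc n. (real t + 1)\<^sup>2) = (\<Sum>t=1..n. (real t + 1)\<^sup>2) + (real n + 2)\<^sup>2"
    by (simp add: add.commute)
  have 2: "(\<Sum>s=1..<Suc n. e s) = (\<Sum>s=1..<n. e s) + e n"
    using step(1) by simp
  have "lyap (Suc n) \<le> lyap n + 6 * \<sigma>\<^sup>2 / (\<eta>\<^sup>2 * m) * (real n + 2)\<^sup>2 + 27 * B / (\<eta>\<^sup>2 * m) * e n"
    using step by (intro lyap_Suc) auto
  with step.IH step.prems show ?case unfolding 1 2 distrib_left by linarith
qed

lemma sigma_term:
  assumes n: "n \<le> k"
  shows "6 * \<sigma>\<^sup>2 / (\<eta>\<^sup>2 * m) * (\<Sum>t=1..n. (real t + 1)\<^sup>2)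
      \<le> real n / real k * (2 * \<sigma>\<^sup>2 * (real k + 2) ^ 3 / (\<eta>\<^sup>2 * m))"
proof -
  have "6 * \<sigma>\<^sup>2 / (\<eta>\<^sup>2 * m) * (\<Sum>t=1..n. (real t + 1)\<^sup>2)
      \<le> 6 * \<sigma>\<^sup>2 / (\<eta>\<^sup>2 * m) * (real n / real k * ((real k + 2) ^ 3 / 3))"
    using pars n by (intro mult_left_mono sum_squares_le) auto
  then show ?thesis by (simp add: mult_ac)
qed

lemma sigma_const: "2 * \<sigma>\<^sup>2 * (real k + 2) ^ 3 / (\<eta>\<^sup>2 * m) \<le> D\<^sup>2"
  using eta(4) pars m_pos by (simp add: field_simps)

lemma L_const: "4 / 27 * L * D\<^sup>2 / \<eta> \<le> D\<^sup>2 / 27"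
  using mult_right_mono[OF eta(1), of "D\<^sup>2"] pars by (simp add: field_simps)

text \<open>The constants are chosen so that the bound is \<open>3 D\<^sup>2\<close> at \<open>t = k\<close>; the growth linear in \<open>t\<close>
  is essential, since the constant bound \<open>3 D\<^sup>2\<close> does not reproduce itself in the induction.\<close>

definition vbound :: "nat \<Rightarrow> real" where
  "vbound t = D\<^sup>2 / 27 * (28 + 53 * real t / real k)"

text \<open>\<open>x n\<close> averages \<open>z 1\<close>, ..., \<open>z n\<close> with weights
  \<open>3 * s * (s + 1) / (n * (n + 1) * (n + 2))\<close>. The weighted mean of \<open>s\<close> is
  \<open>(3 * n + 1) / 4\<close>, so the bound is \<open>vbound\<close> with \<open>t\<close>
  replaced by that mean.\<close>

lemma r_le:
  assumes n: "n \<ge> 1" and v: "\<And>s. 1 \<le> s \<Longrightarrow> s \<le> n \<Longrightarrow> v s \<le> vbound s"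
  shows "r n \<le> D\<^sup>2 / 27 * (28 + 53 * (3 * real n + 1) / (4 * real k))"
  using n v
proof (induction n rule: dec_induct)
  case base
  then show ?case using r1 by (fastforce simp: vbound_def)
next
  case (step n)
  have "r (Suc n) \<le> real n / (real n + 3) * r n + 3 / (real n + 3) * v (Suc n)"
    using r_rec step by simp
  also have "\<dots> \<le> real n / (real n + 3) * (D\<^sup>2 / 27 * (28 + 53 * (3 * real n + 1) / (4 * real k)))
      + 3 / (real n + 3) * vbound (Suc n)"
    using step by (intro add_mono mult_left_mono) auto
  also have "\<dots> = D\<^sup>2 / 27 * (28 + 53 * (3 * real (Suc n) + 1) / (4 * real k))"
  proof -
    have "p / (p + 3) * (d * (28 + 53 * (3 * p + 1) / (4 * q))) + 3 / (p + 3) * (d * (28 + 53 * (1 + p) / q))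
        = d * (28 + 53 * (3 * (1 + p) + 1) / (4 * q))" if "q > 0" "p \<ge> 0" for p d q :: real
      using that by (simp add: divide_simps) (simp add: algebra_simps)
    from this[of "real k" "real n" "D\<^sup>2 / 27"] pars show ?thesis by (simp add: vbound_def)
  qed
  finally show ?case .
qed

lemma spread_sum_le:
  assumes n: "1 \<le> n" "n \<le> k" and v: "\<And>s. 1 \<le> s \<Longrightarrow> s < n \<Longrightarrow> v s \<le> vbound s"
  shows "(\<Sum>s=1..<n. e s) \<le> 416 / 27 * D\<^sup>2 * real n"
proof -
  have "(\<Sum>s=1..<n. e s) \<le> (\<Sum>s=1..<n. 4 * D\<^sup>2 / 27 * (56 + 53 * (7 * real s + 1) / (4 * real k)))"
  proof (rule sum_mono)
    fix s assume "s \<in> {1..<n}"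
    then have s: "1 \<le> s" "s < n" by auto
    have "e s \<le> 4 * vbound s + 4 * (D\<^sup>2 / 27 * (28 + 53 * (3 * real s + 1) / (4 * real k)))"
    proof -
      have "r s \<le> D\<^sup>2 / 27 * (28 + 53 * (3 * real s + 1) / (4 * real k))"
        using s by (intro r_le v) auto
      with e_le[of s] v[OF s] show ?thesis by linarith
    qed
    also have "\<dots> = 4 * D\<^sup>2 / 27 * (56 + 53 * (7 * real s + 1) / (4 * real k))"
      using pars by (simp add: vbound_def field_simps)
    finally show "e s \<le> 4 * D\<^sup>2 / 27 * (56 + 53 * (7 * real s + 1) / (4 * real k))" .
  qed
  also have "\<dots> \<le> 4 * D\<^sup>2 / 27 * (104 * real n)"
    unfolding sum_distrib_left[symmetric] using n pars
    by (intro mult_left_mono sum_spread_bound) auto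
  finally show ?thesis by simp
qed

lemma K_const: "27 * B / (\<eta>\<^sup>2 * m) \<le> 9 * Kb\<^sup>2 / (\<eta>\<^sup>2 * m)" "9 * Kb\<^sup>2 / (\<eta>\<^sup>2 * m) \<le> 1 / (16 * real k)"
  using Kb eta(3) pars m_pos by (simp_all add: field_simps)

lemma v_le:
  assumes "n \<ge> 1" "n \<le> k"
  shows "v n \<le> vbound n"
  using assms
proof (induction n rule: less_induct)
  case (less n)
  have "27 * B / (\<eta>\<^sup>2 * m) * (\<Sum>s=1..<n. e s) \<le> 1 / (16 * real k) * (416 / 27 * D\<^sup>2 * real n)"
    using K_const pars less spread_sum_le[of n]
    by (intro mult_mono) (auto intro!: sum_nonneg nonneg)
  moreover have "6 * \<sigma>\<^sup>2 / (\<eta>\<^sup>2 * m) * (\<Sum>t=1..n. (real t + 1)\<^sup>2) \<le> real n / real k * D\<^sup>2"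
    using sigma_term[of n] less mult_left_mono[OF sigma_const, of "real n / real k"]
    by simp
  moreover have "v n \<le> lyap n" using nonneg(1)[of n] pars by (simp add: lyap_def)
  ultimately have "v n \<le> D\<^sup>2 + D\<^sup>2 / 27 + real n / real k * D\<^sup>2 + 1 / (16 * real k) * (416 / 27 * D\<^sup>2 * real n)"
    using lyap_le[of n] L_const less by linarith
  \<comment> \<open>In units of \<open>D\<^sup>2 / 27\<close>: the start gives 27 and the first step
    1, hence 28; at \<open>n = k\<close> the additive noise gives 27 and the spread
    \<open>416 / 16 = 26\<close>, hence 53. The total is 81.\<close>
  also have "\<dots> = vbound n" using pars by (simp add: vbound_def field_simps)
  finally show ?case .
qed

lemma v_le_3:
  assumes "n \<ge> 1" "n \<le> k"
  shows "v n \<le> 3 * D\<^sup>2"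
proof -
  have "real n / real k \<le> 1" using assms by simp
  then have "D\<^sup>2 / 27 * (28 + 53 * (real n / real k)) \<le> D\<^sup>2 / 27 * (28 + 53 * 1)"
    by (intro mult_left_mono add_mono) auto
  with v_le[OF assms] show ?thesis by (simp add: vbound_def)
qed

lemma a_le:
  "(real k + 1) * (real k + 2) * a k \<le> 3 * \<eta> * D\<^sup>2 + 4 / 9 * L * D\<^sup>2
     + 3 * (2 * \<sigma>\<^sup>2 * (real k + 2) ^ 3 / m) / \<eta> + 3 * (144 * real k * Kb\<^sup>2 / m) * D\<^sup>2 / \<eta>"
proof -
  have "(\<Sum>s=1..<k. e s) \<le> 416 / 27 * D\<^sup>2 * real k"
    using v_le pars by (intro spread_sum_le) auto
  \<comment> \<open>Rounded so that \<open>9 * 16 = 144\<close> reproduces the square of the factor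
    12 in the step-size rule.\<close>
  also have "\<dots> \<le> 16 * D\<^sup>2 * real k" by (intro mult_right_mono) auto
  finally have "27 * B / (\<eta>\<^sup>2 * m) * (\<Sum>s=1..<k. e s) \<le> 9 * Kb\<^sup>2 / (\<eta>\<^sup>2 * m) * (16 * D\<^sup>2 * real k)"
    using K_const pars by (intro mult_mono) (auto intro!: sum_nonneg nonneg)
  moreover have "6 * \<sigma>\<^sup>2 / (\<eta>\<^sup>2 * m) * (\<Sum>t=1..k. (real t + 1)\<^sup>2) \<le> 2 * \<sigma>\<^sup>2 * (real k + 2) ^ 3 / (\<eta>\<^sup>2 * m)"
    using sigma_term[of k] pars by simp
  moreover have "(real k + 1) * (real k + 2) / (3 * \<eta>) * a k \<le> lyap k"
    using nonneg(2)[of k] by (simp add: lyap_def)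
  ultimately have "(real k + 1) * (real k + 2) / (3 * \<eta>) * a k
      \<le> D\<^sup>2 + 4 / 27 * L * D\<^sup>2 / \<eta> + 2 * \<sigma>\<^sup>2 * (real k + 2) ^ 3 / (\<eta>\<^sup>2 * m)
        + 9 * Kb\<^sup>2 / (\<eta>\<^sup>2 * m) * (16 * D\<^sup>2 * real k)"
    using lyap_le[of k] pars by linarith
  then have "3 * \<eta> * ((real k + 1) * (real k + 2) / (3 * \<eta>) * a k)
      \<le> 3 * \<eta> * (D\<^sup>2 + 4 / 27 * L * D\<^sup>2 / \<eta> + 2 * \<sigma>\<^sup>2 * (real k + 2) ^ 3 / (\<eta>\<^sup>2 * m)
        + 9 * Kb\<^sup>2 / (\<eta>\<^sup>2 * m) * (16 * D\<^sup>2 * real k))"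
    using pars by (intro mult_left_mono) auto
  moreover have "3 * h * (d + 4 / 27 * l * d / h + s / (h\<^sup>2 * n) + 9 * q / (h\<^sup>2 * n) * (16 * d * p))
      = 3 * h * d + 4 / 9 * l * d + 3 * (s / n) / h + 3 * (144 * p * q / n) * d / h"
    if "h > 0" "n > 0" for h d l s n q p :: real
    using that by (simp add: field_simps power2_eq_square)
  ultimately show ?thesis using pars m_pos by simp
qed

end

section \<open>Elementary estimates for the final rate and conclusion\<close>

lemma sqrt_ratio_le:
  fixes p n b :: real
  assumes "0 \<le> p" "0 < n" "0 \<le> b"
  shows "sqrt (p * b\<^sup>2 / n) / (p + 1) \<le> b / sqrt ((p + 1) * n)"
proof (rule power2_le_imp_le)
  have "p * b\<^sup>2 / n / (p + 1)\<^sup>2 \<le> (p + 1) * b\<^sup>2 / n / (p + 1)\<^sup>2"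
    using assms by (intro divide_right_mono mult_right_mono) auto
  also have "\<dots> = b\<^sup>2 / ((p + 1) * n)"
    using assms by (simp add: power2_eq_square)
  finally show "(sqrt (p * b\<^sup>2 / n) / (p + 1))\<^sup>2 \<le> (b / sqrt ((p + 1) * n))\<^sup>2"
    using assms by (simp add: power_divide)
qed (use assms in auto)

text \<open>After squaring this is \<open>72 * (p + 2) \<le> 96 * (p + 1)\<close>, with equality at
  \<open>p = 2\<close>.\<close>

lemma sqrt_cube_ratio_le:
  fixes p n :: real
  assumes "2 \<le> p" "0 < n"
  shows "6 * sqrt (2 * (p + 2) ^ 3 / n) / ((p + 1) * (p + 2)) \<le> 4 * sqrt 6 / sqrt ((p + 1) * n)"
proof (rule power2_le_imp_le)
  have "36 * (2 * (p + 2) ^ 3 / n) / ((p + 1) * (p + 2))\<^sup>2 = 72 * (p + 2) / (n * (p + 1)\<^sup>2)"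
    using assms by (simp add: power2_eq_square power3_eq_cube divide_simps)
  also have "\<dots> \<le> 96 * (p + 1) / (n * (p + 1)\<^sup>2)"
    using assms by (intro divide_right_mono) auto
  also have "\<dots> = 96 / ((p + 1) * n)"
  proof -
    have "96 * q / (n * q\<^sup>2) = 96 / (q * n)" if "0 < q" for q :: real
      using that by (simp add: power2_eq_square mult.commute)
    from this[of "p + 1"] show ?thesis using assms by simp
  qed
  finally show "(6 * sqrt (2 * (p + 2) ^ 3 / n) / ((p + 1) * (p + 2)))\<^sup>2
      \<le> (4 * sqrt 6 / sqrt ((p + 1) * n))\<^sup>2"
    using assms by (simp add: power_divide power_mult_distrib)
qed (use assms in auto)

theorem corollary2:
  fixes N :: "'a::euclidean_space \<Rightarrow> real"
    and X :: "'a set" and f :: "'a \<Rightarrow> real" and g :: "'a \<Rightarrow> 'a" and L fstar :: real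
    and M :: "'w measure" and Xi :: "'s measure"
    and \<xi> :: "nat \<Rightarrow> nat \<Rightarrow> 'w \<Rightarrow> 's" and G :: "'a \<Rightarrow> 's \<Rightarrow> 'a"
    and \<omega> :: "'a \<Rightarrow> real" and \<omega>' :: "'a \<Rightarrow> 'a" and x0 xstar :: 'a
    and LL \<sigma> Kbar \<eta> D :: real and K :: "'s \<Rightarrow> real" and m k :: nat
    and x y z :: "nat \<Rightarrow> 'w \<Rightarrow> 'a"
  assumes N: "is_norm N"
    and X: "closed X" "convex X"
    and f_convex: "convex_on X f"
    and f_gradient: "\<And>u. u \<in> X \<Longrightarrow> (f has_derivative (\<lambda>h. g u \<bullet> h)) (at u within X)"
    and L_nonneg: "L \<ge> 0"
    and f_smooth: "\<And>u v. u \<in> X \<Longrightarrow> v \<in> X \<Longrightarrow>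
          0 \<le> f v - f u - g u \<bullet> (v - u) \<and>
          f v - f u - g u \<bullet> (v - u) \<le> L / 2 * (N (v - u))\<^sup>2"
    and xstar: "is_arg_min f (\<lambda>u. u \<in> X) xstar"
    and fstar: "fstar = (INF u\<in>X. f u)"
    and \<omega>_gradient: "\<And>u. GDERIV \<omega> u :> \<omega>' u"
    and \<omega>'_continuous: "continuous_on UNIV \<omega>'"
    and \<omega>_strongly_convex: "strongly_convex N 1 \<omega>"
    and \<omega>_min: "\<omega> 0 = 0" "\<And>u. \<omega> u \<ge> 0"
    and M: "prob_space M"
    and m: "m \<ge> 1"
    and \<xi>_indep: "prob_space.indep_vars M (\<lambda>_. Xi) (\<lambda>(t, i). \<xi> t i) (UNIV \<times> {1..m})"
    and \<xi>_ident: "\<And>t i. i \<in> {1..m} \<Longrightarrow> distr M Xi (\<xi> t i) = distr M Xi (\<xi> t 1)"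
    and G_measurable: "\<And>u. u \<in> X \<Longrightarrow> G u \<in> borel_measurable Xi"
    and G_unbiased: "\<And>u t i. u \<in> X \<Longrightarrow> i \<in> {1..m} \<Longrightarrow>
          integrable M (\<lambda>w. G u (\<xi> t i w)) \<and> (\<integral>w. G u (\<xi> t i w) \<partial>M) = g u"
    and LL_nonneg: "LL \<ge> 0" and \<sigma>_nonneg: "\<sigma> \<ge> 0"
    and G_variance: "\<And>u t. u \<in> X \<Longrightarrow>
          integrable M (\<lambda>w. (dual_norm N (G u (\<xi> t 1 w) - g u))\<^sup>2) \<and>
          (\<integral>w. (dual_norm N (G u (\<xi> t 1 w) - g u))\<^sup>2 \<partial>M)
            \<le> LL * (f u - fstar - g xstar \<bullet> (u - xstar)) + \<sigma>\<^sup>2"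
    and K_pos: "\<And>s. s \<in> space Xi \<Longrightarrow> K s > 0"
    and K_measurable: "K \<in> borel_measurable Xi"
    and K_square_integrable: "\<And>t. integrable M (\<lambda>w. (K (\<xi> t 1 w))\<^sup>2)"
    and K_second_moment: "\<And>t t'. (\<integral>w. (K (\<xi> t 1 w))\<^sup>2 \<partial>M) = (\<integral>w. (K (\<xi> t' 1 w))\<^sup>2 \<partial>M)"
    and G_lipschitz: "\<And>s u v. s \<in> space Xi \<Longrightarrow> u \<in> X \<Longrightarrow> v \<in> X \<Longrightarrow>
          dual_norm N (G u s - G v s) \<le> K s * N (u - v)"
    and Kbar: "Kbar = sqrt (3 * (\<integral>w. (K (\<xi> 1 1 w))\<^sup>2 \<partial>M) + 3 * L\<^sup>2)"
    and k: "k \<ge> 2"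
    and x0: "x0 \<in> X"
    and D: "D > 0" "bregman \<omega> \<omega>' x0 x0 xstar \<le> D\<^sup>2"
    and \<eta>: "\<eta> = Max {4 * L, 18 * (k + 1) * LL / m, 12 * sqrt (k * Kbar\<^sup>2 / m),
                     \<sigma> / D * sqrt (2 * (k + 2) ^ 3 / m)}"
    and sagd: "\<And>w. w \<in> space M \<Longrightarrow>
          sagd_run X (bregman \<omega> \<omega>' x0) G x0 (\<lambda>t. 3 / (t + 2)) (\<lambda>t. \<eta> / (t + 1)) (\<lambda>_. m)
            (\<lambda>t i. \<xi> t i w) (\<lambda>t. x t w) (\<lambda>t. y t w) (\<lambda>t. z t w)"
  shows "(\<forall>t\<in>{1..k}.
            integrable M (\<lambda>w. bregman \<omega> \<omega>' x0 (z t w) xstar) \<and>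
            (\<integral>w. bregman \<omega> \<omega>' x0 (z t w) xstar \<partial>M) \<le> 3 * D\<^sup>2) \<and>
         integrable M (\<lambda>w. f (x k w) - fstar) \<and>
         (\<integral>w. (f (x k w) - fstar) \<partial>M)
           \<le> 13 * L * D\<^sup>2 / ((k + 1) * (k + 2)) + 54 * LL * D\<^sup>2 / ((k + 2) * m)
             + 72 * Kbar * D\<^sup>2 / ((k + 2) * sqrt ((k + 1) * m))
             + 4 * \<sigma> * D * sqrt 6 / sqrt ((k + 1) * m)"
proof -
  interpret prob_space M by fact
  \<comment> \<open>Guarantees a positive step parameter even if \<open>L\<close>, \<open>LL\<close>
    and \<open>\<sigma>\<close> all vanish.\<close>
  have K2_pos: "0 < (\<integral>w. (K (\<xi> 1 1 w))\<^sup>2 \<partial>M)"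
  proof -
    have \<xi>1: "\<xi> 1 1 \<in> measurable M Xi"
      using \<xi>_indep m by (auto simp: indep_vars_def)
    have pos: "0 < (K (\<xi> 1 1 w))\<^sup>2" if "w \<in> space M" for w
      using K_pos[OF measurable_space[OF \<xi>1 that]] by simp
    have "\<not> (AE w in M. (K (\<xi> 1 1 w))\<^sup>2 = 0)"
    proof
      assume "AE w in M. (K (\<xi> 1 1 w))\<^sup>2 = 0"
      then have "AE w in M. False" by (rule AE_mp) (use pos in \<open>auto intro!: AE_I2\<close>)
      then show False by simp
    qed
    then have ne: "(\<integral>w. (K (\<xi> 1 1 w))\<^sup>2 \<partial>M) \<noteq> 0"
      using K_square_integrable[of 1] by (subst integral_nonneg_eq_0_iff_AE) auto
    have "0 \<le> (\<integral>w. (K (\<xi> 1 1 w))\<^sup>2 \<partial>M)" by simp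
    with ne show ?thesis by linarith
  qed
  have Kbar_sq: "3 * (\<integral>w. (K (\<xi> 1 1 w))\<^sup>2 \<partial>M) \<le> Kbar\<^sup>2" and Kbar_pos: "0 < Kbar"
    using K2_pos by (auto simp: Kbar intro: add_pos_nonneg)
  have k0: "0 < real k" and m0: "0 < real m" using k m by auto
  define \<eta>L where "\<eta>L = 18 * (real k + 1) * LL / real m"
  define \<eta>K where "\<eta>K = 12 * sqrt (real k * Kbar\<^sup>2 / real m)"
  define \<eta>S where "\<eta>S = \<sigma> / D * sqrt (2 * (real k + 2) ^ 3 / real m)"
  have \<eta>_Max: "\<eta> = Max {4 * L, \<eta>L, \<eta>K, \<eta>S}"
    unfolding \<eta> \<eta>L_def \<eta>K_def \<eta>S_def by (simp add: add.commute)
  have \<eta>_ge: "4 * L \<le> \<eta>" "\<eta>L \<le> \<eta>" "\<eta>K \<le> \<eta>" "\<eta>S \<le> \<eta>"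
    unfolding \<eta>_Max by (rule Max_ge; simp)+
  have nonneg: "0 \<le> \<eta>L" "0 < \<eta>K" "0 \<le> \<eta>S"
    using LL_nonneg \<sigma>_nonneg D(1) k0 m0 Kbar_pos by (auto simp: \<eta>L_def \<eta>K_def \<eta>S_def)
  have \<eta>_in: "\<eta> \<in> {4 * L, \<eta>L, \<eta>K, \<eta>S}"
    unfolding \<eta>_Max by (rule Max_in) auto
  then have \<eta>_le: "\<eta> \<le> 4 * L + \<eta>L + \<eta>K + \<eta>S"
    using nonneg L_nonneg by auto
  have \<eta>_pos: "0 < \<eta>" using nonneg(2) \<eta>_ge(3) by simp
  have \<eta>K_sq: "\<eta>K\<^sup>2 = 144 * real k * Kbar\<^sup>2 / real m"
    using k0 m0 by (simp add: \<eta>K_def power_mult_distrib)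
  have \<eta>S_sq: "\<eta>S\<^sup>2 * D\<^sup>2 = 2 * \<sigma>\<^sup>2 * (real k + 2) ^ 3 / real m"
    using D(1) k0 m0 by (simp add: \<eta>S_def power_mult_distrib power_divide)
  interpret sagd_setup N X \<omega> \<omega>' x0 M f g L fstar Xi \<xi> G xstar LL \<sigma> \<eta> K m x y z
    by unfold_locales
      (fact N X x0 \<omega>_gradient \<omega>'_continuous \<omega>_strongly_convex \<omega>_min f_gradient L_nonneg f_smooth
        xstar fstar m \<xi>_indep \<xi>_ident G_measurable G_unbiased LL_nonneg G_variance K_pos K_measurable
        K_square_integrable K_second_moment G_lipschitz \<eta>_pos \<eta>_ge(1) sagd)+
  let ?a = "\<lambda>t. \<integral>w. gap t w \<partial>M" and ?v = "\<lambda>t. \<integral>w. div_star t w \<partial>M"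
  let ?r = "\<lambda>t. \<integral>w. (N (x t w - xstar))\<^sup>2 / 2 \<partial>M" and ?e = "\<lambda>t. \<integral>w. (N (z t w - x t w))\<^sup>2 \<partial>M"
  interpret mom: sagd_moments ?a ?v ?r ?e L LL \<sigma> \<eta> D K2 Kbar m k
  proof
    show "0 \<le> ?a t" "0 \<le> ?v t" "0 \<le> ?e t" for t
      using gap_nonneg[OF x_in_X] bregman_nonneg
      by (auto intro!: Bochner_Integration.integral_nonneg)
    show "?v 0 \<le> D\<^sup>2"
    proof -
      have "?v 0 = (\<integral>w. V x0 xstar \<partial>M)"
        by (intro Bochner_Integration.integral_cong refl) (simp add: path_0)
      then show ?thesis using D(2) by (simp add: prob_space)
    qed
    have "LL * (L * V x0 xstar) + \<sigma>\<^sup>2 \<le> LL * (L * D\<^sup>2) + \<sigma>\<^sup>2"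
      using LL_nonneg L_nonneg D(2) by (simp add: mult_left_mono)
    then have S: "(\<integral>w. (Ndual (noise 1 i w + drift 1 w))\<^sup>2 \<partial>M) \<le> LL * (L * D\<^sup>2) + \<sigma>\<^sup>2"
      if "i \<in> {1..m}" for i
      using noise_drift_bound_first[OF that] by linarith
    show "?a 1 + 3 * \<eta> / ((1 + 1) * (1 + 2)) * ?v 1
        \<le> 3 * \<eta> / ((1 + 1) * (1 + 2)) * ?v 0 + 4 / (\<eta> * m) * (LL * (L * D\<^sup>2) + \<sigma>\<^sup>2)"
      using expected_recursion[OF order_refl S] by simp
    show "?a (Suc t) + 3 * \<eta> / ((real t + 2) * (real t + 3)) * ?v (Suc t)
        \<le> real t / (real t + 3) * ?a t + 3 * \<eta> / ((real t + 2) * (real t + 3)) * ?v t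
          + 6 * (real t + 2) / ((real t + 3) * \<eta> * m) *
            (3 * (LL * ?a t + \<sigma>\<^sup>2) + 3 / 2 * K2 * (3 / (real t + 3))\<^sup>2 * ?e t)"
      if "t \<ge> 1" for t
    proof -
      have coeffs: "\<beta> (Suc t) = 3 / (real t + 3)" "1 - \<beta> (Suc t) = real t / (real t + 3)"
        "\<beta> (Suc t) * \<eta>s (Suc t) = 3 * \<eta> / ((real t + 2) * (real t + 3))"
        "2 * \<beta> (Suc t) / (\<eta>s (Suc t) * m) = 6 * (real t + 2) / ((real t + 3) * \<eta> * m)"
        using \<eta>_pos m0 by (simp_all add: field_simps)
      have t: "Suc t \<ge> 1" by simp
      show ?thesis
        using expected_recursion[OF t noise_drift_bound[OF t], unfolded coeffs(2-4),
            unfolded coeffs(1) diff_Suc_1] .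
    qed
    \<comment> \<open>The previous iterate has weight \<open>1 - \<beta> 1 = 0\<close>, so
      \<open>x 1 = z 1\<close>.\<close>
    show "?r 1 \<le> ?v 1" using x_dist_recursion[of 1] by simp
    show "?r (Suc t) \<le> real t / (real t + 3) * ?r t + 3 / (real t + 3) * ?v (Suc t)" for t
    proof -
      have coeffs: "\<beta> (Suc t) = 3 / (real t + 3)" "1 - \<beta> (Suc t) = real t / (real t + 3)"
        by (simp_all add: field_simps)
      show ?thesis
        using x_dist_recursion[of "Suc t", unfolded coeffs(2), unfolded coeffs(1)] by simp
    qed
    show "?e t \<le> 4 * ?v t + 4 * ?r t" for t by (rule spread_bound)
    show "144 * real k * Kbar\<^sup>2 / m \<le> \<eta>\<^sup>2"
      using power_mono[OF \<eta>_ge(3), of 2] nonneg(2) by (simp add: \<eta>K_sq)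
    show "2 * \<sigma>\<^sup>2 * (real k + 2) ^ 3 / m \<le> \<eta>\<^sup>2 * D\<^sup>2"
      using mult_right_mono[OF power_mono[OF \<eta>_ge(4), of 2], of "D\<^sup>2"] nonneg(3) by (simp add: \<eta>S_sq)
    show "18 * (real k + 1) * LL / m \<le> \<eta>" using \<eta>_ge(2) by (simp add: \<eta>L_def)
  qed (use L_nonneg LL_nonneg \<eta>_pos D m k \<eta>_ge Kbar_sq in auto)
  have "(real k + 1) * (real k + 2) * ?a k
      \<le> 3 * \<eta> * D\<^sup>2 + 4 / 9 * L * D\<^sup>2 + 3 * (\<eta>S\<^sup>2 * D\<^sup>2) / \<eta> + 3 * \<eta>K\<^sup>2 * D\<^sup>2 / \<eta>"
    using mom.a_le unfolding \<eta>K_sq \<eta>S_sq .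
  \<comment> \<open>In the first term the maximum is replaced by the sum of its entries; in the
    quotients one factor of the square is at most \<open>\<eta>\<close> and cancels. This doubles
    the shares of \<open>\<eta>K\<close> and \<open>\<eta>S\<close> to 6, while
    \<open>12 + 4 / 9\<close> is rounded up to 13.\<close>
  also have "\<dots> \<le> 3 * (4 * L + \<eta>L + \<eta>K + \<eta>S) * D\<^sup>2 + L * D\<^sup>2 + 3 * \<eta>S * D\<^sup>2 + 3 * \<eta>K * D\<^sup>2"
  proof (intro add_mono)
    have sq: "3 * (s\<^sup>2 * d) / \<eta> \<le> 3 * s * d" if "0 \<le> s" "s \<le> \<eta>" "0 \<le> d" for s d :: real
      using mult_left_mono[OF that(2), of "s * d"] that \<eta>_pos
      by (simp add: field_simps power2_eq_square)
    show "3 * (\<eta>S\<^sup>2 * D\<^sup>2) / \<eta> \<le> 3 * \<eta>S * D\<^sup>2" using sq nonneg(3) \<eta>_ge(4) by simp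
    show "3 * \<eta>K\<^sup>2 * D\<^sup>2 / \<eta> \<le> 3 * \<eta>K * D\<^sup>2" using sq[of \<eta>K "D\<^sup>2"] nonneg(2) \<eta>_ge(3) by simp
    show "3 * \<eta> * D\<^sup>2 \<le> 3 * (4 * L + \<eta>L + \<eta>K + \<eta>S) * D\<^sup>2"
      using \<eta>_le by (intro mult_right_mono) auto
    show "4 / 9 * L * D\<^sup>2 \<le> L * D\<^sup>2" using L_nonneg by (intro mult_right_mono) auto
  qed
  also have "\<dots> = 13 * L * D\<^sup>2 + 3 * \<eta>L * D\<^sup>2 + 6 * \<eta>K * D\<^sup>2 + 6 * \<eta>S * D\<^sup>2"
    by (simp add: algebra_simps)
  finally have "?a k * ((real k + 1) * (real k + 2))
      \<le> 13 * L * D\<^sup>2 + 3 * \<eta>L * D\<^sup>2 + 6 * \<eta>K * D\<^sup>2 + 6 * \<eta>S * D\<^sup>2"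
    by (simp only: mult_ac)
  then have "?a k \<le> (13 * L * D\<^sup>2 + 3 * \<eta>L * D\<^sup>2 + 6 * \<eta>K * D\<^sup>2 + 6 * \<eta>S * D\<^sup>2) / ((real k + 1) * (real k + 2))"
    by (subst pos_le_divide_eq) auto
  also have "\<dots> = 13 * L * D\<^sup>2 / ((real k + 1) * (real k + 2)) + 3 * \<eta>L * D\<^sup>2 / ((real k + 1) * (real k + 2))
      + 6 * \<eta>K * D\<^sup>2 / ((real k + 1) * (real k + 2)) + 6 * \<eta>S * D\<^sup>2 / ((real k + 1) * (real k + 2))"
    by (simp only: add_divide_distrib)
  also have "\<dots> \<le> 13 * L * D\<^sup>2 / ((real k + 1) * (real k + 2)) + 54 * LL * D\<^sup>2 / ((real k + 2) * real m)
      + 72 * Kbar * D\<^sup>2 / ((real k + 2) * sqrt ((real k + 1) * real m))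
      + 4 * \<sigma> * D * sqrt 6 / sqrt ((real k + 1) * real m)"
  proof (intro add_mono order_refl)
    show "3 * \<eta>L * D\<^sup>2 / ((real k + 1) * (real k + 2)) \<le> 54 * LL * D\<^sup>2 / ((real k + 2) * real m)"
    proof -
      have "3 * (18 * p * l / n) * d / (p * q) = 54 * l * d / (q * n)" if "p > 0" for p l n d q :: real
        using that by (simp add: field_simps)
      from this[of "real k + 1"] show ?thesis unfolding \<eta>L_def by simp
    qed
    show "6 * \<eta>K * D\<^sup>2 / ((real k + 1) * (real k + 2))
        \<le> 72 * Kbar * D\<^sup>2 / ((real k + 2) * sqrt ((real k + 1) * real m))"
    proof -
      have "72 * D\<^sup>2 / (real k + 2) * (sqrt (real k * Kbar\<^sup>2 / real m) / (real k + 1))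
          \<le> 72 * D\<^sup>2 / (real k + 2) * (Kbar / sqrt ((real k + 1) * real m))"
        using Kbar_pos m0 by (intro mult_left_mono sqrt_ratio_le) auto
      then show ?thesis by (simp add: \<eta>K_def mult_ac)
    qed
    show "6 * \<eta>S * D\<^sup>2 / ((real k + 1) * (real k + 2)) \<le> 4 * \<sigma> * D * sqrt 6 / sqrt ((real k + 1) * real m)"
    proof -
      have "\<sigma> * D * (6 * sqrt (2 * (real k + 2) ^ 3 / real m) / ((real k + 1) * (real k + 2)))
          \<le> \<sigma> * D * (4 * sqrt 6 / sqrt ((real k + 1) * real m))"
        using k m0 \<sigma>_nonneg D(1) by (intro mult_left_mono sqrt_cube_ratio_le) auto
      then show ?thesis using D(1) by (simp add: \<eta>S_def power2_eq_square mult_ac)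
    qed
  qed
  finally have bound: "?a k \<le> 13 * L * D\<^sup>2 / ((real k + 1) * (real k + 2)) + 54 * LL * D\<^sup>2 / ((real k + 2) * real m)
      + 72 * Kbar * D\<^sup>2 / ((real k + 2) * sqrt ((real k + 1) * real m))
      + 4 * \<sigma> * D * sqrt 6 / sqrt ((real k + 1) * real m)" .
  have reals: "real (k + 1) = real k + 1" "real (k + 2) = real k + 2"
    "real ((k + 1) * (k + 2)) = (real k + 1) * (real k + 2)" "real ((k + 2) * m) = (real k + 2) * real m"
    "real ((k + 1) * m) = (real k + 1) * real m"
    by (simp_all add: algebra_simps)
  show ?thesis
    using mom.v_le_3 div_star_integrable gap_integrable bound unfolding reals by auto
qed

end
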